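(* In the setting described in the context, $\mathrm{Span}\{\phi_{u-e_1}: u\in K\}\cap\mathrm{im}(\partial_1)=\{0\}$, where $\partial_1:\mathrm{Sol}(A(\eta+\alpha))\to\mathrm{Sol}(\beta)$ is $\varphi\mapsto\partial\varphi/\partial x_1$.
   Context: Let $A=(a_{ij})$ be a $d\times n$ integer matrix whose columns are distinct elements of $\{1\}\times\mathbb{Z}^{d-1}$ generating $\mathbb{Z}^d$; $m=n-d$. $I_A=\langle\partial^u-\partial^v:u,v\in\mathbb{N}^n,Au=Av\rangle$ is assumed generic (minimal generating set of binomials in which every variable occurs) and not Cohen–Macaulay; $\mathrm{in}_{-e_1}(I_A)$ is then monomial. $B$ is an $n\times m$ integer matrix whose columns form a $\mathbb{Z}$-basis of $\ker_{\mathbb{Z}}A$. Standard pairs of a monomial ideal $M$: pairs $(\partial^\eta,\sigma)$, $\eta\in\mathbb{N}^n$, with $\eta_i=0$ for $i\in\sigma$, $\partial^\eta\prod_{i\in\sigma}\partial_i^{\mu_i}\notin M$ for all $\mu_i\ge0$, and for each $l\notin\sigma$ some $\partial^\eta\partial_l^{\mu_l}\prod_{i\in\sigma}\partial_i^{\mu_i}\in M$; embedded if $\langle\partial_j:j\notin\sigma\rangle$ is not a minimal prime of $M$. Let $\tau=\{m+3,\dots,n\}$ and $(\partial^\eta,\{1\}\cup\tau)$ an embedded standard pair of $\mathrm{in}_{-e_1}(I_A)$ such that (i) either $\{y\in\mathbb{R}^m:(By)_j\le\eta_j, 2\le j\le m+2, (By)_1\ge0\}$ is bounded, or for some $r\in\{2,\dots,m+2\}$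 the hyperplanes $\{(By)_r=0\}$ and $\{(By)_1=0\}$ coincide; (ii) whenever $(\partial^\mu,\{1\}\cup\tau)$ is a standard pair of $\mathrm{in}_{-e_1}(I_A)$ and $y\in\mathbb{C}^m$ with $\mu_i=\eta_i-(By)_i$ ($2\le i\le m+2$) and $(By)_1\in\mathbb{Z}$, then $(By)_1\le0$. Let $\alpha=\sum_{i\in\tau}\alpha_ie_i$, $\alpha_i\in\mathbb{C}$ generic, and $\beta=A(\eta+\alpha-e_1)$. $H_A(\gamma)$ is the left ideal of the Weyl algebra generated by $I_A$ and $\sum_ja_{ij}x_j\partial_j-\gamma_i$; $\mathrm{Sol}(\gamma)$ denotes its space of holomorphic, possibly multivalued, solutions on a fixed open set where the canonical series with respect to $-e_1$ converge. A fake exponent of $H_A(\gamma)$ w.r.t. $-e_1$ is $v\in\mathbb{C}^n$ with $Av=\gamma$ and $v_i=\mu_i$ for $i\notin\sigma$ for some standard pair $(\partial^\mu,\sigma)$ of $\mathrm{in}_{-e_1}(I_A)$. $\mathrm{nsupp}(v)=\{i:v_i\in\mathbb{Z}_{<0}\}$; $v$ has minimal negative support if for all $u\in\ker_{\mathbb{Z}}A$, $\mathrm{nsupp}(v-u)\subseteq\mathrm{nsupp}(v)$ implies equality; for such $v$, $N_v=\{u\in\ker_{\mathbb{Z}}A:\mathrm{nsupp}(v-u)=\mathrm{nsupp}(v)\}$ and $\phi_v=\sum_{-u\in N_v}\frac{[v]_{u_-}}{[u+v]_{u_+}}x^{v+u}$ with $[v]_{u_-}=\prod_{i:u_i<0}\prod_{j=1}^{-u_i}(v_i-j+1)$,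 $[u+v]_{u_+}=\prod_{i:u_i>0}\prod_{j=1}^{u_i}(v_i+j)$ (a solution of $H_A(Av)$ when $v$ is a fake exponent). $F$ is the set of fake exponents of $H_A(A(\eta+\alpha))$ w.r.t. $-e_1$ with minimal negative support, and $K=\{u\in F:u_1=0\}$; for $u\in K$, $u-e_1$ is a fake exponent of $H_A(\beta)$ with minimal negative support. *)

theory Defs
  imports
    "HOL-Analysis.Analysis"
    "HOL-Library.Poly_Mapping"
    "HOL-Library.Function_Algebras"
    "HOL-Library.Extended_Nat"
begin

text \<open>Coordinates, rows and columns are indexed by finite linearly ordered types. The positions
  \<open>1, 2, \<dots>\<close> of the usual notation are counted along that order.\<close>

definition idx :: "nat \<Rightarrow> 'k::{finite,linorder}" where
  "idx j = sorted_list_of_set UNIV ! (j - 1)"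

definition of_nat_vec :: "nat^'n \<Rightarrow> 'a::semiring_1^'n" where
  "of_nat_vec u = (\<chi> i. of_nat (u $ i))"

definition of_int_vec :: "int^'n \<Rightarrow> 'a::ring_1^'n" where
  "of_int_vec u = (\<chi> i. of_int (u $ i))"

abbreviation of_int_mat :: "int^'n^'d \<Rightarrow> 'a::ring_1^'n^'d" where
  "of_int_mat A \<equiv> map_matrix of_int A"

definition kerZ :: "int^'n^'d \<Rightarrow> (int^'n) set" where
  "kerZ A = {u. A *v u = 0}"


section \<open>Ideals of commutative rings\<close>

definition ideal_gen :: "'r::comm_ring_1 set \<Rightarrow> 'r set" where
  "ideal_gen S = module.span (*) S"

definition is_ideal :: "'r::comm_ring_1 set \<Rightarrow> bool" where
  "is_ideal I \<longleftrightarrow> module.subspace (*) I"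

definition is_prime_ideal :: "'r::comm_ring_1 set \<Rightarrow> bool" where
  "is_prime_ideal P \<longleftrightarrow> is_ideal P \<and> P \<noteq> UNIV \<and> (\<forall>a b. a * b \<in> P \<longrightarrow> a \<in> P \<or> b \<in> P)"

definition is_maximal_ideal :: "'r::comm_ring_1 set \<Rightarrow> bool" where
  "is_maximal_ideal P \<longleftrightarrow>
     is_ideal P \<and> P \<noteq> UNIV \<and> (\<forall>J. is_ideal J \<and> P \<subseteq> J \<longrightarrow> J = P \<or> J = UNIV)"

definition is_minimal_prime_of :: "'r::comm_ring_1 set \<Rightarrow> 'r set \<Rightarrow> bool" where
  "is_minimal_prime_of P M \<longleftrightarrow>
     is_prime_ideal P \<and> M \<subseteq> P \<and> (\<forall>Q. is_prime_ideal Q \<and> M \<subseteq> Q \<and> Q \<subseteq> P \<longrightarrow> Q = P)"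

text \<open>The Cohen--Macaulay property of the quotient ring \<open>S/I\<close>: every maximal ideal of \<open>S/I\<close> has
  depth equal to its codimension. Elements and ideals of \<open>S/I\<close> are written as elements of \<open>S\<close> and
  as ideals of \<open>S\<close> containing \<open>I\<close>.\<close>

definition regular_sequence_mod :: "'r::comm_ring_1 set \<Rightarrow> 'r list \<Rightarrow> bool" where
  "regular_sequence_mod I xs \<longleftrightarrow>
     ideal_gen (I \<union> set xs) \<noteq> UNIV \<and>
     (\<forall>i<length xs. \<forall>s. xs ! i * s \<in> ideal_gen (I \<union> set (take i xs))
                       \<longrightarrow> s \<in> ideal_gen (I \<union> set (take i xs)))"

definition depth_mod :: "'r::comm_ring_1 set \<Rightarrow> 'r set \<Rightarrow> enat" where
  "depth_mod I P = (SUP xs \<in> {xs. set xs \<subseteq> P \<and> regular_sequence_mod I xs}. enat (length xs))"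

definition codim_mod :: "'r::comm_ring_1 set \<Rightarrow> 'r set \<Rightarrow> enat" where
  "codim_mod I P =
     (SUP Qs \<in> {Qs. Qs \<noteq> [] \<and> sorted_wrt (\<subset>) Qs \<and> last Qs = P \<and>
                   (\<forall>Q \<in> set Qs. is_prime_ideal Q \<and> I \<subseteq> Q)}. enat (length Qs - 1))"

definition cohen_macaulay_mod :: "'r::comm_ring_1 set \<Rightarrow> bool" where
  "cohen_macaulay_mod I \<longleftrightarrow>
     (\<forall>P. is_maximal_ideal P \<and> I \<subseteq> P \<longrightarrow> depth_mod I P = codim_mod I P)"


section \<open>Toric ideals, initial ideals, standard pairs\<close>

text \<open>The polynomial ring \<open>\<complex>[\<partial>\<^sub>1, \<dots>, \<partial>\<^sub>n]\<close>: finitely supported coefficient functions on exponent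
  vectors, with convolution as product.\<close>

type_synonym 'n dpoly = "(nat^'n) \<Rightarrow>\<^sub>0 complex"

definition dmon :: "nat^'n::finite \<Rightarrow> 'n dpoly" where
  "dmon u = Poly_Mapping.single u 1"

definition toric_ideal :: "int^'n::finite^'d \<Rightarrow> 'n dpoly set" where
  "toric_ideal A =
     ideal_gen {dmon u - dmon v | u v. A *v of_nat_vec u = A *v of_nat_vec v}"

definition generic_binomial_ideal :: "'n::finite dpoly set \<Rightarrow> bool" where
  "generic_binomial_ideal I \<longleftrightarrow>
     (\<exists>G. G \<subseteq> {dmon u - dmon v | u v. \<forall>i. u $ i > 0 \<or> v $ i > 0} \<and>
          ideal_gen G = I \<and> (\<forall>G'. G' \<subset> G \<longrightarrow> ideal_gen G' \<noteq> I))"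

definition weight :: "int^'n::finite \<Rightarrow> nat^'n \<Rightarrow> int" where
  "weight w a = (\<Sum>i\<in>UNIV. w $ i * int (a $ i))"

definition initial_form :: "int^'n::finite \<Rightarrow> 'n dpoly \<Rightarrow> 'n dpoly" where
  "initial_form w f =
     (\<Sum>a \<in> {a \<in> Poly_Mapping.keys f. \<forall>b \<in> Poly_Mapping.keys f. weight w b \<le> weight w a}.
        Poly_Mapping.single a (Poly_Mapping.lookup f a))"

definition initial_ideal :: "int^'n::finite \<Rightarrow> 'n dpoly set \<Rightarrow> 'n dpoly set" where
  "initial_ideal w I = ideal_gen (initial_form w ` I)"

definition standard_pair :: "'n::finite dpoly set \<Rightarrow> nat^'n \<Rightarrow> 'n set \<Rightarrow> bool" where
  "standard_pair M \<eta> \<sigma> \<longleftrightarrow>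
     (\<forall>i\<in>\<sigma>. \<eta> $ i = 0) \<and>
     (\<forall>\<mu>. {i. \<mu> $ i \<noteq> 0} \<subseteq> \<sigma> \<longrightarrow> dmon (\<eta> + \<mu>) \<notin> M) \<and>
     (\<forall>l. l \<notin> \<sigma> \<longrightarrow> (\<exists>\<mu>. {i. \<mu> $ i \<noteq> 0} \<subseteq> insert l \<sigma> \<and> dmon (\<eta> + \<mu>) \<in> M))"

definition embedded_standard_pair :: "'n::finite dpoly set \<Rightarrow> nat^'n \<Rightarrow> 'n set \<Rightarrow> bool" where
  "embedded_standard_pair M \<eta> \<sigma> \<longleftrightarrow>
     standard_pair M \<eta> \<sigma> \<and>
     \<not> is_minimal_prime_of (ideal_gen {dmon (axis j 1) | j. j \<notin> \<sigma>}) M"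


section \<open>Hypergeometric systems and their solutions\<close>

text \<open>Multivalued functions of \<open>x \<in> (\<complex>\<^sup>*)\<^sup>n\<close> are written in logarithmic coordinates
  \<open>x\<^sub>j = exp z\<^sub>j\<close>, as functions of \<open>z\<close> on an open set \<open>W\<close> of \<open>\<complex>\<^sup>n\<close> lying over a domain \<open>U = exp W\<close>.
  If \<open>U\<close> is given by \<open>(log |x\<^sub>1|, \<dots>, log |x\<^sub>n|) \<in> C\<close> with \<open>C\<close> open and convex, as the usual domains of
  convergence of canonical series are, then its full preimage \<open>W = {z. Re z \<in> C}\<close> is the universal
  cover of \<open>U\<close>, so holomorphic functions on \<open>W\<close> are exactly the multivalued holomorphic functions
  on \<open>U\<close>. If \<open>exp\<close> is injective on \<open>W\<close>, they are single-valued branches on \<open>U\<close>.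
  All functions are extended by \<open>0\<close> outside \<open>W\<close>.\<close>

definition holomorphic_Cn :: "(complex^'n) set \<Rightarrow> (complex^'n \<Rightarrow> complex) \<Rightarrow> bool" where
  "holomorphic_Cn W f \<longleftrightarrow>
     (\<forall>z\<in>W. \<exists>D. (f has_derivative D) (at z) \<and> (\<forall>c v. D (c *s v) = c * D v))"

text \<open>The derivative \<open>\<partial>/\<partial>x\<^sub>j\<close>; by the chain rule it is \<open>exp (-z\<^sub>j) \<partial>/\<partial>z\<^sub>j\<close>.\<close>

definition dx :: "(complex^'n) set \<Rightarrow> 'n \<Rightarrow> (complex^'n \<Rightarrow> complex) \<Rightarrow> complex^'n \<Rightarrow> complex" where
  "dx W j f z = (if z \<in> W then exp (- (z $ j)) * deriv (\<lambda>t. f (z + axis j t)) 0 else 0)"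

type_synonym 'n operator = "(complex^'n \<Rightarrow> complex) \<Rightarrow> (complex^'n \<Rightarrow> complex)"

text \<open>The Weyl algebra in its (faithful) action on holomorphic functions.\<close>

inductive_set weyl_algebra :: "(complex^'n) set \<Rightarrow> 'n operator set" for W :: "(complex^'n) set" where
  const: "(\<lambda>f z. c * f z) \<in> weyl_algebra W"
| var: "(\<lambda>f z. exp (z $ j) * f z) \<in> weyl_algebra W"
| deriv: "dx W j \<in> weyl_algebra W"
| add: "P \<in> weyl_algebra W \<Longrightarrow> Q \<in> weyl_algebra W \<Longrightarrow> P + Q \<in> weyl_algebra W"
| mult: "P \<in> weyl_algebra W \<Longrightarrow> Q \<in> weyl_algebra W \<Longrightarrow> P \<circ> Q \<in> weyl_algebra W"

inductive_set weyl_left_ideal :: "(complex^'n) set \<Rightarrow> 'n operator set \<Rightarrow> 'n operator set"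
  for W :: "(complex^'n) set" and S :: "'n operator set" where
  zero: "0 \<in> weyl_left_ideal W S"
| gen: "P \<in> S \<Longrightarrow> P \<in> weyl_left_ideal W S"
| add: "P \<in> weyl_left_ideal W S \<Longrightarrow> Q \<in> weyl_left_ideal W S \<Longrightarrow> P + Q \<in> weyl_left_ideal W S"
| mult: "Q \<in> weyl_algebra W \<Longrightarrow> P \<in> weyl_left_ideal W S \<Longrightarrow> Q \<circ> P \<in> weyl_left_ideal W S"

definition dmon_op :: "(complex^'n::{finite,linorder}) set \<Rightarrow> nat^'n::{finite,linorder} \<Rightarrow> 'n operator" where
  "dmon_op W a = foldr (\<lambda>j P. (dx W j ^^ (a $ j)) \<circ> P) (sorted_list_of_set UNIV) id"

definition dpoly_op :: "(complex^'n::{finite,linorder}) set \<Rightarrow> 'n dpoly \<Rightarrow> 'n operator" where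
  "dpoly_op W p f z = (\<Sum>a \<in> Poly_Mapping.keys p. Poly_Mapping.lookup p a * dmon_op W a f z)"

definition euler_op ::
    "(complex^'n::finite) set \<Rightarrow> int^'n^'d \<Rightarrow> complex^'d \<Rightarrow> 'd \<Rightarrow> 'n operator" where
  "euler_op W A \<gamma> i f z =
     (\<Sum>j\<in>UNIV. of_int (A $ i $ j) * (exp (z $ j) * dx W j f z)) - \<gamma> $ i * f z"

definition H_A ::
    "(complex^'n::{finite,linorder}) set \<Rightarrow> int^'n::{finite,linorder}^'d \<Rightarrow> complex^'d \<Rightarrow> 'n operator set" where
  "H_A W A \<gamma> = weyl_left_ideal W (dpoly_op W ` toric_ideal A \<union> range (euler_op W A \<gamma>))"

definition Sol ::
    "(complex^'n::{finite,linorder}) set \<Rightarrow> int^'n::{finite,linorder}^'d \<Rightarrow> complex^'d \<Rightarrow>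
     (complex^'n::{finite,linorder} \<Rightarrow> complex) set" where
  "Sol W A \<gamma> =
     {f. holomorphic_Cn W f \<and> (\<forall>z. z \<notin> W \<longrightarrow> f z = 0) \<and> (\<forall>P \<in> H_A W A \<gamma>. P f = 0)}"

definition complex_span :: "('x \<Rightarrow> complex) set \<Rightarrow> ('x \<Rightarrow> complex) set" where
  "complex_span S = module.span (\<lambda>c f x. c * f x) S"


section \<open>Fake exponents and canonical series\<close>

definition fake_exponents ::
    "int^'n::finite \<Rightarrow> int^'n^'d \<Rightarrow> complex^'d \<Rightarrow> (complex^'n) set" where
  "fake_exponents w A \<gamma> =
     {v. of_int_mat A *v v = \<gamma> \<and>
         (\<exists>\<mu> \<sigma>. standard_pair (initial_ideal w (toric_ideal A)) \<mu> \<sigma> \<and>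
                 (\<forall>i. i \<notin> \<sigma> \<longrightarrow> v $ i = of_nat (\<mu> $ i)))}"

definition nsupp :: "complex^'n \<Rightarrow> 'n set" where
  "nsupp v = {i. \<exists>k::int. k < 0 \<and> v $ i = of_int k}"

definition minimal_negative_support :: "int^'n::finite^'d \<Rightarrow> complex^'n \<Rightarrow> bool" where
  "minimal_negative_support A v \<longleftrightarrow>
     (\<forall>u \<in> kerZ A. nsupp (v - of_int_vec u) \<subseteq> nsupp v \<longrightarrow> nsupp (v - of_int_vec u) = nsupp v)"

definition N_set :: "int^'n::finite^'d \<Rightarrow> complex^'n \<Rightarrow> (int^'n) set" where
  "N_set A v = {u \<in> kerZ A. nsupp (v - of_int_vec u) = nsupp v}"

definition phi_coeff :: "complex^'n::finite \<Rightarrow> int^'n \<Rightarrow> complex" where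
  "phi_coeff v u =
     (\<Prod>i\<in>{i. u $ i < 0}. \<Prod>j=1..nat (- (u $ i)). v $ i - of_nat j + 1) /
     (\<Prod>i\<in>{i. u $ i > 0}. \<Prod>j=1..nat (u $ i). v $ i + of_nat j)"

definition phi_term :: "complex^'n::finite \<Rightarrow> complex^'n \<Rightarrow> int^'n \<Rightarrow> complex" where
  "phi_term v z u = phi_coeff v u * exp (\<Sum>i\<in>UNIV. (v $ i + of_int (u $ i)) * z $ i)"

definition phi ::
    "(complex^'n::finite) set \<Rightarrow> int^'n^'d \<Rightarrow> complex^'n \<Rightarrow> complex^'n \<Rightarrow> complex" where
  "phi W A v z = (if z \<in> W then \<Sum>\<^sub>\<infinity>u\<in>{u. - u \<in> N_set A v}. phi_term v z u else 0)"

definition phi_converges_on ::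
    "(complex^'n::finite) set \<Rightarrow> int^'n^'d \<Rightarrow> complex^'n \<Rightarrow> bool" where
  "phi_converges_on W A v \<longleftrightarrow> (\<forall>z\<in>W. phi_term v z summable_on {u. - u \<in> N_set A v})"

definition minimal_fake_exponents ::
    "int^'n::finite \<Rightarrow> int^'n^'d \<Rightarrow> complex^'d \<Rightarrow> (complex^'n) set" where
  "minimal_fake_exponents w A \<gamma> = {v \<in> fake_exponents w A \<gamma>. minimal_negative_support A v}"


section \<open>Generic parameters\<close>

text \<open>\<open>P\<close> holds for generic \<open>\<alpha> \<in> \<complex>\<^sup>T\<close>: off a countable union of proper affine hyperplanes
  \<open>\<Sum>i\<in>T. c\<^sub>i \<alpha>\<^sub>i = b\<close>, \<open>c \<noteq> 0\<close>, of \<open>\<complex>\<^sup>T\<close>. A finite union would not suffice for conditions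
  such as \<open>\<alpha>\<^sub>i \<notin> \<int>\<close>.\<close>

definition for_generic :: "'n::finite set \<Rightarrow> (complex^'n \<Rightarrow> bool) \<Rightarrow> bool" where
  "for_generic T P \<longleftrightarrow>
     (\<exists>H :: ((complex^'n) \<times> complex) set.
        countable H \<and> (\<forall>(c, b) \<in> H. \<exists>i\<in>T. c $ i \<noteq> 0) \<and>
        (\<forall>\<alpha>. (\<forall>i. i \<notin> T \<longrightarrow> \<alpha> $ i = 0) \<and> (\<forall>(c, b) \<in> H. (\<Sum>i\<in>T. c $ i * \<alpha> $ i) \<noteq> b) \<longrightarrow> P \<alpha>))"

end

theory Submission
  imports Defs "HOL-Complex_Analysis.Conformal_Mappings"
begin

text \<open>
  Suppose \<open>\<partial>\<^sub>1 f\<close> is a combination of the series \<open>\<phi>\<^bsub>u - e\<^sub>1\<^esub>\<close>, \<open>u \<in> K\<close>. The part of \<open>x\<^sub>1 \<partial>\<^sub>1 f\<close> of degree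
  \<open>0\<close> in \<open>x\<^sub>1\<close> is the finite sum \<open>\<Sum>\<^sub>u c\<^sub>u x\<^sup>u\<close>, all other terms having negative degree in \<open>x\<^sub>1\<close>. Fix
  \<open>u \<in> K\<close>. If \<open>\<partial>\<^sup>p\<close> lies in the initial ideal, then \<open>\<partial>\<^sup>p f = \<partial>\<^sup>q f\<close> with \<open>\<partial>\<^sub>1\<close> dividing \<open>\<partial>\<^sup>q\<close>, so
  \<open>x\<^sup>p \<partial>\<^sup>p f\<close>, a polynomial in the \<open>\<theta>\<^sub>j = x\<^sub>j \<partial>\<^sub>j\<close> applied to \<open>f\<close>, has negative degree in \<open>x\<^sub>1\<close> as well.
  Call \<open>j\<close> good if such a \<open>p\<close> exists for which this polynomial is \<open>(\<theta>\<^sub>j - u\<^sub>j) T\<^sub>j\<close> with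
  \<open>T\<^sub>j(u) \<noteq> 0\<close>. Condition (i) forces the column \<open>a\<^sub>1\<close> to lie outside the span of the columns \<open>a\<^sub>j\<close>
  with \<open>j \<noteq> 1\<close> not good, so the Euler operators yield
  \<open>\<theta>\<^sub>1 f = - \<Sum>\<^sub>j w\<^sub>j (\<theta>\<^sub>j - u\<^sub>j) f\<close>, summed over good \<open>j\<close>. Applying \<open>T = \<Prod>\<^sub>j T\<^sub>j\<close> makes the
  right-hand side negative in \<open>x\<^sub>1\<close>, and comparing coefficients of \<open>x\<^sup>u\<close> gives \<open>c\<^sub>u T(u) = 0\<close>.
  Condition (ii) is needed for \<open>u - e\<^sub>1\<close> to have minimal negative support, hence for the
  convergence of \<open>\<phi>\<^bsub>u - e\<^sub>1\<^esub>\<close>.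
\<close>

text \<open>The obstacle is that only \<theta>_1 f, not f, has a known expansion. Relations for f
  are therefore used only where \<partial>^p f = \<partial>^q f turns them into operators applied to
  \<theta>_1 f. Genericity of the ideal makes the largest exponent of \<partial>_1 in a fibre
  uniquely attained, so standard pairs become statements on integer kernel vectors
  (\<open>optimal\<close>); faces of standard pairs then have independent columns, hence at most d
  elements. Genericity of \<alpha> is used as independence over the rationals: the irrational
  coordinates of u span the columns of \<tau>. So the free coordinates of u form a face with d
  elements, outside which every index is good, or exactly {1} with \<tau>. In the second case
  condition (i), with the maximality of the given standard pair, leaves at most one index outside
  that is not good, which keeps the columns independent. Coefficients are compared only in degree 0
  of x_1, through a power series in 1/x_1; the finitely many exponents of that degree are separated
  by extra factors of T.\<close>

section \<open>The initial ideal of a generic toric ideal\<close>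

lemma module_times: "module ((*) :: 'r::comm_ring_1 \<Rightarrow> 'r \<Rightarrow> 'r)"
  by unfold_locales (simp_all add: algebra_simps)

lemma ideal_gen_base: "x \<in> S \<Longrightarrow> x \<in> ideal_gen S"
  unfolding ideal_gen_def by (rule module.span_base[OF module_times])

lemma ideal_gen_induct [consumes 1, case_names zero step]:
  assumes "x \<in> ideal_gen S" "P 0" "\<And>c x y. x \<in> S \<Longrightarrow> P y \<Longrightarrow> P (c * x + y)"
  shows "P x"
  using assms unfolding ideal_gen_def by (rule module.span_induct_alt[OF module_times])

lemma of_nat_vec_add: "of_nat_vec (a + b) = of_nat_vec a + (of_nat_vec b :: 'a::semiring_1^'n)"
  by (simp add: of_nat_vec_def vec_eq_iff)

lemma keys_dmon_diff:
  assumes "u \<noteq> v"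
  shows "Poly_Mapping.keys (dmon u - dmon v) = {u, v}"
  using assms by (auto simp: dmon_def in_keys_iff lookup_minus lookup_single when_def split: if_splits)

text \<open>The exponent vectors of the monomials that do not have the largest exponent of \<open>\<partial>\<^sub>i\<close> in
  their fibre; see \<open>dmon_mem_initial_ideal_iff\<close>.\<close>

definition improvable :: "int^'n^'d \<Rightarrow> 'n::finite \<Rightarrow> nat^'n \<Rightarrow> bool" where
  "improvable A i a \<longleftrightarrow> (\<exists>b. A *v of_nat_vec b = A *v of_nat_vec a \<and> a $ i < b $ i)"

lemma improvable_add: "improvable A i a \<Longrightarrow> improvable A i (a + c)"
  unfolding improvable_def
  by (metis add_less_cancel_right matrix_vector_right_distrib of_nat_vec_add vector_add_component)

text \<open>The coefficient at exponent \<open>t\<close> of the image of \<open>f\<close> under the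
  monomial map \<partial>^u -> s^(Au), which vanishes on the toric ideal.\<close>

definition fibre_sum :: "int^'n^'d \<Rightarrow> int^'d \<Rightarrow> 'n::finite dpoly \<Rightarrow> complex" where
  "fibre_sum A t f =
     (\<Sum>a\<in>Poly_Mapping.keys f. if A *v of_nat_vec a = t then Poly_Mapping.lookup f a else 0)"

lemma fibre_sum_add: "fibre_sum A t (f + g) = fibre_sum A t f + fibre_sum A t g"
  unfolding fibre_sum_def by (rule setsum_keys_plus_distrib) auto

lemma fibre_sum_sum: "fibre_sum A t (\<Sum>x\<in>X. f x) = (\<Sum>x\<in>X. fibre_sum A t (f x))"
  by (induction X rule: infinite_finite_induct) (auto simp: fibre_sum_add fibre_sum_def[of _ _ 0])

lemma fibre_sum_single:
  "fibre_sum A t (Poly_Mapping.single a r) = (if A *v of_nat_vec a = t then r else 0)"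
  by (simp add: fibre_sum_def)

lemma fibre_sum_uminus: "fibre_sum A t (- f) = - fibre_sum A t f"
  using fibre_sum_add[of A t f "- f"] by (simp add: fibre_sum_def[of _ _ 0] add_eq_0_iff)

lemma fibre_sum_diff: "fibre_sum A t (f - g) = fibre_sum A t f - fibre_sum A t g"
  using fibre_sum_add[of A t f "- g"] by (simp add: fibre_sum_uminus)

lemma poly_mapping_sum_single:
  "c = (\<Sum>a\<in>Poly_Mapping.keys c. Poly_Mapping.single a (Poly_Mapping.lookup c a))"
  by (rule poly_mapping_eqI)
    (simp add: lookup_sum lookup_single when_def sum.delta' in_keys_iff)

lemma fibre_sum_toric_ideal:
  assumes "f \<in> toric_ideal A"
  shows "fibre_sum A t f = 0"
  using assms unfolding toric_ideal_def
proof (induction rule: ideal_gen_induct)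
  case zero
  show ?case by (simp add: fibre_sum_def)
next
  case (step c x y)
  then obtain u v where x: "x = dmon u - dmon v" and uv: "A *v of_nat_vec u = A *v of_nat_vec v"
    by auto
  have "c * x = (\<Sum>a\<in>Poly_Mapping.keys c. Poly_Mapping.single a (Poly_Mapping.lookup c a)) * x"
    by (simp flip: poly_mapping_sum_single)
  also have "\<dots> = (\<Sum>a\<in>Poly_Mapping.keys c. Poly_Mapping.single (a + u) (Poly_Mapping.lookup c a)
      - Poly_Mapping.single (a + v) (Poly_Mapping.lookup c a))"
    by (simp add: sum_distrib_right x dmon_def right_diff_distrib mult_single sum_subtractf)
  finally have "fibre_sum A t (c * x) = 0"
    by (simp add: fibre_sum_sum fibre_sum_diff fibre_sum_single of_nat_vec_add
        matrix_vector_right_distrib uv)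
  with step show ?case by (simp add: fibre_sum_add)
qed

lemma dmon_diff_mem_toric_ideal_iff:
  "dmon u - dmon v \<in> toric_ideal A \<longleftrightarrow> A *v of_nat_vec u = A *v of_nat_vec v"
proof
  assume "dmon u - dmon v \<in> toric_ideal A"
  from fibre_sum_toric_ideal[OF this, of "A *v of_nat_vec u"]
  show "A *v of_nat_vec u = A *v of_nat_vec v"
    by (auto simp: fibre_sum_diff dmon_def fibre_sum_single split: if_splits)
qed (auto simp: toric_ideal_def intro!: ideal_gen_base)

text \<open>The polynomials all of whose terms free of \<open>\<partial>\<^sub>i\<close> are improvable form an ideal, and it contains
  every generator in which all variables occur.\<close>

lemma generic_toric_ideal_improvable:
  assumes "generic_binomial_ideal (toric_ideal A)" "f \<in> toric_ideal A"
    and "a \<in> Poly_Mapping.keys f" "a $ i = 0"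
  shows "improvable A i a"
proof -
  obtain G where G: "G \<subseteq> {dmon u - dmon v | u v. \<forall>i. u $ i > 0 \<or> v $ i > 0}"
    "ideal_gen G = toric_ideal A"
    using assms(1) unfolding generic_binomial_ideal_def by blast
  have "f \<in> ideal_gen G" using assms(2) G(2) by simp
  then have "\<forall>a\<in>Poly_Mapping.keys f. a $ i = 0 \<longrightarrow> improvable A i a"
  proof (induction rule: ideal_gen_induct)
    case (step c x y)
    obtain u v where x: "x = dmon u - dmon v" and uv: "\<forall>i. u $ i > 0 \<or> v $ i > 0"
      using step(1) G(1) by blast
    have "x \<in> toric_ideal A" using step(1) G(2) ideal_gen_base by auto
    then have A: "A *v of_nat_vec u = A *v of_nat_vec v"
      by (simp add: x dmon_diff_mem_toric_ideal_iff)
    have x_keys: "improvable A i b" if "b \<in> Poly_Mapping.keys x" "b $ i = 0" for b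
    proof (cases "u = v")
      case False
      with that(1) consider "b = u" | "b = v" by (auto simp: x keys_dmon_diff)
      then show ?thesis
        by cases (use A uv that(2) in \<open>metis improvable_def neq0_conv\<close>)+
    qed (use that x in simp)
    show ?case
    proof (intro ballI impI)
      fix a assume a: "a \<in> Poly_Mapping.keys (c * x + y)" "a $ i = 0"
      from a(1) keys_add[of "c * x" y] have "a \<in> Poly_Mapping.keys (c * x) \<or> a \<in> Poly_Mapping.keys y" by blast
      then show "improvable A i a"
      proof
        assume "a \<in> Poly_Mapping.keys (c * x)"
        then obtain b b' where b: "a = b' + b" "b \<in> Poly_Mapping.keys x"
          using keys_mult[of c x] by blast
        with a(2) have "improvable A i b" by (intro x_keys) auto
        then show ?thesis by (simp add: b(1) improvable_add add.commute[of b'])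
      qed (use step a in blast)
    qed
  qed simp
  with assms show ?thesis by blast
qed

text \<open>In the case of equality the common power of \<partial>_i is cancelled from both
  monomials; their difference is a nonzero element of the ideal free of \<partial>_i, to which
  genericity applies. Hence ties do not occur among the maximisers of a fibre.\<close>

lemma improvable_if_ge:
  assumes "generic_binomial_ideal (toric_ideal A)"
    and ab: "A *v of_nat_vec a = A *v of_nat_vec b" "a \<noteq> b" "a $ i \<le> b $ i"
  shows "improvable A i a"
proof (cases "a $ i = b $ i")
  case True
  define c where "c = (\<chi> j. if j = i then a $ i else 0)"
  define a' where "a' = (\<chi> j. if j = i then 0 else a $ j)"
  define b' where "b' = (\<chi> j. if j = i then 0 else b $ j)"
  have eq: "a = a' + c" "b = b' + c"
    by (auto simp: a'_def b'_def c_def vec_eq_iff True)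
  have "a' \<noteq> b'" using ab(2) eq by auto
  moreover have "A *v of_nat_vec a' = A *v of_nat_vec b'"
    using ab(1) by (simp add: eq of_nat_vec_add matrix_vector_right_distrib)
  then have "dmon a' - dmon b' \<in> toric_ideal A" by (simp add: dmon_diff_mem_toric_ideal_iff)
  ultimately have "improvable A i a'"
    using assms(1) by (intro generic_toric_ideal_improvable[where f = "dmon a' - dmon b'"])
      (auto simp: keys_dmon_diff a'_def)
  then show ?thesis unfolding eq(1) by (rule improvable_add)
qed (use ab in \<open>auto simp: improvable_def intro!: exI[of _ b]\<close>)

lemma weight_neg_axis: "weight (- axis i 1) a = - int (a $ i)"
  by (simp add: weight_def axis_def if_distrib[of uminus] if_distrib[of "\<lambda>x. x * _"] sum.delta'
      cong: if_cong)

lemma keys_initial_form: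
  "Poly_Mapping.keys (initial_form w f) \<subseteq>
     {a \<in> Poly_Mapping.keys f. \<forall>b \<in> Poly_Mapping.keys f. weight w b \<le> weight w a}"
  unfolding initial_form_def
  by (rule subset_trans[OF keys_sum]) auto

text \<open>The weight -e_i selects the smallest exponents of \<partial>_i. As fibre sums vanish, a
  selected term shares its fibre with another term of \<open>f\<close>, whose exponent is at least
  as large.\<close>

lemma keys_initial_form_improvable:
  assumes gen: "generic_binomial_ideal (toric_ideal A)" and f: "f \<in> toric_ideal A"
    and a: "a \<in> Poly_Mapping.keys (initial_form (- axis i 1) f)"
  shows "improvable A i a"
proof -
  from a have af: "a \<in> Poly_Mapping.keys f" and min: "\<forall>b\<in>Poly_Mapping.keys f. a $ i \<le> b $ i"
    using keys_initial_form[of "- axis i 1" f] by (auto simp: weight_neg_axis)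
  have "\<exists>b\<in>Poly_Mapping.keys f. b \<noteq> a \<and> A *v of_nat_vec b = A *v of_nat_vec a"
  proof (rule ccontr)
    assume *: "\<not> ?thesis"
    have "fibre_sum A (A *v of_nat_vec a) f =
        (\<Sum>b\<in>Poly_Mapping.keys f. if b = a then Poly_Mapping.lookup f a else 0)"
      unfolding fibre_sum_def by (rule sum.cong) (use * in auto)
    also have "\<dots> \<noteq> 0" using af by (simp add: in_keys_iff)
    finally show False using fibre_sum_toric_ideal[OF f] by simp
  qed
  then show ?thesis using improvable_if_ge[OF gen] min by metis
qed

text \<open>The polynomials with only improvable terms form an ideal containing all initial forms.
  Conversely, a better \<open>b\<close> in the fibre of \<open>a\<close> makes \<partial>^a the
  initial form of \<partial>^a - \<partial>^b.\<close>

lemma dmon_mem_initial_ideal_iff: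
  assumes gen: "generic_binomial_ideal (toric_ideal A)"
  shows "dmon a \<in> initial_ideal (- axis i 1) (toric_ideal A) \<longleftrightarrow> improvable A i a"
proof
  assume "dmon a \<in> initial_ideal (- axis i 1) (toric_ideal A)"
  then have "\<forall>b\<in>Poly_Mapping.keys (dmon a). improvable A i b"
    unfolding initial_ideal_def
  proof (induction rule: ideal_gen_induct)
    case (step c x y)
    have x: "improvable A i b" if "b \<in> Poly_Mapping.keys x" for b
      using step(1) that keys_initial_form_improvable[OF gen] by blast
    show ?case
    proof
      fix b assume "b \<in> Poly_Mapping.keys (c * x + y)"
      then consider "b \<in> Poly_Mapping.keys (c * x)" | "b \<in> Poly_Mapping.keys y"
        using keys_add[of "c * x" y] by blast
      then show "improvable A i b"
      proof cases
        case 1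
        then obtain p q where "b = p + q" "q \<in> Poly_Mapping.keys x"
          using keys_mult[of c x] by blast
        then show ?thesis using x improvable_add[of A i q p] by (simp add: add.commute)
      qed (use step in blast)
    qed
  qed simp
  then show "improvable A i a" by (simp add: dmon_def)
next
  assume "improvable A i a"
  then obtain b where b: "A *v of_nat_vec b = A *v of_nat_vec a" "a $ i < b $ i"
    unfolding improvable_def by blast
  then have ne: "a \<noteq> b" by auto
  have "{c \<in> {a, b}. \<forall>d\<in>{a, b}. weight (- axis i 1) d \<le> weight (- axis i 1) c} = {a}"
    using b(2) by (auto simp: weight_neg_axis)
  then have "initial_form (- axis i 1) (dmon a - dmon b) = dmon a"
    using ne by (simp add: initial_form_def keys_dmon_diff lookup_minus)
      (simp add: dmon_def lookup_single_not_eq)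
  moreover have "dmon a - dmon b \<in> toric_ideal A"
    using b by (simp add: dmon_diff_mem_toric_ideal_iff)
  ultimately show "dmon a \<in> initial_ideal (- axis i 1) (toric_ideal A)"
    unfolding initial_ideal_def by (intro ideal_gen_base) force
qed

section \<open>Standard pairs and optimality\<close>

lemma kerZ_uminus: "k \<in> kerZ A \<Longrightarrow> - k \<in> kerZ A"
  by (simp add: kerZ_def matrix_vector_mult_def vec_eq_iff sum_negf)

lemma kerZ_diff: "k \<in> kerZ A \<Longrightarrow> k' \<in> kerZ A \<Longrightarrow> k - k' \<in> kerZ A"
  by (simp add: kerZ_def matrix_vector_mult_diff_distrib)

lemma kerZ_scale: "k \<in> kerZ A \<Longrightarrow> (c :: int) *s k \<in> kerZ A"
  by (simp add: kerZ_def matrix_vector_mult_def vec_eq_iff mult.left_commute flip: sum_distrib_left)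

text \<open>For \<open>i \<in> \<sigma>\<close> and \<open>\<nu> \<in> \<nat>\<^sup>n\<close>: no monomial \<open>\<partial>\<^sup>\<nu> \<partial>\<^sup>\<mu>\<close> with \<open>\<mu>\<close> supported on \<open>\<sigma>\<close> lies in the
  initial ideal with respect to \<open>- e\<^sub>i\<close>.\<close>

definition optimal :: "int^'n^'d \<Rightarrow> 'n::finite \<Rightarrow> 'n set \<Rightarrow> ('n \<Rightarrow> int) \<Rightarrow> bool" where
  "optimal A i \<sigma> \<nu> \<longleftrightarrow>
     (\<forall>k\<in>kerZ A. 0 \<le> k $ i \<and> (\<forall>j. j \<notin> \<sigma> \<longrightarrow> 0 \<le> \<nu> j + k $ j) \<longrightarrow> k = 0)"

lemma optimalD:
  "optimal A i \<sigma> \<nu> \<Longrightarrow> k \<in> kerZ A \<Longrightarrow> 0 \<le> k $ i \<Longrightarrow> (\<And>j. j \<notin> \<sigma> \<Longrightarrow> 0 \<le> \<nu> j + k $ j) \<Longrightarrow> k = 0"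
  unfolding optimal_def by blast

lemma optimal_zero:
  assumes "optimal A i \<sigma> \<nu>" "\<And>j. j \<notin> \<sigma> \<Longrightarrow> 0 \<le> \<nu> j"
  shows "optimal A i \<sigma> (\<lambda>_. 0)"
  unfolding optimal_def
proof (intro ballI impI)
  fix k assume "k \<in> kerZ A" "0 \<le> k $ i \<and> (\<forall>j. j \<notin> \<sigma> \<longrightarrow> 0 \<le> 0 + k $ j)"
  with assms show "k = 0" by (intro optimalD[OF assms(1)]) auto
qed

lemma optimal_subset:
  "optimal A i \<sigma> \<nu> \<Longrightarrow> \<sigma>' \<subseteq> \<sigma> \<Longrightarrow> (\<And>j. j \<notin> \<sigma> \<Longrightarrow> \<nu>' j = \<nu> j) \<Longrightarrow> optimal A i \<sigma>' \<nu>'"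
  unfolding optimal_def by (metis subsetD)

text \<open>One of \<open>k\<close> and \<open>- k\<close> has nonnegative entry \<open>i\<close>.
  Together with \<open>optimal_zero\<close> this gives independence of the columns over the face of
  a standard pair.\<close>

lemma optimal_zero_supported:
  assumes "optimal A i \<sigma> (\<lambda>_. 0)" "k \<in> kerZ A" "\<And>j. j \<notin> \<sigma> \<Longrightarrow> k $ j = 0"
  shows "k = 0"
proof (cases "0 \<le> k $ i")
  case True
  then show ?thesis using assms by (intro optimalD[OF assms(1)]) auto
next
  case False
  then have "- k = 0" using assms by (intro optimalD[OF assms(1)]) (auto simp: kerZ_uminus)
  then show ?thesis by simp
qed

text \<open>Entries over \<sigma> impose no constraint: multiplying by a large monomial in these
  variables makes them nonnegative.\<close>

lemma not_mem_initial_ideal_iff_optimal: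
  assumes gen: "generic_binomial_ideal (toric_ideal A)" and "i \<in> \<sigma>"
  shows "(\<forall>\<nu>. {j. \<nu> $ j \<noteq> 0} \<subseteq> \<sigma> \<longrightarrow>
            dmon (\<mu> + \<nu>) \<notin> initial_ideal (- axis i 1) (toric_ideal A)) \<longleftrightarrow>
         optimal A i \<sigma> (\<lambda>j. int (\<mu> $ j))"
  unfolding dmon_mem_initial_ideal_iff[OF gen]
proof
  assume L: "\<forall>\<nu>. {j. \<nu> $ j \<noteq> 0} \<subseteq> \<sigma> \<longrightarrow> \<not> improvable A i (\<mu> + \<nu>)"
  show "optimal A i \<sigma> (\<lambda>j. int (\<mu> $ j))"
    unfolding optimal_def
  proof (intro ballI impI)
    fix k assume k: "k \<in> kerZ A" "0 \<le> k $ i \<and> (\<forall>j. j \<notin> \<sigma> \<longrightarrow> 0 \<le> int (\<mu> $ j) + k $ j)"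
    define \<nu> where "\<nu> = (\<chi> j. if j \<in> \<sigma> then nat \<bar>k $ j\<bar> else 0)"
    define b where "b = (\<chi> j. nat (int ((\<mu> + \<nu>) $ j) + k $ j))"
    have nn: "0 \<le> int ((\<mu> + \<nu>) $ j) + k $ j" for j
      using k(2) by (cases "j \<in> \<sigma>") (auto simp: \<nu>_def)
    then have b: "of_nat_vec b = of_nat_vec (\<mu> + \<nu>) + k"
      by (simp add: b_def of_nat_vec_def vec_eq_iff)
    have "A *v of_nat_vec (\<mu> + \<nu>) = A *v of_nat_vec b"
      using k(1) by (simp add: b matrix_vector_right_distrib kerZ_def)
    moreover have "(\<mu> + \<nu>) $ i \<le> b $ i"
      using k(2) nn[of i] by (simp add: b_def) linarith
    moreover have "\<not> improvable A i (\<mu> + \<nu>)"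
      using L[rule_format, of \<nu>] by (simp add: \<nu>_def Collect_mono_iff subset_iff)
    ultimately have "\<mu> + \<nu> = b" using improvable_if_ge[OF gen] by blast
    with b show "k = 0" by simp
  qed
next
  assume R: "optimal A i \<sigma> (\<lambda>j. int (\<mu> $ j))"
  show "\<forall>\<nu>. {j. \<nu> $ j \<noteq> 0} \<subseteq> \<sigma> \<longrightarrow> \<not> improvable A i (\<mu> + \<nu>)"
  proof (intro allI impI notI)
    fix \<nu> assume \<nu>: "{j. \<nu> $ j \<noteq> 0} \<subseteq> \<sigma>" and "improvable A i (\<mu> + \<nu>)"
    then obtain b where b: "A *v of_nat_vec b = A *v of_nat_vec (\<mu> + \<nu>)" "(\<mu> + \<nu>) $ i < b $ i"
      unfolding improvable_def by blast
    define k :: "int^'a" where "k = of_nat_vec b - of_nat_vec (\<mu> + \<nu>)"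
    have "k = 0"
    proof (rule optimalD[OF R])
      show "k \<in> kerZ A" using b(1) by (simp add: k_def kerZ_def matrix_vector_mult_diff_distrib)
      show "0 \<le> int (\<mu> $ j) + k $ j" if "j \<notin> \<sigma>" for j
      proof -
        have "\<nu> $ j = 0" using that \<nu> by blast
        then show ?thesis by (simp add: k_def of_nat_vec_def)
      qed
    qed (use b(2) in \<open>simp add: k_def of_nat_vec_def\<close>)
    moreover have "k $ i > 0" using b(2) by (simp add: k_def of_nat_vec_def)
    ultimately show False by simp
  qed
qed

text \<open>Negating \<open>optimal\<close> alone allows \<open>k $ i = 0\<close>; the detour
  through the initial ideal makes the inequality strict, which later puts a factor \<partial>_1 into
  \<partial>^q.\<close>

lemma not_optimalE:
  assumes gen: "generic_binomial_ideal (toric_ideal A)" and "i \<in> \<sigma>"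
    and nopt: "\<not> optimal A i \<sigma> \<nu>" and nn: "\<And>j. j \<notin> \<sigma> \<Longrightarrow> 0 \<le> \<nu> j"
  obtains k where "k \<in> kerZ A" "0 < k $ i" "\<And>j. j \<notin> \<sigma> \<Longrightarrow> 0 \<le> \<nu> j + k $ j"
proof -
  define \<mu> where "\<mu> = (\<chi> j. nat (\<nu> j))"
  have \<mu>: "int (\<mu> $ j) = \<nu> j" if "j \<notin> \<sigma>" for j using nn[OF that] by (simp add: \<mu>_def)
  have "\<not> optimal A i \<sigma> (\<lambda>j. int (\<mu> $ j))"
    using nopt optimal_subset[of A i \<sigma> "\<lambda>j. int (\<mu> $ j)" \<sigma> \<nu>] \<mu> by auto
  then obtain \<nu>' where \<nu>': "{j. \<nu>' $ j \<noteq> 0} \<subseteq> \<sigma>" "improvable A i (\<mu> + \<nu>')"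
    using not_mem_initial_ideal_iff_optimal[OF gen \<open>i \<in> \<sigma>\<close>, of \<mu>] dmon_mem_initial_ideal_iff[OF gen]
    by blast
  then obtain b where b: "A *v of_nat_vec b = A *v of_nat_vec (\<mu> + \<nu>')" "(\<mu> + \<nu>') $ i < b $ i"
    unfolding improvable_def by blast
  show thesis
  proof (rule that[of "of_nat_vec b - of_nat_vec (\<mu> + \<nu>')"])
    show "of_nat_vec b - of_nat_vec (\<mu> + \<nu>') \<in> kerZ A"
      using b(1) by (simp add: kerZ_def matrix_vector_mult_diff_distrib)
    show "0 \<le> \<nu> j + (of_nat_vec b - of_nat_vec (\<mu> + \<nu>')) $ j" if "j \<notin> \<sigma>" for j
    proof -
      have "\<nu>' $ j = 0" using that \<nu>'(1) by blast
      then show ?thesis using \<mu>[OF that] by (simp add: of_nat_vec_def)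
    qed
  qed (use b(2) in \<open>simp add: of_nat_vec_def\<close>)
qed

text \<open>If \<open>i\<close> were outside \<sigma>, a power of \<partial>_i would have to bring
  some monomial into the initial ideal; cancelling that power from both members of the fibre shows
  that the monomial was already there.\<close>

lemma standard_pair_index_mem:
  assumes gen: "generic_binomial_ideal (toric_ideal A)"
    and sp: "standard_pair (initial_ideal (- axis i 1) (toric_ideal A)) \<mu> \<sigma>"
  shows "i \<in> \<sigma>"
proof (rule ccontr)
  assume "i \<notin> \<sigma>"
  then obtain \<nu> where \<nu>: "{j. \<nu> $ j \<noteq> 0} \<subseteq> insert i \<sigma>" "improvable A i (\<mu> + \<nu>)"
    using sp unfolding standard_pair_def dmon_mem_initial_ideal_iff[OF gen] by blast
  then obtain b where b: "A *v of_nat_vec b = A *v of_nat_vec (\<mu> + \<nu>)" "(\<mu> + \<nu>) $ i < b $ i"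
    unfolding improvable_def by blast
  define c where "c = (\<chi> j. if j = i then \<nu> $ i else 0)"
  define \<nu>' where "\<nu>' = (\<chi> j. if j = i then 0 else \<nu> $ j)"
  \<comment> \<open>No truncation occurs, since \<open>b $ i\<close> exceeds
    \<open>\<nu> $ i\<close>.\<close>
  define b' where "b' = (\<chi> j. b $ j - c $ j)"
  have eq: "\<mu> + \<nu> = (\<mu> + \<nu>') + c" "b = b' + c"
    using b(2) by (auto simp: c_def \<nu>'_def b'_def vec_eq_iff)
  have "A *v of_nat_vec b' = A *v of_nat_vec (\<mu> + \<nu>')"
    using b(1) unfolding eq by (simp add: of_nat_vec_add matrix_vector_right_distrib)
  moreover have "(\<mu> + \<nu>') $ i < b' $ i"
    using b(2) by (simp add: \<nu>'_def b'_def c_def)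
  ultimately have "improvable A i (\<mu> + \<nu>')" unfolding improvable_def by blast
  moreover have "{j. \<nu>' $ j \<noteq> 0} \<subseteq> \<sigma>" using \<nu>(1) by (auto simp: \<nu>'_def)
  ultimately show False
    using sp unfolding standard_pair_def dmon_mem_initial_ideal_iff[OF gen] by blast
qed

lemma standard_pair_iff_optimal:
  assumes gen: "generic_binomial_ideal (toric_ideal A)" and i: "i \<in> \<sigma>"
  shows "standard_pair (initial_ideal (- axis i 1) (toric_ideal A)) \<mu> \<sigma> \<longleftrightarrow>
    (\<forall>j\<in>\<sigma>. \<mu> $ j = 0) \<and> optimal A i \<sigma> (\<lambda>j. int (\<mu> $ j)) \<and>
    (\<forall>l. l \<notin> \<sigma> \<longrightarrow> \<not> optimal A i (insert l \<sigma>) (\<lambda>j. int (\<mu> $ j)))"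
proof -
  have "(\<exists>\<nu>. {j. \<nu> $ j \<noteq> 0} \<subseteq> insert l \<sigma> \<and> dmon (\<mu> + \<nu>) \<in> initial_ideal (- axis i 1) (toric_ideal A))
      \<longleftrightarrow> \<not> optimal A i (insert l \<sigma>) (\<lambda>j. int (\<mu> $ j))" for l
    using not_mem_initial_ideal_iff_optimal[OF gen, of i "insert l \<sigma>" \<mu>] i by blast
  then show ?thesis
    unfolding standard_pair_def not_mem_initial_ideal_iff_optimal[OF gen i] by simp
qed

section \<open>Rational linear algebra of the columns\<close>

text \<open>Rational entries give a field for dimension counts, while relations still clear to
  elements of \<open>kerZ A\<close>.\<close>

definition rat_column :: "int^'n^'d \<Rightarrow> 'n \<Rightarrow> rat^'d" where
  "rat_column A j = (\<chi> i. of_int (A $ i $ j))"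

lemma inj_rat_column: "inj (\<lambda>j. column j A) \<Longrightarrow> inj (rat_column A)"
  by (auto simp: inj_def rat_column_def column_def vec_eq_iff)

lemma clear_denominators:
  fixes q :: "'a::finite \<Rightarrow> rat"
  obtains N :: int and k where "N > 0" "\<And>j. of_int (k j) = of_int N * q j"
proof -
  define d where "d j = snd (quotient_of (q j))" for j
  define N where "N = (\<Prod>j\<in>UNIV. d j)"
  have d: "d j > 0" for j by (simp add: d_def quotient_of_denom_pos')
  have "\<exists>k. of_int k = of_int N * q j" for j
  proof -
    have "q j = of_int (fst (quotient_of (q j))) / of_int (d j)"
      unfolding d_def by (metis quotient_of_div prod.collapse)
    moreover have "N = d j * (\<Prod>j\<in>UNIV - {j}. d j)"
      unfolding N_def by (simp add: prod.remove)
    ultimately have "of_int N * q j = of_int ((\<Prod>j\<in>UNIV - {j}. d j) * fst (quotient_of (q j)))"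
      using d[of j] by (simp add: field_simps)
    then show ?thesis by metis
  qed
  then obtain k where "\<And>j. of_int (k j) = of_int N * q j" by metis
  moreover have "N > 0" using d by (auto simp: N_def intro!: prod_pos)
  ultimately show thesis using that by blast
qed

lemma kerZ_of_rat_relation:
  fixes A :: "int^'n::finite^'d"
  assumes "(\<Sum>j\<in>UNIV. q j *s rat_column A j) = 0"
  obtains N k where "k \<in> kerZ A" "N > 0" "\<And>j. of_int (k $ j) = of_int N * q j"
proof -
  obtain N and k where N: "N > 0" and k: "\<And>j. of_int (k j) = of_int N * q j"
    using clear_denominators[of q] by metis
  have "(\<Sum>j\<in>UNIV. A $ i $ j * k j) = 0" for i
  proof -
    have "(\<Sum>j\<in>UNIV. q j * of_int (A $ i $ j)) = 0"
      using arg_cong[OF assms, of "\<lambda>v. v $ i"] by (simp add: rat_column_def)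
    then have "of_int N * (\<Sum>j\<in>UNIV. q j * of_int (A $ i $ j)) = 0" by simp
    then have "of_int (\<Sum>j\<in>UNIV. A $ i $ j * k j) = (0::rat)"
      by (simp add: k sum_distrib_left mult_ac)
    then show ?thesis by (simp only: of_int_eq_0_iff)
  qed
  then have "(\<chi> j. k j) \<in> kerZ A" by (simp add: kerZ_def matrix_vector_mult_def vec_eq_iff)
  then show thesis using that N k by auto
qed

lemma rat_column_in_span:
  fixes A :: "int^'n::finite^'d"
  assumes inj: "inj (\<lambda>j. column j A)" and "rat_column A j \<in> vec.span (rat_column A ` S)" "j \<notin> S"
  obtains k where "k \<in> kerZ A" "0 < k $ j" "\<And>x. x \<notin> insert j S \<Longrightarrow> k $ x = 0"
proof -
  have inj': "inj_on (rat_column A) S" using inj_rat_column[OF inj] by (rule inj_on_subset) simp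
  obtain c where "rat_column A j = (\<Sum>v\<in>rat_column A ` S. c v *s v)"
    using assms(2) by (subst (asm) vec.span_finite) auto
  then have c: "rat_column A j = (\<Sum>x\<in>S. c (rat_column A x) *s rat_column A x)"
    by (simp add: sum.reindex[OF inj'])
  define q where "q x = (if x = j then 1 else if x \<in> S then - c (rat_column A x) else 0)" for x
  have "(\<Sum>x\<in>UNIV. q x *s rat_column A x) = (\<Sum>x\<in>insert j S. q x *s rat_column A x)"
    by (rule sum.mono_neutral_right) (auto simp: q_def)
  also have "\<dots> = rat_column A j + (\<Sum>x\<in>S. q x *s rat_column A x)"
    using \<open>j \<notin> S\<close> by (simp add: q_def)
  also have "(\<Sum>x\<in>S. q x *s rat_column A x) = - (\<Sum>x\<in>S. c (rat_column A x) *s rat_column A x)"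
    unfolding sum_negf[symmetric]
    by (rule sum.cong) (use \<open>j \<notin> S\<close> in \<open>auto simp: q_def\<close>)
  finally have "(\<Sum>x\<in>UNIV. q x *s rat_column A x) = 0" using c by simp
  then obtain N k where k: "k \<in> kerZ A" "N > 0" "\<And>j. of_int (k $ j) = of_int N * q j"
    using kerZ_of_rat_relation by metis
  show thesis
  proof (rule that[OF k(1)])
    have "k $ j = N" using k(3)[of j] by (simp add: q_def)
    then show "0 < k $ j" using k(2) by simp
    show "k $ x = 0" if "x \<notin> insert j S" for x
      using k(3)[of x] that by (simp add: q_def)
  qed
qed

lemma kerZ_supported_exists:
  fixes A :: "int^'n::finite^'d::finite"
  assumes inj: "inj (\<lambda>j. column j A)" and "CARD('d) < card S"
  obtains k where "k \<in> kerZ A" "k \<noteq> 0" "\<And>x. x \<notin> S \<Longrightarrow> k $ x = 0"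
proof -
  have inj': "inj_on (rat_column A) S" using inj_rat_column[OF inj] by (rule inj_on_subset) simp
  have "card (rat_column A ` S) > vec.dim (rat_column A ` S)"
    using vec.dim_subset[of "rat_column A ` S" UNIV] assms(2)
    by (simp only: card_image[OF inj'] vec_dim_card) simp
  then have "vec.dependent (rat_column A ` S)"
    using vec.dim_eq_card_independent[of "rat_column A ` S"] by auto
  then obtain v where "v \<in> rat_column A ` S" "v \<in> vec.span (rat_column A ` S - {v})"
    unfolding vec.dependent_def by blast
  then obtain j where j: "j \<in> S" "rat_column A j \<in> vec.span (rat_column A ` S - {rat_column A j})"
    by blast
  moreover have "rat_column A ` S - {rat_column A j} = rat_column A ` (S - {j})"
    using inj' j(1) by (auto simp: inj_on_def)
  ultimately obtain k where "k \<in> kerZ A" "0 < k $ j" "\<And>x. x \<notin> insert j (S - {j}) \<Longrightarrow> k $ x = 0"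
    using rat_column_in_span[OF inj, of j "S - {j}"] by auto
  moreover from this(2) have "k \<noteq> 0" by auto
  moreover have "insert j (S - {j}) = S" using j(1) by blast
  ultimately show thesis using that[of k] by metis
qed

lemma optimal_zero_card_le:
  fixes A :: "int^'n::finite^'d::finite"
  assumes "inj (\<lambda>j. column j A)" "optimal A i \<sigma> (\<lambda>_. 0)"
  shows "card \<sigma> \<le> CARD('d)"
proof (rule ccontr)
  assume "\<not> ?thesis"
  then obtain k where "k \<in> kerZ A" "k \<noteq> 0" "\<And>x. x \<notin> \<sigma> \<Longrightarrow> k $ x = 0"
    using kerZ_supported_exists[OF assms(1), of \<sigma>] by auto
  then show False using optimal_zero_supported[OF assms(2)] by blast
qed

text \<open>The space is abstract because of two uses: the columns of \<open>A\<close>, and the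
  complex numbers as a rational vector space.\<close>

lemma exists_functional:
  fixes scale :: "'a::field \<Rightarrow> 'v::ab_group_add \<Rightarrow> 'v"
  assumes vs: "vector_space scale" and x: "x \<notin> module.span scale S"
  obtains g where "Vector_Spaces.linear scale (*) g" "g x = 1" "\<And>y. y \<in> S \<Longrightarrow> g y = 0"
proof -
  interpret vector_space_pair scale "(*) :: 'a \<Rightarrow> 'a \<Rightarrow> 'a"
    using vs by (simp add: vector_space_pair_def vector_space_over_itself.vector_space_axioms)
  obtain T where T: "T \<subseteq> S" "vs1.independent T" "S \<subseteq> vs1.span T"
    using vs1.maximal_independent_subset by blast
  have xT: "x \<notin> vs1.span T" using x T(1) vs1.span_mono by blast
  then have "vs1.independent (insert x T)"
    using T(2) vs1.independent_insert by auto
  from linear_independent_extend[OF this, of "\<lambda>y. if y = x then 1 else 0"]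
  obtain g where g: "Vector_Spaces.linear scale (*) g"
      "\<forall>y\<in>insert x T. g y = (if y = x then 1 else 0)" by blast
  interpret g: Vector_Spaces.linear scale "(*)" g by fact
  have "x \<notin> T" using xT vs1.span_base by blast
  then have "g y = 0" if "y \<in> T" for y using g(2) that by auto
  then have "g y = 0" if "y \<in> S" for y
    using g.eq_0_on_span[of T y] T(3) that by blast
  moreover have "g x = 1" using g(2) by simp
  ultimately show thesis using that g(1) by blast
qed

lemma vector_space_complex_rat: "vector_space (\<lambda>(q::rat) (z::complex). of_rat q * z)"
  by unfold_locales (simp_all add: algebra_simps of_rat_add of_rat_mult)

section \<open>Faces containing \<open>\<tau>\<close>\<close>

text \<open>Here \<open>i\<close> is the index \<open>1\<close>, and \<open>recession\<close> is what is used of condition (i).\<close>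

locale combinatorial_setting =
  fixes A :: "int^'n::finite^'d::finite" and i :: 'n and \<tau> :: "'n set" and \<eta> :: "nat^'n"
  assumes gen: "generic_binomial_ideal (toric_ideal A)"
    and inj_columns: "inj (\<lambda>j. column j A)"
    and i_notin: "i \<notin> \<tau>"
    and card_\<tau>: "card \<tau> + 2 = CARD('d)"
    and std: "standard_pair (initial_ideal (- axis i 1) (toric_ideal A)) \<eta> (insert i \<tau>)"
    and recession: "(\<forall>k\<in>kerZ A. (\<forall>j. j \<notin> insert i \<tau> \<longrightarrow> 0 \<le> k $ j) \<longrightarrow> k = 0) \<or>
      (\<exists>r. r \<notin> insert i \<tau> \<and> (\<forall>k\<in>kerZ A. k $ r * k $ i \<le> 0 \<and> (k $ r = 0 \<longleftrightarrow> k $ i = 0)))"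
    and cond_ii: "\<And>\<mu> (z :: complex^'n) k.
      standard_pair (initial_ideal (- axis i 1) (toric_ideal A)) \<mu> (insert i \<tau>) \<Longrightarrow>
      of_int_mat A *v z = 0 \<Longrightarrow>
      (\<And>j. j \<notin> insert i \<tau> \<Longrightarrow> of_nat (\<mu> $ j) = of_nat (\<eta> $ j) - z $ j) \<Longrightarrow>
      z $ i = of_int k \<Longrightarrow> k \<le> 0"
begin

abbreviation "\<sigma>\<^sub>0 \<equiv> insert i \<tau>"

lemma optimal_\<eta>: "optimal A i \<sigma>\<^sub>0 (\<lambda>j. int (\<eta> $ j))"
  and not_optimal_\<eta>: "l \<notin> \<sigma>\<^sub>0 \<Longrightarrow> \<not> optimal A i (insert l \<sigma>\<^sub>0) (\<lambda>j. int (\<eta> $ j))"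
  and \<eta>_eq_0: "j \<in> \<sigma>\<^sub>0 \<Longrightarrow> \<eta> $ j = 0"
  using std by (auto simp: standard_pair_iff_optimal[OF gen])

lemma optimal_\<sigma>\<^sub>0: "optimal A i \<sigma>\<^sub>0 (\<lambda>_. 0)"
  using optimal_zero[OF optimal_\<eta>] by simp

lemma card_\<sigma>\<^sub>0: "card \<sigma>\<^sub>0 + 1 = CARD('d)"
  using card_\<tau> i_notin by simp

text \<open>Here \<open>k $ i = 0\<close>, and outside \<open>\<sigma>\<^sub>0\<close> only entry
  \<open>j\<close> can be nonzero, so \<open>k\<close> or \<open>- k\<close> is feasible in
  \<open>optimal_\<sigma>\<^sub>0\<close>.\<close>

lemma kernel_near_\<tau>:
  assumes k: "k \<in> kerZ A" "\<And>x. x \<notin> insert j \<tau> \<Longrightarrow> k $ x = 0" and j: "j \<noteq> i" "j \<notin> \<tau>"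
  shows "k = 0"
proof -
  have *: "k = 0" if "k \<in> kerZ A" "\<And>x. x \<notin> insert j \<tau> \<Longrightarrow> k $ x = 0" "0 \<le> k $ j" for k
  proof (rule optimalD[OF optimal_\<sigma>\<^sub>0 that(1)])
    show "0 \<le> k $ i" using that(2)[of i] j i_notin by simp
    show "0 \<le> 0 + k $ x" if "x \<notin> \<sigma>\<^sub>0" for x
      using \<open>0 \<le> k $ j\<close> \<open>\<And>x. x \<notin> insert j \<tau> \<Longrightarrow> k $ x = 0\<close>[of x] that by (cases "x = j") auto
  qed
  show ?thesis
  proof (cases "0 \<le> k $ j")
    case True
    then show ?thesis using *[of k] k by blast
  next
    case False
    then have "- k = 0" using *[of "- k"] k by (simp add: kerZ_uminus)
    then show ?thesis by simp
  qed
qed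

lemma opposite_signs:
  assumes triv: "optimal A i (insert l \<sigma>\<^sub>0) (\<lambda>_. 0)"
    and k: "k \<in> kerZ A" "k \<noteq> 0" "\<And>x. x \<notin> insert l (insert l' \<sigma>\<^sub>0) \<Longrightarrow> k $ x = 0"
    and pos: "0 \<le> k $ i"
  shows "k $ l' < 0"
proof (rule ccontr)
  assume "\<not> ?thesis"
  then have "k = 0" using k
    by (intro optimalD[OF triv k(1) pos]) (metis add_0 insert_iff le_less not_less)
  with k show False by simp
qed

text \<open>The decisive use of condition (i). Two extensions carry a relation on d + 1 columns. In
  the bounded case, once its entry \<open>i\<close> is nonnegative, its entries at \<open>l\<close>
  and \<open>l'\<close> are both negative, so its negative lies in a trivial cone. In the hyperplane
  case only \<open>r\<close> can be an extension.\<close>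

lemma optimal_extension_unique:
  assumes l: "l \<notin> \<sigma>\<^sub>0" "optimal A i (insert l \<sigma>\<^sub>0) (\<lambda>_. 0)"
    and l': "l' \<notin> \<sigma>\<^sub>0" "optimal A i (insert l' \<sigma>\<^sub>0) (\<lambda>_. 0)"
  shows "l = l'"
proof (rule ccontr)
  assume ne: "l \<noteq> l'"
  have ex: "\<exists>k. k \<in> kerZ A \<and> k \<noteq> 0 \<and> (\<forall>x. x \<notin> insert l (insert l' \<sigma>\<^sub>0) \<longrightarrow> k $ x = 0) \<and> 0 \<le> k $ i"
    if "l \<notin> \<sigma>\<^sub>0" "l' \<notin> \<sigma>\<^sub>0" "l \<noteq> l'" for l l'
  proof -
    have "CARD('d) < card (insert l (insert l' \<sigma>\<^sub>0))" using card_\<sigma>\<^sub>0 that by simp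
    then obtain k where k: "k \<in> kerZ A" "k \<noteq> 0" "\<And>x. x \<notin> insert l (insert l' \<sigma>\<^sub>0) \<Longrightarrow> k $ x = 0"
      using kerZ_supported_exists[OF inj_columns] by blast
    show ?thesis
    proof (cases "0 \<le> k $ i")
      case True
      then show ?thesis using k by blast
    next
      case False
      then show ?thesis using k by (intro exI[of _ "- k"]) (auto simp: kerZ_uminus)
    qed
  qed
  from recession show False
  proof
    assume F: "\<forall>k\<in>kerZ A. (\<forall>j. j \<notin> \<sigma>\<^sub>0 \<longrightarrow> 0 \<le> k $ j) \<longrightarrow> k = 0"
    obtain k where k: "k \<in> kerZ A" "k \<noteq> 0" "\<And>x. x \<notin> insert l (insert l' \<sigma>\<^sub>0) \<Longrightarrow> k $ x = 0"
        "0 \<le> k $ i"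
      using ex[OF l(1) l'(1) ne] by blast
    have "k $ l' < 0" using opposite_signs[OF l(2) k(1,2) _ k(4)] k(3) by blast
    moreover have "k $ l < 0"
      by (rule opposite_signs[OF l'(2) k(1,2) _ k(4)]) (use k(3) in auto)
    ultimately have "\<forall>j. j \<notin> \<sigma>\<^sub>0 \<longrightarrow> 0 \<le> (- k) $ j"
      using k(3) by (metis insert_iff less_imp_le neg_0_le_iff_le order_refl vector_uminus_component)
    then have "- k = 0" using F kerZ_uminus[OF k(1)] by blast
    with k(2) show False by simp
  next
    assume "\<exists>r. r \<notin> \<sigma>\<^sub>0 \<and> (\<forall>k\<in>kerZ A. k $ r * k $ i \<le> 0 \<and> (k $ r = 0 \<longleftrightarrow> k $ i = 0))"
    then obtain r where r: "r \<notin> \<sigma>\<^sub>0" "\<And>k. k \<in> kerZ A \<Longrightarrow> k $ r = 0 \<longleftrightarrow> k $ i = 0" by blast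
    have "\<not> optimal A i (insert l \<sigma>\<^sub>0) (\<lambda>_. 0)" if l0: "l \<notin> \<sigma>\<^sub>0" "l \<noteq> r" for l
    proof
      assume opt: "optimal A i (insert l \<sigma>\<^sub>0) (\<lambda>_. 0)"
      show False
      proof (cases "\<exists>x. x \<notin> \<sigma>\<^sub>0 \<and> x \<noteq> l \<and> x \<noteq> r")
        case True
        \<comment> \<open>Through a third index the relation avoids \<open>r\<close>; hence entry
          \<open>i\<close> is 0, and both \<open>k\<close> and \<open>- k\<close> would be negative
          at \<open>x\<close>.\<close>
        then obtain x where x: "x \<notin> \<sigma>\<^sub>0" "x \<noteq> l" "x \<noteq> r" by blast
        obtain k where k: "k \<in> kerZ A" "k \<noteq> 0" "\<And>y. y \<notin> insert l (insert x \<sigma>\<^sub>0) \<Longrightarrow> k $ y = 0"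
          using ex[OF l0(1) x(1)] x(2) by blast
        have "k $ r = 0" using k(3)[of r] r(1) x l0 by simp
        then have "k $ i = 0" using r(2) k(1) by blast
        then have "k $ x < 0" using opposite_signs[OF opt k(1,2)] k(3) by auto
        moreover have "(- k) $ x < 0"
          using \<open>k $ i = 0\<close> k by (intro opposite_signs[OF opt]) (auto simp: kerZ_uminus)
        ultimately show False by simp
      next
        case False
        \<comment> \<open>Only \<open>l\<close> and \<open>r\<close> remain outside the face.
          Maximality of the standard pair of \<eta> supplies two vectors: \<open>k\<close> respects
          the constraint at \<open>r\<close>, \<open>k'\<close> the one at \<open>l\<close>.\<close>
        obtain k where k: "k \<in> kerZ A" "0 < k $ i" "\<And>j. j \<notin> insert l \<sigma>\<^sub>0 \<Longrightarrow> 0 \<le> int (\<eta> $ j) + k $ j"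
          by (rule not_optimalE[OF gen _ not_optimal_\<eta>[OF l0(1)]]) (simp, simp, blast)
        obtain k' where k': "k' \<in> kerZ A" "0 < k' $ i" "\<And>j. j \<notin> insert r \<sigma>\<^sub>0 \<Longrightarrow> 0 \<le> int (\<eta> $ j) + k' $ j"
          by (rule not_optimalE[OF gen _ not_optimal_\<eta>[OF r(1)]]) (simp, simp, blast)
        \<comment> \<open>This cancels entry \<open>i\<close>, hence also entry \<open>r\<close>;
          what remains is supported on \<open>insert l \<tau>\<close>, where there is no
          relation.\<close>
        define h where "h = k' $ i *s k - k $ i *s k'"
        have h: "h \<in> kerZ A" unfolding h_def by (intro kerZ_diff kerZ_scale k k')
        have "h $ i = 0" by (simp add: h_def)
        then have "h $ r = 0" using r(2) h by blast
        have "h = 0"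
        proof (rule kernel_near_\<tau>[OF h])
          show "h $ x = 0" if "x \<notin> insert l \<tau>" for x
            using that False \<open>h $ r = 0\<close> \<open>h $ i = 0\<close> by (metis insert_iff)
        qed (use l0 in auto)
        then have proportional: "k' $ i * k $ x = k $ i * k' $ x" for x
          by (simp add: h_def vec_eq_iff)
        txt \<open>\<open>k\<close> and \<open>k'\<close> are positively proportional; the shorter one contradicts the optimality
          of \<open>\<eta>\<close>.\<close>
        have shorter: "0 \<le> int (\<eta> $ x) + a" if "0 \<le> int (\<eta> $ x) + b" "p * b = q * a" "0 < p" "p \<le> q"
          for x a b p q
        proof (cases "0 \<le> a")
          case False
          then have "p * b \<le> p * a" using that(2,4) mult_right_mono_neg[of p q a] by simp
          then have "b \<le> a" using that(3) by simp
          then show ?thesis using that(1) by simp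
        qed simp
        have x: "x = l \<or> x = r" if "x \<notin> \<sigma>\<^sub>0" for x using that False by blast
        show False
        proof (cases "k $ i \<le> k' $ i")
          case True
          have "k = 0"
          proof (rule optimalD[OF optimal_\<eta> k(1)])
            fix x assume "x \<notin> \<sigma>\<^sub>0"
            with x consider "x = l" | "x = r" by blast
            then show "0 \<le> int (\<eta> $ x) + k $ x"
            proof cases
              case 1
              then have "0 \<le> int (\<eta> $ x) + k' $ x" using k'(3) l0 by auto
              then show ?thesis using shorter[of x "k' $ x" "k $ i" "k' $ i" "k $ x"] proportional True k(2) by simp
            next
              case 2
              then show ?thesis using k(3) l0 r(1) by auto
            qed
          qed (use k in auto)
          then show False using k(2) by simp
        next
          case False
          have "k' = 0"
          proof (rule optimalD[OF optimal_\<eta> k'(1)])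
            fix x assume "x \<notin> \<sigma>\<^sub>0"
            with x consider "x = l" | "x = r" by blast
            then show "0 \<le> int (\<eta> $ x) + k' $ x"
            proof cases
              case 1
              then show ?thesis using k'(3) l0 by auto
            next
              case 2
              then have "0 \<le> int (\<eta> $ x) + k $ x" using k(3) l0 r(1) by auto
              then show ?thesis using shorter[of x "k $ x" "k' $ i" "k $ i" "k' $ x"] proportional False k'(2) by simp
            qed
          qed (use k' in auto)
          then show False using k'(2) by simp
        qed
      qed
    qed
    then show False using l l' ne by metis
  qed
qed

text \<open>The columns over \<tau> are independent, so both families span the same space; an
  element of \<rho> outside \<tau> would then depend on \<tau>, against
  \<open>kernel_near_\<tau>\<close>.\<close>

lemma spanning_eq_\<tau>:
  assumes span: "\<And>x. x \<in> \<tau> \<Longrightarrow> rat_column A x \<in> vec.span (rat_column A ` \<rho>)"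
    and i: "i \<notin> \<rho>" and card: "card \<rho> \<le> card \<tau>"
  shows "\<rho> = \<tau>"
proof -
  let ?c = "rat_column A"
  have inj: "inj_on ?c S" for S using inj_rat_column[OF inj_columns] by (rule inj_on_subset) simp
  have ind: "vec.independent (?c ` \<tau>)"
  proof
    assume "vec.dependent (?c ` \<tau>)"
    then obtain j where j: "j \<in> \<tau>" "?c j \<in> vec.span (?c ` \<tau> - {?c j})"
      unfolding vec.dependent_def by blast
    moreover have "?c ` \<tau> - {?c j} = ?c ` (\<tau> - {j})"
      using inj[of \<tau>] j(1) by (auto simp: inj_on_def)
    ultimately obtain k where k: "k \<in> kerZ A" "0 < k $ j" "\<And>x. x \<notin> insert j (\<tau> - {j}) \<Longrightarrow> k $ x = 0"
      using rat_column_in_span[OF inj_columns, of j "\<tau> - {j}"] by auto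
    have "k = 0" by (rule optimal_zero_supported[OF optimal_\<sigma>\<^sub>0 k(1)]) (rule k(3), use j(1) in blast)
    with k(2) show False by simp
  qed
  have "vec.dim (vec.span (?c ` \<rho>)) \<le> card (?c ` \<rho>)"
    by (rule vec.dim_le_card) auto
  also have "\<dots> \<le> card (?c ` \<tau>)" using card by (simp add: card_image inj)
  also have "\<dots> = vec.dim (?c ` \<tau>)" using vec.dim_eq_card_independent[OF ind] by simp
  finally have eq: "vec.span (?c ` \<tau>) = vec.span (vec.span (?c ` \<rho>))"
    using span by (intro vec.dim_eq_span) auto
  have sub: "\<rho> \<subseteq> \<tau>"
  proof (rule ccontr)
    assume "\<not> ?thesis"
    then obtain j where j: "j \<in> \<rho>" "j \<notin> \<tau>" by blast
    have "?c j \<in> vec.span (?c ` \<tau>)" unfolding eq using j(1) by (simp add: vec.span_base vec.span_span)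
    then obtain k where k: "k \<in> kerZ A" "0 < k $ j" "\<And>x. x \<notin> insert j \<tau> \<Longrightarrow> k $ x = 0"
      using rat_column_in_span[OF inj_columns _ j(2)] by auto
    have "k = 0" using kernel_near_\<tau>[OF k(1) k(3)] j i by blast
    with k(2) show False by simp
  qed
  have "card (?c ` \<tau>) \<le> card (?c ` \<rho>)"
    using vec.independent_span_bound[OF _ ind, of "?c ` \<rho>"] span by auto
  then have "card \<tau> \<le> card \<rho>" by (simp add: card_image inj)
  with sub show ?thesis by (simp add: card_seteq)
qed

end

section \<open>Fake exponents at generic parameters\<close>

text \<open>Linear independence over the rationals of 1 and the \<alpha>_j with j in \<tau>: the
  form in which genericity of \<alpha> enters. It fails only on countably many hyperplanes.\<close>

definition rat_independent :: "'n set \<Rightarrow> complex^'n::finite \<Rightarrow> bool" where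
  "rat_independent \<tau> \<alpha> \<longleftrightarrow>
     (\<forall>(q :: 'n \<Rightarrow> rat) b :: rat. (\<Sum>j\<in>\<tau>. of_rat (q j) * \<alpha> $ j) = of_rat b \<longrightarrow> (\<forall>j\<in>\<tau>. q j = 0))"

lemma rat_functional_exists:
  assumes \<alpha>: "rat_independent \<tau> \<alpha>" and x: "x \<in> \<tau>"
  obtains g :: "complex \<Rightarrow> rat" where
    "\<And>y z. g (y + z) = g y + g z" "\<And>q z. g (of_rat q * z) = q * g z"
    "\<And>q. g (of_rat q) = 0" "\<And>j. j \<in> \<tau> \<Longrightarrow> g (\<alpha> $ j) = (if j = x then 1 else 0)"
proof -
  interpret vector_space "\<lambda>(q::rat) (z::complex). of_rat q * z"
    by (rule vector_space_complex_rat)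
  have inj: "inj_on (($) \<alpha>) \<tau>"
  proof (rule inj_onI, rule ccontr)
    fix j j' assume j: "j \<in> \<tau>" "j' \<in> \<tau>" "\<alpha> $ j = \<alpha> $ j'" "j \<noteq> j'"
    let ?q = "\<lambda>y. if y = j then 1 else if y = j' then -1 else 0 :: rat"
    have "(\<Sum>y\<in>\<tau>. of_rat (?q y) * \<alpha> $ y) =
        (\<Sum>y\<in>\<tau>. (if y = j then \<alpha> $ j else 0) - (if y = j' then \<alpha> $ j' else 0))"
      by (rule sum.cong) (use j(4) in \<open>auto simp: of_rat_minus\<close>)
    also have "\<dots> = of_rat 0" using j by (simp add: sum_subtractf)
    finally have "\<forall>y\<in>\<tau>. ?q y = 0" by (rule \<alpha>[unfolded rat_independent_def, rule_format, THEN ballI])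
    with j(1) show False by force
  qed
  have "\<alpha> $ x \<notin> span (insert 1 (($) \<alpha> ` (\<tau> - {x})))"
  proof
    assume "\<alpha> $ x \<in> span (insert 1 (($) \<alpha> ` (\<tau> - {x})))"
    then obtain b where "\<alpha> $ x - of_rat b * 1 \<in> span (($) \<alpha> ` (\<tau> - {x}))"
      using span_breakdown_eq by blast
    then obtain c where c: "\<alpha> $ x - of_rat b = (\<Sum>v\<in>($) \<alpha> ` (\<tau> - {x}). of_rat (c v) * v)"
      by (subst (asm) span_finite) auto
    have inj': "inj_on (($) \<alpha>) (\<tau> - {x})" using inj by (rule inj_on_subset) auto
    let ?q = "\<lambda>y. if y = x then 1 else - c (\<alpha> $ y)"
    have "(\<Sum>y\<in>\<tau>. of_rat (?q y) * \<alpha> $ y) =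
        \<alpha> $ x + (\<Sum>y\<in>\<tau> - {x}. of_rat (?q y) * \<alpha> $ y)"
      using x by (subst sum.remove[of _ x]) auto
    also have "(\<Sum>y\<in>\<tau> - {x}. of_rat (?q y) * \<alpha> $ y) = - (\<Sum>y\<in>\<tau> - {x}. of_rat (c (\<alpha> $ y)) * \<alpha> $ y)"
      unfolding sum_negf[symmetric] by (rule sum.cong) (auto simp: of_rat_minus)
    also have "(\<Sum>y\<in>\<tau> - {x}. of_rat (c (\<alpha> $ y)) * \<alpha> $ y) = \<alpha> $ x - of_rat b"
      unfolding c by (simp add: sum.reindex[OF inj'])
    finally have "(\<Sum>y\<in>\<tau>. of_rat (?q y) * \<alpha> $ y) = of_rat b" by simp
    then have "\<forall>y\<in>\<tau>. ?q y = 0" by (rule \<alpha>[unfolded rat_independent_def, rule_format, THEN ballI])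
    with x show False by force
  qed
  from exists_functional[OF vector_space_complex_rat this]
  obtain g where g: "Vector_Spaces.linear (\<lambda>(q::rat) (z::complex). of_rat q * z) (*) g"
    "g (\<alpha> $ x) = 1" "\<And>y. y \<in> insert 1 (($) \<alpha> ` (\<tau> - {x})) \<Longrightarrow> g y = 0" by blast
  interpret g: Vector_Spaces.linear "\<lambda>(q::rat) (z::complex). of_rat q * z" "(*)" g by fact
  show thesis
  proof (rule that)
    show "g (of_rat q) = 0" for q using g.scale[of q 1] g(3)[of 1] by simp
    show "g (\<alpha> $ j) = (if j = x then 1 else 0)" if "j \<in> \<tau>" for j using g(2,3) that by auto
  qed (use g.add g.scale in auto)
qed

lemma Nats_floor: "(z :: complex) \<in> \<nat> \<Longrightarrow> z = of_int \<lfloor>Re z\<rfloor> \<and> 0 \<le> \<lfloor>Re z\<rfloor>"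
  by (elim Nats_cases) simp

lemma Nats_not_nsupp: "v $ j \<in> \<nat> \<Longrightarrow> j \<notin> nsupp v"
  unfolding nsupp_def
proof
  assume "v $ j \<in> \<nat>" "j \<in> {i. \<exists>k::int. k < 0 \<and> v $ i = of_int k}"
  then obtain n :: nat and k :: int where "v $ j = of_nat n" "v $ j = of_int k" "k < 0"
    by (auto elim!: Nats_cases)
  then have "of_int k = (of_int (int n) :: complex)" by simp
  with \<open>k < 0\<close> show False by (simp only: of_int_eq_iff)
qed

lemma nsupp_of_int: "v $ j = of_int k \<Longrightarrow> j \<in> nsupp v \<longleftrightarrow> k < 0"
  by (auto simp: nsupp_def)

lemma Rats_rat: "z \<in> \<rat> \<Longrightarrow> \<exists>q. z = of_rat q"
  by (auto elim: Rats_cases)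

context combinatorial_setting
begin

text \<open>The coordinates that any standard pair giving rise to \<open>v\<close> must leave free;
  \<open>i\<close> is added since it lies in every such face. Unlike the face of the pair, this set
  depends on \<open>v\<close> alone.\<close>

definition support_face :: "complex^'n \<Rightarrow> 'n set" where
  "support_face v = insert i {j. v $ j \<notin> \<nat>}"

lemma fake_exponent_optimal:
  assumes "v \<in> fake_exponents (- axis i 1) A \<gamma>"
  shows "optimal A i (support_face v) (\<lambda>j. \<lfloor>Re (v $ j)\<rfloor>)"
proof -
  obtain \<mu> \<sigma> where sp: "standard_pair (initial_ideal (- axis i 1) (toric_ideal A)) \<mu> \<sigma>"
    and v: "\<And>j. j \<notin> \<sigma> \<Longrightarrow> v $ j = of_nat (\<mu> $ j)"
    using assms unfolding fake_exponents_def by auto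
  have i: "i \<in> \<sigma>" using standard_pair_index_mem[OF gen sp] .
  have "optimal A i \<sigma> (\<lambda>j. int (\<mu> $ j))" using sp by (simp add: standard_pair_iff_optimal[OF gen i])
  then show ?thesis
  proof (rule optimal_subset)
    show "support_face v \<subseteq> \<sigma>" using i v by (force simp: support_face_def)
  qed (use v in simp)
qed

lemma optimal_support_face_zero:
  assumes "v \<in> fake_exponents (- axis i 1) A \<gamma>"
  shows "optimal A i (support_face v) (\<lambda>_. 0)"
  by (rule optimal_zero[OF fake_exponent_optimal[OF assms]])
    (use Nats_floor in \<open>auto simp: support_face_def\<close>)

end

text \<open>\<open>v\<close> stands for an element of K; minimality of its negative support is
  assumed only in the lemmas that need it.\<close>

locale generic_setting = combinatorial_setting +
  fixes \<alpha> :: "complex^'a" and v :: "complex^'a"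
  assumes rat_independent: "rat_independent \<tau> \<alpha>"
    and \<alpha>_eq_0: "\<And>j. j \<notin> \<tau> \<Longrightarrow> \<alpha> $ j = 0"
    and fake: "v \<in> fake_exponents (- axis i 1) A (of_int_mat A *v (of_nat_vec \<eta> + \<alpha>))"
    and v_i: "v $ i = 0"
begin

lemma A_v: "of_int_mat A *v v = of_int_mat A *v (of_nat_vec \<eta> + \<alpha>)"
  using fake by (simp add: fake_exponents_def)

text \<open>A rational functional that kills 1 and every \<alpha>_j except \<alpha>_x is applied to
  Av = A(\<eta> + \<alpha>): the right-hand side becomes column \<open>x\<close>, and the rational
  coordinates of \<open>v\<close> disappear.\<close>

lemma irrational_coordinates_span:
  assumes "x \<in> \<tau>"
  shows "rat_column A x \<in> vec.span (rat_column A ` {j. v $ j \<notin> \<rat>})"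
proof -
  obtain g :: "complex \<Rightarrow> rat" where
    g: "\<And>y z. g (y + z) = g y + g z" "\<And>q z. g (of_rat q * z) = q * g z"
    "\<And>q. g (of_rat q) = 0" "\<And>j. j \<in> \<tau> \<Longrightarrow> g (\<alpha> $ j) = (if j = x then 1 else 0)"
    using rat_functional_exists[OF rat_independent assms] by blast
  have g_int: "g (of_int k * z) = of_int k * g z" for k z using g(2)[of "of_int k" z] by simp
  have "g (of_nat n) = 0" for n using g(3)[of "of_nat n"] by simp
  then have g_\<eta>\<alpha>: "g (of_nat (\<eta> $ j) + \<alpha> $ j) = (if j = x then 1 else 0)" for j
    using g(3)[of 0] g(4)[of j] \<alpha>_eq_0[of j] assms by (cases "j \<in> \<tau>") (auto simp: g(1))
  have g_sum: "g (\<Sum>j\<in>S. h j) = (\<Sum>j\<in>S. g (h j))" if "finite S" for h and S :: "'a set"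
    using that g(3)[of 0] by induction (auto simp: g(1))
  have "rat_column A x = (\<Sum>j\<in>UNIV. g (v $ j) *s rat_column A j)"
  proof (rule vec_eq_iff[THEN iffD2], rule allI)
    fix y
    have "(\<Sum>j\<in>UNIV. of_int (A $ y $ j) * v $ j) =
        (\<Sum>j\<in>UNIV. of_int (A $ y $ j) * (of_nat (\<eta> $ j) + \<alpha> $ j))"
      using arg_cong[OF A_v, of "\<lambda>w. w $ y"]
      by (simp add: matrix_vector_mult_def map_matrix_def of_nat_vec_def)
    then have "(\<Sum>j\<in>UNIV. of_int (A $ y $ j) * g (v $ j)) =
        (\<Sum>j\<in>UNIV. of_int (A $ y $ j) * g (of_nat (\<eta> $ j) + \<alpha> $ j))"
      by (metis (mono_tags, lifting) g_sum g_int sum.cong finite_class.finite_UNIV)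
    also have "\<dots> = of_int (A $ y $ x)"
      by (simp add: g_\<eta>\<alpha> if_distrib[of "\<lambda>t. _ * t"] cong: if_cong)
    finally show "rat_column A x $ y = (\<Sum>j\<in>UNIV. g (v $ j) *s rat_column A j) $ y"
      by (simp add: rat_column_def mult.commute)
  qed
  also have "\<dots> \<in> vec.span (rat_column A ` {j. v $ j \<notin> \<rat>})"
  proof (rule vec.span_sum)
    fix j
    show "g (v $ j) *s rat_column A j \<in> vec.span (rat_column A ` {j. v $ j \<notin> \<rat>})"
    proof (cases "v $ j \<in> \<rat>")
      case True
      then have "g (v $ j) = 0" using g(3) Rats_rat by metis
      then show ?thesis by (simp add: vec.span_zero)
    qed (simp add: vec.span_scale vec.span_base)
  qed
  finally show ?thesis .
qed

lemma irrational_coordinates_eq_\<tau>: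
  assumes "card {j. v $ j \<notin> \<rat>} \<le> card \<tau>"
  shows "{j. v $ j \<notin> \<rat>} = \<tau>"
  by (rule spanning_eq_\<tau>[OF irrational_coordinates_span _ assms]) (auto simp: v_i)

lemma irrational_subset: "{j. v $ j \<notin> \<rat>} \<subseteq> support_face v - {i}"
  using Nats_subset_Rats by (auto simp: support_face_def v_i)

lemma card_support_face: "card (support_face v) \<le> CARD('b)"
  by (rule optimal_zero_card_le[OF inj_columns optimal_support_face_zero[OF fake]])

lemma support_face_small:
  assumes "card (support_face v) < CARD('b)"
  shows "support_face v = \<sigma>\<^sub>0"
proof -
  have i: "i \<in> support_face v" by (simp add: support_face_def)
  have "card {j. v $ j \<notin> \<rat>} \<le> card (support_face v - {i})"
    by (rule card_mono[OF _ irrational_subset]) simp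
  also have "\<dots> \<le> card \<tau>" using assms card_\<tau> i by simp
  finally have "{j. v $ j \<notin> \<rat>} = \<tau>" by (rule irrational_coordinates_eq_\<tau>)
  then have "\<sigma>\<^sub>0 \<subseteq> support_face v" using irrational_subset i by auto
  then show ?thesis using assms card_\<sigma>\<^sub>0 by (intro card_seteq[symmetric]) auto
qed

text \<open>\<open>c\<close> combines the Euler operators. For an index \<open>j\<close> of nonzero
  weight, let p be the negative part of \<open>k\<close>. The inequality at \<open>j\<close> means
  p_j > v_j, so \<theta>_j - v_j is a factor of x^p \<partial>^p; the inequalities at the other
  \<open>x\<close> mean p_x \<le> v_x, so no other factor vanishes at \<open>v\<close>.\<close>

lemma weights_exist:
  obtains c :: "'b \<Rightarrow> rat" where "(\<Sum>x\<in>UNIV. c x * of_int (A $ x $ i)) = 1"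
    "\<And>j. j \<noteq> i \<Longrightarrow> (\<Sum>x\<in>UNIV. c x * of_int (A $ x $ j)) \<noteq> 0 \<Longrightarrow> v $ j \<in> \<nat> \<and>
      (\<exists>k\<in>kerZ A. 0 < k $ i \<and> \<lfloor>Re (v $ j)\<rfloor> + k $ j < 0 \<and> (\<forall>x. x \<noteq> i \<and> x \<noteq> j \<and> v $ x \<in> \<nat> \<longrightarrow> 0 \<le> \<lfloor>Re (v $ x)\<rfloor> + k $ x))"
proof -
  let ?S = "support_face v" and ?val = "\<lambda>j. \<lfloor>Re (v $ j)\<rfloor>"
  \<comment> \<open>An index outside the face is bad if freeing it as well still allows no kernel
    vector that increases entry \<open>i\<close>.\<close>
  define bad where "bad = {j. j \<noteq> i \<and> (j \<in> ?S \<or> optimal A i (insert j ?S) ?val)}"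
  have val: "0 \<le> ?val j" if "j \<notin> ?S" for j
    using that Nats_floor[of "v $ j"] by (auto simp: support_face_def)
  have triv: "optimal A i (insert j ?S) (\<lambda>_. 0)" if "j \<in> bad" "j \<notin> ?S" for j
    using that by (intro optimal_zero[of A i "insert j ?S" ?val] val) (auto simp: bad_def)
  have no_kernel: "k = 0" if k: "k \<in> kerZ A" "\<And>x. x \<notin> insert i bad \<Longrightarrow> k $ x = 0" for k
  proof (cases "bad \<subseteq> ?S")
    case True
    then show ?thesis
      by (intro optimal_zero_supported[OF optimal_support_face_zero[OF fake] k(1)] k(2))
        (auto simp: support_face_def)
  next
    case False
    \<comment> \<open>Adding \<open>l\<close> keeps the columns independent, so the face has fewer
      than d elements and must be \<open>\<sigma>\<^sub>0\<close>; there the extending index is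
      unique.\<close>
    then obtain l where l: "l \<in> bad" "l \<notin> ?S" by blast
    have "card (insert l ?S) \<le> CARD('b)"
      by (rule optimal_zero_card_le[OF inj_columns triv[OF l]])
    then have S: "?S = \<sigma>\<^sub>0" using l(2) by (intro support_face_small) simp
    have "bad \<subseteq> insert l \<sigma>\<^sub>0"
    proof
      fix j assume j: "j \<in> bad"
      show "j \<in> insert l \<sigma>\<^sub>0"
      proof (cases "j \<in> ?S")
        case False
        then have "j = l"
          using triv j l optimal_extension_unique[of j l] unfolding S by blast
        then show ?thesis by simp
      qed (simp add: S)
    qed
    then show ?thesis using triv[OF l] unfolding S
      by (intro optimal_zero_supported[of A i "insert l \<sigma>\<^sub>0"] k) auto
  qed
  have "rat_column A i \<notin> vec.span (rat_column A ` bad)"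
  proof
    assume "rat_column A i \<in> vec.span (rat_column A ` bad)"
    then obtain k where "k \<in> kerZ A" "0 < k $ i" "\<And>x. x \<notin> insert i bad \<Longrightarrow> k $ x = 0"
      by (rule rat_column_in_span[OF inj_columns]) (auto simp: bad_def)
    then show False using no_kernel[of k] by auto
  qed
  from exists_functional[OF vec.vector_space_axioms this]
  obtain g where g: "Vector_Spaces.linear (*s) (*) g" "g (rat_column A i) = 1"
    "\<And>y. y \<in> rat_column A ` bad \<Longrightarrow> g y = 0" by blast
  interpret g: Vector_Spaces.linear "(*s)" "(*)" g by fact
  have g_col: "(\<Sum>x\<in>UNIV. g (axis x 1) * of_int (A $ x $ j)) = g (rat_column A j)" for j
  proof -
    have "g (rat_column A j) = g (\<Sum>x\<in>UNIV. (rat_column A j) $ x *s axis x 1)"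
      by (simp add: basis_expansion)
    also have "\<dots> = (\<Sum>x\<in>UNIV. g (axis x 1) * of_int (A $ x $ j))"
      by (simp add: g.sum g.scale rat_column_def mult.commute)
    finally show ?thesis ..
  qed
  show thesis
  proof (rule that[of "\<lambda>x. g (axis x 1)"], unfold g_col)
    show "g (rat_column A i) = 1" by fact
    fix j assume j: "j \<noteq> i" "g (rat_column A j) \<noteq> 0"
    then have "j \<notin> bad" using g(3) by blast
    then have jS: "j \<notin> ?S" and nopt: "\<not> optimal A i (insert j ?S) ?val" using j(1) by (auto simp: bad_def)
    obtain k where k: "k \<in> kerZ A" "0 < k $ i" "\<And>x. x \<notin> insert j ?S \<Longrightarrow> 0 \<le> ?val x + k $ x"
      by (rule not_optimalE[OF gen _ nopt]) (simp add: support_face_def, use val in blast, blast)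
    \<comment> \<open>Otherwise \<open>k\<close> would already be feasible for the face of
      \<open>v\<close>.\<close>
    have "?val j + k $ j < 0"
    proof (rule ccontr)
      assume "\<not> ?thesis"
      then have "k = 0" using k by (intro optimalD[OF fake_exponent_optimal[OF fake] k(1)])
          (simp, metis insert_iff not_le)
      with k(2) show False by simp
    qed
    moreover note k
    moreover have "v $ j \<in> \<nat>" using jS by (auto simp: support_face_def)
    ultimately show "v $ j \<in> \<nat> \<and>
      (\<exists>k\<in>kerZ A. 0 < k $ i \<and> \<lfloor>Re (v $ j)\<rfloor> + k $ j < 0 \<and> (\<forall>x. x \<noteq> i \<and> x \<noteq> j \<and> v $ x \<in> \<nat> \<longrightarrow> 0 \<le> ?val x + k $ x))"
      by (auto simp: support_face_def)
  qed
qed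

section \<open>Negative supports of the shifted exponent v - e_1\<close>

lemma nsupp_shift: "nsupp (v - axis i 1) = insert i (nsupp v)"
proof (rule set_eqI)
  fix j show "j \<in> nsupp (v - axis i 1) \<longleftrightarrow> j \<in> insert i (nsupp v)"
    using nsupp_of_int[of "v - axis i 1" i "-1"] v_i by (cases "j = i") (auto simp: nsupp_def axis_def)
qed

text \<open>Entry \<open>i\<close> is \<open>k $ i - 1\<close> and stays negative; natural
  coordinates of \<open>v\<close> stay nonnegative, which makes \<open>k\<close> feasible for
  optimality when \<open>k $ i = 0\<close>. So x_1 times the series of v - e_1 has only nonpositive
  degrees in x_1, with x^v alone in degree 0.\<close>

lemma nsupp_shift_eqD:
  assumes k: "k \<in> kerZ A" and ns: "nsupp (v - axis i 1 + of_int_vec k) = nsupp (v - axis i 1)"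
  shows "k $ i \<le> 0" "k $ i = 0 \<Longrightarrow> k = 0"
proof -
  have "i \<in> nsupp (v - axis i 1 + of_int_vec k)" by (simp add: ns nsupp_shift)
  then show "k $ i \<le> 0"
    by (subst (asm) nsupp_of_int[of _ _ "k $ i - 1"]) (auto simp: v_i of_int_vec_def)
  assume ki: "k $ i = 0"
  show "k = 0"
  proof (rule optimalD[OF fake_exponent_optimal[OF fake] k])
    fix j assume j: "j \<notin> support_face v"
    then have vj: "v $ j \<in> \<nat>" "j \<noteq> i" by (auto simp: support_face_def)
    then have "j \<notin> nsupp (v - axis i 1 + of_int_vec k)"
      using Nats_not_nsupp by (simp add: ns nsupp_shift)
    moreover have "(v - axis i 1 + of_int_vec k) $ j = of_int (\<lfloor>Re (v $ j)\<rfloor> + k $ j)"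
      using vj Nats_floor[OF vj(1)] by (simp add: axis_def of_int_vec_def)
    ultimately show "0 \<le> \<lfloor>Re (v $ j)\<rfloor> + k $ j" using nsupp_of_int by (metis not_le)
  qed (simp add: ki)
qed

text \<open>The place of condition (ii). Removing a negative coordinate \<open>x\<close> forces the
  face of \<open>v\<close> to be \<open>insert x \<sigma>\<^sub>0\<close>. Among the kernel vectors
  clearing all negative coordinates outside \<open>\<sigma>\<^sub>0\<close>, one with smallest entry
  \<open>i\<close> yields either a standard pair violating (ii) or a violation of
  optimality.\<close>

lemma minimal_negative_support_shift:
  assumes minv: "minimal_negative_support A v"
  shows "minimal_negative_support A (v - axis i 1)"
  unfolding minimal_negative_support_def
proof (intro ballI impI)
  let ?val = "\<lambda>j. \<lfloor>Re (v $ j)\<rfloor>"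
  fix k assume k: "k \<in> kerZ A" and sub: "nsupp (v - axis i 1 - of_int_vec k) \<subseteq> nsupp (v - axis i 1)"
  have shifted: "(v - axis i 1 - of_int_vec k) $ j = of_int (a - k $ j)" if "v $ j = of_int a" "j \<noteq> i" for a j
    using that by (simp add: axis_def of_int_vec_def)
  have at_i: "(v - axis i 1 - of_int_vec k) $ i = of_int (- 1 - k $ i)"
    by (simp add: v_i of_int_vec_def)
  have nonneg: "0 \<le> ?val j - k $ j" if "j \<noteq> i" "v $ j \<in> \<nat>" for j
  proof -
    have "j \<notin> nsupp (v - axis i 1 - of_int_vec k)"
      using sub that Nats_not_nsupp[of v j] by (auto simp: nsupp_shift)
    then show ?thesis using Nats_floor[OF that(2)] shifted[OF _ that(1)] nsupp_of_int by (metis not_le)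
  qed
  show "nsupp (v - axis i 1 - of_int_vec k) = nsupp (v - axis i 1)"
  proof (rule ccontr)
    assume neq: "\<not> ?thesis"
    have ki: "0 \<le> k $ i"
    proof (rule ccontr)
      assume "\<not> 0 \<le> k $ i"
      then have "- k = 0"
        using nonneg by (intro optimalD[OF fake_exponent_optimal[OF fake] kerZ_uminus[OF k]])
          (auto simp: support_face_def)
      with \<open>\<not> 0 \<le> k $ i\<close> show False by simp
    qed
    then have "i \<in> nsupp (v - axis i 1 - of_int_vec k)"
      unfolding nsupp_of_int[OF at_i] by simp
    then obtain x where x: "x \<in> nsupp v" "x \<noteq> i" "x \<notin> nsupp (v - axis i 1 - of_int_vec k)"
      using neq sub unfolding nsupp_shift by blast
    obtain a :: int where a: "v $ x = of_int a" "a < 0" using x(1) by (auto simp: nsupp_def)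
    have xS: "x \<in> support_face v" using x(1) Nats_not_nsupp by (auto simp: support_face_def)
    have iS: "i \<in> support_face v" by (simp add: support_face_def)
    \<comment> \<open>Both \<open>i\<close> and \<open>x\<close> have integer coordinates, which
      leaves room for at most d - 2 irrational ones.\<close>
    have "card {j. v $ j \<notin> \<rat>} \<le> card (support_face v - {i} - {x})"
      using irrational_subset a(1) by (intro card_mono) auto
    also have "\<dots> \<le> card \<tau>" using card_support_face card_\<tau> iS xS x(2) by simp
    finally have \<rho>: "{j. v $ j \<notin> \<rat>} = \<tau>" by (rule irrational_coordinates_eq_\<tau>)
    have x_notin: "x \<notin> \<sigma>\<^sub>0" using x(2) a(1) \<rho> by auto
    have "insert x \<sigma>\<^sub>0 \<subseteq> support_face v" using \<rho> irrational_subset xS iS by auto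
    then have S: "support_face v = insert x \<sigma>\<^sub>0"
      using card_support_face card_\<sigma>\<^sub>0 x_notin by (intro card_seteq[symmetric]) auto
    have int: "v $ j = of_int (?val j)" if "j \<notin> \<sigma>\<^sub>0" for j
    proof (cases "j = x")
      case False
      then have "v $ j \<in> \<nat>" using that S by (auto simp: support_face_def)
      then show ?thesis using Nats_floor by blast
    qed (simp add: a)
    define Z where "Z h \<longleftrightarrow> h \<in> kerZ A \<and> (\<forall>j. j \<notin> \<sigma>\<^sub>0 \<longrightarrow> 0 \<le> ?val j - h $ j)" for h
    have "Z k"
      unfolding Z_def
    proof (intro conjI allI impI)
      fix j assume j: "j \<notin> \<sigma>\<^sub>0"
      show "0 \<le> ?val j - k $ j"
      proof (cases "j = x")
        case True
        then show ?thesis using x shifted[OF int] nsupp_of_int j by (metis not_le)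
      next
        case False
        then show ?thesis using j S by (intro nonneg) (auto simp: support_face_def)
      qed
    qed (rule k)
    \<comment> \<open>Otherwise \<open>v - of_int_vec h\<close> has empty negative support, since
      the coordinates over \<tau> are irrational; but \<open>v\<close> is minimal and negative at
      \<open>x\<close>.\<close>
    have Z_pos: "0 < h $ i" if "Z h" for h
    proof (rule ccontr)
      assume hi: "\<not> 0 < h $ i"
      have "nsupp (v - of_int_vec h) = {}"
      proof (rule ccontr)
        assume "nsupp (v - of_int_vec h) \<noteq> {}"
        then obtain j and m :: int where m: "m < 0" "v $ j - of_int (h $ j) = of_int m"
          by (auto simp: nsupp_def of_int_vec_def)
        then have vj: "v $ j = of_int (m + h $ j)" by (simp add: algebra_simps)
        then have "v $ j \<in> \<rat>" by simp
        then have "j \<notin> \<tau>" using \<rho> by auto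
        moreover have "j \<noteq> i"
        proof
          assume "j = i"
          then have "of_int (m + h $ i) = (of_int 0 :: complex)" using vj v_i by simp
          then show False using hi m(1) by (simp only: of_int_eq_iff)
        qed
        ultimately have "0 \<le> ?val j - h $ j" using that by (simp add: Z_def)
        then show False using vj m(1) by simp
      qed
      then show False
        using minv that x(1) unfolding minimal_negative_support_def Z_def by auto
    qed
    obtain h where h: "Z h" and h_min: "\<And>h'. Z h' \<Longrightarrow> nat (h $ i) \<le> nat (h' $ i)"
      using ex_has_least_nat[of Z k "\<lambda>h. nat (h $ i)"] \<open>Z k\<close> by blast
    have h_ker: "h \<in> kerZ A" and hi: "0 < h $ i" using h Z_pos by (auto simp: Z_def)
    \<comment> \<open>Any improvement \<open>k'\<close> could be subtracted from \<open>h\<close>,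
      lowering entry \<open>i\<close> further.\<close>
    have opt: "optimal A i \<sigma>\<^sub>0 (\<lambda>j. ?val j - h $ j)"
    proof (rule ccontr)
      assume nopt: "\<not> ?thesis"
      obtain k' where k': "k' \<in> kerZ A" "0 < k' $ i" "\<And>j. j \<notin> \<sigma>\<^sub>0 \<Longrightarrow> 0 \<le> ?val j - h $ j + k' $ j"
        by (rule not_optimalE[OF gen _ nopt]) (simp, use h in \<open>simp add: Z_def\<close>, blast)
      then have "Z (h - k')" using h_ker by (auto simp: Z_def kerZ_diff algebra_simps)
      from h_min[OF this] Z_pos[OF this] k'(2) show False by simp
    qed
    define \<mu> where "\<mu> = (\<chi> j. if j \<in> \<sigma>\<^sub>0 then 0 else nat (?val j - h $ j))"
    have \<mu>: "int (\<mu> $ j) = ?val j - h $ j" if "j \<notin> \<sigma>\<^sub>0" for j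
      using h that by (simp add: \<mu>_def Z_def)
    have opt_\<mu>: "optimal A i \<sigma>\<^sub>0 (\<lambda>j. int (\<mu> $ j))"
      by (rule optimal_subset[OF opt]) (auto simp: \<mu>)
    show False
    proof (cases "standard_pair (initial_ideal (- axis i 1) (toric_ideal A)) \<mu> \<sigma>\<^sub>0")
      case True
      \<comment> \<open>The complex kernel vector for condition (ii): it takes \<eta> to \<mu>
        outside the face and has entry \<open>h $ i\<close> at \<open>i\<close>.\<close>
      define z where "z = of_nat_vec \<eta> + \<alpha> - (v - of_int_vec h)"
      have "of_int_mat A *v (of_int_vec h :: complex^'a) = 0"
      proof (rule vec_eq_iff[THEN iffD2], rule allI)
        fix y
        have "(\<Sum>j\<in>UNIV. A $ y $ j * h $ j) = 0"
          using h_ker by (simp add: kerZ_def matrix_vector_mult_def vec_eq_iff)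
        then have "of_int (\<Sum>j\<in>UNIV. A $ y $ j * h $ j) = (0::complex)" by (simp only: of_int_0)
        then show "(of_int_mat A *v (of_int_vec h :: complex^'a)) $ y = 0 $ y"
          by (simp add: matrix_vector_mult_def map_matrix_def of_int_vec_def)
      qed
      then have Az: "of_int_mat A *v z = 0"
        unfolding z_def using A_v
        by (simp add: matrix_vector_mult_diff_distrib matrix_vector_right_distrib)
      have "of_nat (\<mu> $ j) = of_nat (\<eta> $ j) - z $ j" if "j \<notin> \<sigma>\<^sub>0" for j
      proof -
        have "(of_nat (\<mu> $ j) :: complex) = of_int (int (\<mu> $ j))" by simp
        also have "\<dots> = v $ j - of_int (h $ j)" using int[OF that] by (simp add: \<mu>[OF that])
        finally show ?thesis using that \<alpha>_eq_0[of j] by (simp add: z_def of_nat_vec_def of_int_vec_def)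
      qed
      moreover have "z $ i = of_int (h $ i)"
        using \<alpha>_eq_0[OF i_notin] \<eta>_eq_0[of i] by (simp add: z_def of_nat_vec_def of_int_vec_def v_i)
      ultimately have "h $ i \<le> 0" by (rule cond_ii[OF True Az])
      then show False using hi by simp
    next
      case False
      then obtain l where l: "l \<notin> \<sigma>\<^sub>0" "optimal A i (insert l \<sigma>\<^sub>0) (\<lambda>j. int (\<mu> $ j))"
        using opt_\<mu> by (auto simp: standard_pair_iff_optimal[OF gen] \<mu>_def)
      have "optimal A i (insert l \<sigma>\<^sub>0) (\<lambda>_. 0)" by (rule optimal_zero[OF l(2)]) simp
      then have "l = x"
        using optimal_extension_unique[OF l(1) _ x_notin] optimal_support_face_zero[OF fake] S by simp
      \<comment> \<open>Away from \<open>x\<close>, adding \<open>h\<close> back to \<mu> restores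
        the natural coordinates of \<open>v\<close>, so \<open>h\<close> is feasible.\<close>
      have "h = 0"
      proof (rule optimalD[OF l(2) h_ker])
        show "0 \<le> int (\<mu> $ j) + h $ j" if j: "j \<notin> insert l \<sigma>\<^sub>0" for j
        proof -
          have "v $ j \<in> \<nat>" using j S \<open>l = x\<close> by (auto simp: support_face_def)
          then show ?thesis using \<mu>[of j] j Nats_floor by auto
        qed
      qed (use hi in simp)
      then show False using hi by simp
    qed
  qed
qed

lemma shift_mem_minimal_fake_exponents:
  assumes "minimal_negative_support A v"
  shows "v - axis i 1 \<in> minimal_fake_exponents (- axis i 1) A
    (of_int_mat A *v (of_nat_vec \<eta> + \<alpha> - axis i 1))"
proof -
  obtain \<mu> \<sigma> where sp: "standard_pair (initial_ideal (- axis i 1) (toric_ideal A)) \<mu> \<sigma>"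
    and v: "\<And>j. j \<notin> \<sigma> \<Longrightarrow> v $ j = of_nat (\<mu> $ j)"
    using fake unfolding fake_exponents_def by auto
  have "i \<in> \<sigma>" using standard_pair_index_mem[OF gen sp] .
  then have "\<forall>j. j \<notin> \<sigma> \<longrightarrow> (v - axis i 1) $ j = of_nat (\<mu> $ j)"
    using v by (auto simp: axis_def)
  then show ?thesis
    using sp A_v minimal_negative_support_shift[OF assms]
    by (auto simp: minimal_fake_exponents_def fake_exponents_def matrix_vector_mult_diff_distrib)
qed

end

section \<open>Euler derivatives of separately holomorphic functions\<close>

lemma axis_add: "axis j (s + t) = axis j s + (axis j t :: 'a::monoid_add^'n)"
  by (simp add: axis_def vec_eq_iff)

lemma axis_zero [simp]: "axis j (0 :: 'a::zero) = 0"
  by (simp add: axis_def vec_eq_iff)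

lemma norm_axis_complex [simp]: "norm (axis j (t :: complex)) = norm t"
  by (simp add: norm_vec_def L2_set_def axis_def if_distrib[of norm] if_distrib[of "\<lambda>x. x\<^sup>2"]
      cong: if_cong)

text \<open>In logarithmic coordinates \<open>\<partial>/\<partial>z\<^sub>j\<close> is the operator \<open>\<theta>\<^sub>j = x\<^sub>j \<partial>/\<partial>x\<^sub>j\<close>.\<close>

definition theta :: "(complex^'n) set \<Rightarrow> 'n \<Rightarrow> (complex^'n \<Rightarrow> complex) \<Rightarrow> complex^'n \<Rightarrow> complex" where
  "theta W j f z = (if z \<in> W then deriv (\<lambda>t. f (z + axis j t)) 0 else 0)"

text \<open>Continuity and holomorphy in each variable: inherited by \<theta>_j f through
  one-variable Cauchy estimates, and sufficient for the \<theta>_j to commute.\<close>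

definition sep_holomorphic :: "(complex^'n) set \<Rightarrow> (complex^'n \<Rightarrow> complex) \<Rightarrow> bool" where
  "sep_holomorphic W f \<longleftrightarrow> continuous_on W f \<and> (\<forall>z. z \<notin> W \<longrightarrow> f z = 0) \<and>
     (\<forall>z\<in>W. \<forall>j. (\<lambda>t. f (z + axis j t)) field_differentiable (at 0))"

lemma dx_eq_theta: "dx W j f = (\<lambda>z. exp (- (z $ j)) * theta W j f z)"
  by (auto simp: dx_def theta_def)

lemma holomorphic_Cn_imp_sep_holomorphic:
  fixes f :: "complex^'n::finite \<Rightarrow> complex"
  assumes "holomorphic_Cn W f" "\<And>z. z \<notin> W \<Longrightarrow> f z = 0"
  shows "sep_holomorphic W f"
  unfolding sep_holomorphic_def
proof (intro conjI allI impI ballI)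
  show "continuous_on W f"
    using assms(1) unfolding holomorphic_Cn_def
    by (meson continuous_at_imp_continuous_on has_derivative_continuous)
  fix z j assume "z \<in> W"
  then obtain D where D: "(f has_derivative D) (at z)" "\<And>c v. D (c *s v) = c * D v"
    using assms(1) unfolding holomorphic_Cn_def by blast
  have line: "((\<lambda>t. z + axis j t) has_derivative (\<lambda>t. axis j t)) (at 0)"
  proof -
    have bl: "bounded_linear (\<lambda>t::complex. axis j t)"
      by (rule bounded_linear_intro[where K = 1]) (auto simp: axis_def vec_eq_iff scaleR_vec_def norm_axis_complex[unfolded axis_def])
    from has_derivative_add[OF has_derivative_const bounded_linear.has_derivative[OF bl has_derivative_ident]]
    show ?thesis by simp
  qed
  have "(f has_derivative D) (at (z + axis j 0))" using D(1) by simp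
  from has_derivative_compose[OF line this]
  have "((\<lambda>t. f (z + axis j t)) has_derivative (\<lambda>t. D (axis j t))) (at 0)" .
  moreover have "(\<lambda>t. D (axis j t)) = (*) (D (axis j 1))"
  proof
    fix t :: complex
    have "axis j t = t *s axis j 1" by (simp add: axis_def vec_eq_iff)
    then show "D (axis j t) = D (axis j 1) * t" using D(2)[of t "axis j 1"] by (simp only: mult.commute)
  qed
  ultimately have "((\<lambda>t. f (z + axis j t)) has_field_derivative D (axis j 1)) (at 0)"
    unfolding has_field_derivative_def by simp
  then show "(\<lambda>t. f (z + axis j t)) field_differentiable (at 0)"
    by (auto simp: field_differentiable_def)
qed (rule assms(2))

locale open_domain =
  fixes W :: "(complex^'n::finite) set"
  assumes W_open: "open W"
begin

lemma theta_has_field_derivative: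
  assumes "sep_holomorphic W f" "z + axis j t \<in> W"
  shows "((\<lambda>t. f (z + axis j t)) has_field_derivative theta W j f (z + axis j t)) (at t)"
proof -
  have "(\<lambda>s. f ((z + axis j t) + axis j s)) field_differentiable (at 0)"
    using assms unfolding sep_holomorphic_def by blast
  then have "((\<lambda>s. f ((z + axis j t) + axis j s)) has_field_derivative theta W j f (z + axis j t)) (at 0)"
    using assms(2) by (simp add: theta_def field_differentiable_derivI)
  then have "((\<lambda>s. f (z + axis j (t + s))) has_field_derivative theta W j f (z + axis j t)) (at 0)"
    by (simp add: axis_add add.assoc)
  then show ?thesis using DERIV_shift[of "\<lambda>s. f (z + axis j s)" _ 0 t] by (simp add: add.commute)
qed

lemma theta_has_field_derivative_0:
  assumes "sep_holomorphic W f" "z \<in> W"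
  shows "((\<lambda>t. f (z + axis j t)) has_field_derivative theta W j f z) (at 0)"
  using theta_has_field_derivative[OF assms(1), of z j 0] assms(2) by simp

lemma thetaI:
  assumes "((\<lambda>t. f (z + axis j t)) has_field_derivative D) (at 0)" "z \<in> W"
  shows "theta W j f z = D"
  using assms by (simp add: theta_def DERIV_imp_deriv)

lemma radius:
  assumes "z \<in> W"
  obtains r where "r > 0" "cball z (3 * r) \<subseteq> W"
proof -
  obtain e where "e > 0" "cball z e \<subseteq> W"
    using open_contains_cball_eq[OF W_open] assms by blast
  then show thesis by (intro that[of "e / 3"]) auto
qed

lemma sep_holomorphic_line:
  assumes "sep_holomorphic W f" "\<And>t. t \<in> S \<Longrightarrow> z + axis j t \<in> W"
  shows "(\<lambda>t. f (z + axis j t)) holomorphic_on S"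
  unfolding holomorphic_on_def
  using theta_has_field_derivative[OF assms(1) assms(2)]
  by (meson field_differentiable_at_within field_differentiable_def)

text \<open>A Cauchy estimate on a circle of radius \<open>r\<close> bounds the difference of the
  derivatives at two base points by the distance of the values of \<open>f\<close> along the two
  lines.\<close>

lemma theta_continuous:
  assumes f: "sep_holomorphic W f"
  shows "continuous_on W (theta W j f)"
  unfolding continuous_on_iff
proof (intro ballI allI impI)
  fix z0 and e :: real assume z0: "z0 \<in> W" and e: "0 < e"
  obtain r where r: "r > 0" "cball z0 (3 * r) \<subseteq> W" using radius[OF z0] .
  have "uniformly_continuous_on (cball z0 (3 * r)) f"
    using f r(2) unfolding sep_holomorphic_def
    by (intro compact_uniformly_continuous) (auto intro: continuous_on_subset)
  then obtain d where d: "d > 0" "\<And>x y. x \<in> cball z0 (3 * r) \<Longrightarrow> y \<in> cball z0 (3 * r) \<Longrightarrow>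
      dist y x < d \<Longrightarrow> dist (f y) (f x) < e / 2 * r"
    using e r(1) unfolding uniformly_continuous_on_def
    by (metis half_gt_zero mult_pos_pos)
  show "\<exists>d>0. \<forall>z\<in>W. dist z z0 < d \<longrightarrow> dist (theta W j f z) (theta W j f z0) < e"
  proof (intro exI[of _ "min d r"] conjI ballI impI)
    fix z assume z: "z \<in> W" "dist z z0 < min d r"
    define h where "h t = f (z + axis j t) - f (z0 + axis j t)" for t
    have in_cball: "z + axis j t \<in> cball z0 (3 * r)" "z0 + axis j t \<in> cball z0 (3 * r)"
      if "norm t \<le> r" for t
    proof -
      have "dist z0 (z + axis j t) \<le> dist z0 z + norm t"
        using dist_triangle[of z0 "z + axis j t" z] by (simp add: dist_norm)
      then show "z + axis j t \<in> cball z0 (3 * r)" using z(2) that r(1) by (simp add: dist_commute)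
      show "z0 + axis j t \<in> cball z0 (3 * r)" using that r(1) by (simp add: dist_norm)
    qed
    have hol: "h holomorphic_on cball 0 r"
      unfolding h_def using in_cball r(2) by (intro holomorphic_on_diff sep_holomorphic_line[OF f]) auto
    have "norm ((deriv ^^ 1) h 0) \<le> fact 1 * (e / 2 * r) / r ^ 1"
    proof (rule Cauchy_inequality)
      show "h holomorphic_on ball 0 r" using hol holomorphic_on_subset ball_subset_cball by blast
      show "continuous_on (cball 0 r) h" using hol by (rule holomorphic_on_imp_continuous_on)
      show "norm (h t) \<le> e / 2 * r" if "norm (0 - t) = r" for t
      proof -
        have "dist (z + axis j t) (z0 + axis j t) < d" using z(2) by (simp add: dist_norm)
        then have "dist (f (z + axis j t)) (f (z0 + axis j t)) < e / 2 * r"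
          using in_cball[of t] that by (intro d(2)) auto
        then show ?thesis by (simp add: h_def dist_norm)
      qed
    qed (rule r(1))
    moreover have "(h has_field_derivative theta W j f z - theta W j f z0) (at 0)"
      unfolding h_def
      by (intro DERIV_diff theta_has_field_derivative_0[OF f] z z0)
    then have "deriv h 0 = theta W j f z - theta W j f z0" by (rule DERIV_imp_deriv)
    ultimately have "norm (theta W j f z - theta W j f z0) \<le> e / 2" using r(1) by simp
    then show "dist (theta W j f z) (theta W j f z0) < e" using e by (simp add: dist_norm)
  qed (use d r in auto)
qed

text \<open>The difference quotients of \<open>f\<close> in direction \<open>k\<close> converge to \<open>\<theta>\<^sub>k f\<close> uniformly along direction
  \<open>j\<close>, so their derivatives in direction \<open>j\<close> converge as well. This gives both the existence of
  \<open>\<theta>\<^sub>k \<theta>\<^sub>j f\<close> and the symmetry of second derivatives.\<close>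

lemma theta_theta:
  assumes f: "sep_holomorphic W f" and z: "z \<in> W"
  shows "((\<lambda>s. theta W j f (z + axis k s)) has_field_derivative theta W j (theta W k f) z) (at 0)"
proof -
  obtain r where r: "r > 0" "cball z (3 * r) \<subseteq> W" using radius[OF z] .
  define q where "q s \<zeta> = (f ((z + axis k s) + axis j \<zeta>) - f (z + axis j \<zeta>)) / s" for s \<zeta>
  define q' where "q' s \<zeta> = (theta W j f ((z + axis k s) + axis j \<zeta>) - theta W j f (z + axis j \<zeta>)) / s" for s \<zeta>
  have in_cball: "z + axis k s + axis j \<zeta> \<in> cball z (3 * r)" "z + axis j \<zeta> \<in> cball z (3 * r)"
    if "norm s \<le> r" "norm \<zeta> \<le> r" for s \<zeta>
  proof -
    have "norm (axis k s + axis j \<zeta>) \<le> norm s + norm \<zeta>"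
      using norm_triangle_ineq[of "axis k s" "axis j \<zeta>"] by simp
    moreover have "dist z (z + axis k s + axis j \<zeta>) = norm (axis k s + axis j \<zeta>)"
      by (metis add.assoc add_diff_cancel_left' dist_commute dist_norm)
    ultimately show "z + axis k s + axis j \<zeta> \<in> cball z (3 * r)" using that r(1) by simp
    show "z + axis j \<zeta> \<in> cball z (3 * r)" using that r(1) by (simp add: dist_norm)
  qed
  have ev: "eventually (\<lambda>s. s \<noteq> 0 \<and> norm s < r) (at (0::complex))"
    unfolding eventually_at using r(1) by (intro exI[of _ r]) auto
  obtain g' where g': "\<And>w. w \<in> ball 0 r \<Longrightarrow>
      ((\<lambda>\<zeta>. theta W k f (z + axis j \<zeta>)) has_field_derivative g' w) (at w) \<and>
      ((\<lambda>s. q' s w) \<longlongrightarrow> g' w) (at 0)"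
  proof (rule has_complex_derivative_uniform_limit[of 0 r q q' "at 0" "\<lambda>\<zeta>. theta W k f (z + axis j \<zeta>)"])
    show "eventually (\<lambda>s. continuous_on (cball 0 r) (q s) \<and>
        (\<forall>w\<in>ball 0 r. (q s has_field_derivative q' s w) (at w))) (at 0)"
    proof (rule eventually_mono[OF ev], intro conjI ballI)
      fix s :: complex assume s: "s \<noteq> 0 \<and> norm s < r"
      have "q s holomorphic_on cball 0 r"
        unfolding q_def using in_cball[of s] s r(2)
        by (intro holomorphic_on_divide holomorphic_on_diff sep_holomorphic_line[OF f]) auto
      then show "continuous_on (cball 0 r) (q s)" by (rule holomorphic_on_imp_continuous_on)
      fix w :: complex assume w: "w \<in> ball 0 r"
      then have "z + axis k s + axis j w \<in> W" "z + axis j w \<in> W"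
        using in_cball[of s w] s r(2) by auto
      then show "(q s has_field_derivative q' s w) (at w)"
        unfolding q_def q'_def by (intro DERIV_cdivide DERIV_diff theta_has_field_derivative[OF f])
    qed
    show "uniform_limit (cball 0 r) q (\<lambda>\<zeta>. theta W k f (z + axis j \<zeta>)) (at 0)"
      unfolding uniform_limit_iff
    proof (intro allI impI)
      fix e :: real assume e: "e > 0"
      have "uniformly_continuous_on (cball z (3 * r)) (theta W k f)"
        using theta_continuous[OF f] r(2)
        by (intro compact_uniformly_continuous) (auto intro: continuous_on_subset)
      then obtain d where d: "d > 0" "\<And>x y. x \<in> cball z (3 * r) \<Longrightarrow> y \<in> cball z (3 * r) \<Longrightarrow>
          dist y x < d \<Longrightarrow> dist (theta W k f y) (theta W k f x) < e / 2"
        using e unfolding uniformly_continuous_on_def by (metis half_gt_zero)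
      have "eventually (\<lambda>s. s \<noteq> 0 \<and> norm s < min d r) (at (0::complex))"
        unfolding eventually_at using r(1) d(1) by (intro exI[of _ "min d r"]) auto
      then show "\<forall>\<^sub>F s in at 0. \<forall>\<zeta>\<in>cball 0 r. dist (q s \<zeta>) (theta W k f (z + axis j \<zeta>)) < e"
      proof (rule eventually_mono, intro ballI)
        fix s \<zeta> :: complex assume s: "s \<noteq> 0 \<and> norm s < min d r" and \<zeta>: "\<zeta> \<in> cball 0 r"
        define y where "y = z + axis j \<zeta>"
        define c where "c = theta W k f y"
        have y: "y + axis k t \<in> cball z (3 * r)" "y \<in> cball z (3 * r)" if "norm t \<le> norm s" for t :: complex
          using in_cball[of t \<zeta>] that s \<zeta> by (auto simp: y_def add_ac)
        \<comment> \<open>Without its linear part the function has derivative at most e / 2, so the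
          mean value bound is uniform in \<open>\<zeta>\<close>.\<close>
        define F where "F t = f (y + axis k t) - c * t" for t
        have "norm (F s - F 0) \<le> e / 2 * norm (s - 0)"
        proof (rule field_differentiable_bound[of "cball 0 (norm s)" F "\<lambda>t. theta W k f (y + axis k t) - c"])
          fix t :: complex assume t: "t \<in> cball 0 (norm s)"
          then have "y + axis k t \<in> W" using y[of t] r(2) by auto
          then have "(F has_field_derivative theta W k f (y + axis k t) - c) (at t)"
            unfolding F_def
            by (intro DERIV_diff theta_has_field_derivative[OF f] DERIV_cmult_Id) auto
          then show "(F has_field_derivative theta W k f (y + axis k t) - c) (at t within cball 0 (norm s))"
            by (rule has_field_derivative_at_within)
          have "dist (theta W k f (y + axis k t)) (theta W k f y) < e / 2"
            using y[of t] t s by (intro d(2)) (auto simp: dist_norm)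
          then show "norm (theta W k f (y + axis k t) - c) \<le> e / 2" by (simp add: c_def dist_norm)
        qed auto
        then have "norm (f (y + axis k s) - f y - c * s) \<le> e / 2 * norm s"
          by (simp add: F_def algebra_simps)
        moreover have "q s \<zeta> - c = (f (y + axis k s) - f y - c * s) / s"
          using s by (simp add: q_def y_def add_ac diff_divide_distrib)
        ultimately have "norm (q s \<zeta> - c) \<le> e / 2"
          using s by (simp add: norm_divide divide_le_eq)
        then show "dist (q s \<zeta>) (theta W k f (z + axis j \<zeta>)) < e"
          using e by (simp add: dist_norm c_def y_def)
      qed
    qed
  qed (use r in auto)
  have g0: "((\<lambda>\<zeta>. theta W k f (z + axis j \<zeta>)) has_field_derivative g' 0) (at 0)"
    and lim: "((\<lambda>s. q' s 0) \<longlongrightarrow> g' 0) (at 0)"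
    using g'[of 0] r(1) by auto
  have "theta W j (theta W k f) z = g' 0" using thetaI[OF g0 z] .
  moreover have "((\<lambda>s. theta W j f (z + axis k s)) has_field_derivative g' 0) (at 0)"
    unfolding DERIV_def using lim by (simp add: q'_def)
  ultimately show ?thesis by simp
qed

lemma sep_holomorphic_theta:
  assumes "sep_holomorphic W f"
  shows "sep_holomorphic W (theta W j f)"
proof -
  have "theta W j f z = 0" if "z \<notin> W" for z using that by (simp add: theta_def)
  then show ?thesis
    unfolding sep_holomorphic_def field_differentiable_def
    using theta_continuous[OF assms] theta_theta[OF assms] by blast
qed

lemma theta_commute:
  assumes "sep_holomorphic W f"
  shows "theta W k (theta W j f) = theta W j (theta W k f)"
proof
  fix z show "theta W k (theta W j f) z = theta W j (theta W k f) z"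
  proof (cases "z \<in> W")
    case True
    show ?thesis by (rule thetaI[OF theta_theta[OF assms True] True])
  qed (simp add: theta_def)
qed

lemma sep_holomorphic_diff_cmult:
  assumes "sep_holomorphic W f" "sep_holomorphic W g"
  shows "sep_holomorphic W (\<lambda>z. f z - c * g z)"
  using assms unfolding sep_holomorphic_def
  by (auto intro!: continuous_intros field_differentiable_diff field_differentiable_mult field_differentiable_const)

lemma theta_diff_cmult:
  assumes "sep_holomorphic W f" "sep_holomorphic W g"
  shows "theta W j (\<lambda>z. f z - c * g z) = (\<lambda>z. theta W j f z - c * theta W j g z)"
proof
  fix z show "theta W j (\<lambda>z. f z - c * g z) z = theta W j f z - c * theta W j g z"
  proof (cases "z \<in> W")
    case True
    show ?thesis
      by (intro thetaI[OF _ True] DERIV_diff DERIV_cmult theta_has_field_derivative_0 assms True)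
  qed (simp add: theta_def)
qed

lemma theta_sum:
  assumes "\<And>x. x \<in> X \<Longrightarrow> sep_holomorphic W (f x)"
  shows "theta W j (\<lambda>z. \<Sum>x\<in>X. c x * f x z) = (\<lambda>z. \<Sum>x\<in>X. c x * theta W j (f x) z)"
proof
  fix z show "theta W j (\<lambda>z. \<Sum>x\<in>X. c x * f x z) z = (\<Sum>x\<in>X. c x * theta W j (f x) z)"
  proof (cases "z \<in> W")
    case True
    show ?thesis
      by (intro thetaI[OF _ True] DERIV_sum DERIV_cmult theta_has_field_derivative_0 assms True)
  qed (simp add: theta_def)
qed

text \<open>The pair (j, c) stands for the factor \<theta>_j - c. Lists allow single factors to be
  moved or removed by comparing multisets.\<close>

primrec theta_prod :: "('n \<times> complex) list \<Rightarrow> (complex^'n \<Rightarrow> complex) \<Rightarrow> complex^'n \<Rightarrow> complex" where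
  "theta_prod [] f = f"
| "theta_prod (x # xs) f =
     (\<lambda>z. theta W (fst x) (theta_prod xs f) z - snd x * theta_prod xs f z)"

lemma theta_prod_append: "theta_prod (xs @ ys) f = theta_prod xs (theta_prod ys f)"
  by (induction xs) auto

lemma sep_holomorphic_theta_prod:
  "sep_holomorphic W f \<Longrightarrow> sep_holomorphic W (theta_prod xs f)"
  by (induction xs) (auto intro!: sep_holomorphic_diff_cmult sep_holomorphic_theta)

lemma theta_prod_swap:
  assumes f: "sep_holomorphic W f"
  shows "theta_prod [x, y] f = theta_prod [y, x] f"
proof -
  have "theta W j (\<lambda>z. theta W k f z - c * f z) =
      (\<lambda>z. theta W j (theta W k f) z - c * theta W j f z)" for j k c
    by (intro theta_diff_cmult sep_holomorphic_theta f)
  then show ?thesis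
    by (simp add: theta_commute[OF f, of "fst x" "fst y"] algebra_simps)
qed

lemma theta_prod_move:
  assumes f: "sep_holomorphic W f" and "x \<in> set xs"
  shows "theta_prod xs f = theta_prod (x # remove1 x xs) f"
  using assms(2)
proof (induction xs)
  case (Cons y xs)
  show ?case
  proof (cases "x = y")
    case False
    with Cons have "theta_prod (y # xs) f = theta_prod (y # x # remove1 x xs) f" by simp
    also have "\<dots> = theta_prod [y, x] (theta_prod (remove1 x xs) f)"
      by simp
    also have "\<dots> = theta_prod [x, y] (theta_prod (remove1 x xs) f)"
      by (rule theta_prod_swap) (intro sep_holomorphic_theta_prod f)
    finally show ?thesis using False by simp
  qed simp
qed simp

lemma theta_prod_mset:
  assumes f: "sep_holomorphic W f"
  shows "mset xs = mset ys \<Longrightarrow> theta_prod xs f = theta_prod ys f"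
proof (induction xs arbitrary: ys)
  case (Cons x xs)
  have x: "x \<in> set ys" using mset_eq_setD[OF Cons.prems] by auto
  have "mset xs = mset (remove1 x ys)" using Cons.prems by (metis mset_remove1 remove1.simps(2))
  then have "theta_prod xs f = theta_prod (remove1 x ys) f" by (rule Cons.IH)
  then have "theta_prod (x # xs) f = theta_prod (x # remove1 x ys) f" by simp
  also have "\<dots> = theta_prod ys f" using theta_prod_move[OF f x] by simp
  finally show ?case .
qed simp

lemma theta_prod_sum:
  assumes "\<And>x. x \<in> X \<Longrightarrow> sep_holomorphic W (f x)"
  shows "theta_prod xs (\<lambda>z. \<Sum>x\<in>X. c x * f x z) = (\<lambda>z. \<Sum>x\<in>X. c x * theta_prod xs (f x) z)"
proof (induction xs)
  case (Cons y xs)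
  show ?case
    by (simp add: Cons theta_sum[OF sep_holomorphic_theta_prod[OF assms]] sum_distrib_left
        right_diff_distrib sum_subtractf mult.left_commute)
qed simp

end

section \<open>Monomials x^a in logarithmic coordinates and falling factorials\<close>

definition expo :: "complex^'n::finite \<Rightarrow> complex^'n \<Rightarrow> complex" where
  "expo a z = exp (\<Sum>j\<in>UNIV. a $ j * z $ j)"

lemma expo_add: "expo (a + b) z = expo a z * expo b z"
  by (simp add: expo_def distrib_right sum.distrib exp_add)

lemma expo_nonzero [simp]: "expo a z \<noteq> 0"
  by (simp add: expo_def)

lemma expo_zero [simp]: "expo 0 z = 1"
  by (simp add: expo_def)

lemma expo_axis: "expo (axis j c) z = exp (c * z $ j)"
  by (simp add: expo_def axis_def if_distrib[of "\<lambda>t. t * _"] cong: if_cong)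

lemma expo_shift: "expo a (z + axis j t) = expo a z * exp (a $ j * t)"
proof -
  have "(\<Sum>k\<in>UNIV. a $ k * (z + axis j t) $ k) = (\<Sum>k\<in>UNIV. a $ k * z $ k) + a $ j * t"
    by (simp add: distrib_left sum.distrib axis_def if_distrib[of "\<lambda>t. _ * t"] cong: if_cong)
  then show ?thesis by (simp add: expo_def exp_add)
qed

text \<open>The factors of x_j^n \<partial>_j^n = \<theta>_j (\<theta>_j - 1) ... (\<theta>_j - n +
  1), reversed so that one more derivative prepends one factor.\<close>

definition falling :: "'n \<Rightarrow> nat \<Rightarrow> ('n \<times> complex) list" where
  "falling j n = map (\<lambda>m. (j, of_nat m)) (rev [0..<n])"

definition falling_list :: "nat^'n \<Rightarrow> 'n list \<Rightarrow> ('n \<times> complex) list" where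
  "falling_list a xs = concat (map (\<lambda>j. falling j (a $ j)) xs)"

lemma set_falling_list: "set (falling_list a xs) = {(j, of_nat m) |j m. j \<in> set xs \<and> m < a $ j}"
  by (auto simp: falling_list_def falling_def)

lemma distinct_falling_list: "distinct xs \<Longrightarrow> distinct (falling_list a xs)"
proof (induction xs)
  case (Cons x xs)
  have "inj_on (\<lambda>m. (x, complex_of_nat m)) Y" for Y by (auto simp: inj_on_def)
  then have "distinct (falling x (a $ x))" by (simp add: falling_def distinct_map)
  moreover have "set (falling x (a $ x)) \<inter> set (falling_list a xs) = {}"
    using Cons.prems by (auto simp: falling_def set_falling_list)
  ultimately show ?case using Cons by (simp add: falling_list_def)
qed (simp add: falling_list_def)

context open_domain
begin

lemma expo_line_derivative:
  "((\<lambda>t. expo b (z + axis j t)) has_field_derivative b $ j * expo b z) (at 0)"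
  unfolding expo_shift by (auto intro!: derivative_eq_intros)

lemma theta_expo_mult:
  assumes f: "sep_holomorphic W f"
  shows "theta W j (\<lambda>z. expo b z * f z) = (\<lambda>z. expo b z * (theta W j f z + b $ j * f z))"
proof
  fix z show "theta W j (\<lambda>z. expo b z * f z) z = expo b z * (theta W j f z + b $ j * f z)"
  proof (cases "z \<in> W")
    case True
    have "((\<lambda>t. expo b (z + axis j t) * f (z + axis j t)) has_field_derivative
        b $ j * expo b z * f (z + axis j 0) + theta W j f z * expo b (z + axis j 0)) (at 0)"
      by (intro DERIV_mult expo_line_derivative theta_has_field_derivative_0 f True)
    from thetaI[OF this True] show ?thesis by (simp add: algebra_simps)
  qed (use f in \<open>simp add: theta_def sep_holomorphic_def\<close>)
qed

text \<open>The prefactor is the monomial already produced by the other variables;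
  \<open>b $ j = 0\<close> makes it constant for \<partial>_j.\<close>

lemma dx_power:
  assumes f: "sep_holomorphic W f" and b: "b $ j = 0"
  shows "(dx W j ^^ n) (\<lambda>z. expo b z * f z) =
    (\<lambda>z. expo (b - axis j (of_nat n)) z * theta_prod (falling j n) f z)"
proof (induction n)
  case (Suc n)
  have "(dx W j ^^ Suc n) (\<lambda>z. expo b z * f z) =
      dx W j (\<lambda>z. expo (b - axis j (of_nat n)) z * theta_prod (falling j n) f z)"
    by (simp add: Suc)
  also have "\<dots> = (\<lambda>z. exp (- (z $ j)) * (expo (b - axis j (of_nat n)) z *
      (theta W j (theta_prod (falling j n) f) z - of_nat n * theta_prod (falling j n) f z)))"
    unfolding dx_eq_theta theta_expo_mult[OF sep_holomorphic_theta_prod[OF f]] by (simp add: b)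
  also have "\<dots> = (\<lambda>z. expo (b - axis j (of_nat (Suc n))) z * theta_prod (falling j (Suc n)) f z)"
  proof
    fix z
    have "b - axis j (of_nat (Suc n)) = axis j (- 1) + (b - axis j (of_nat n))"
      by (simp add: axis_def vec_eq_iff)
    then have "expo (b - axis j (of_nat (Suc n))) z = exp (- (z $ j)) * expo (b - axis j (of_nat n)) z"
      by (simp only: expo_add expo_axis) simp
    then show "exp (- (z $ j)) * (expo (b - axis j (of_nat n)) z *
        (theta W j (theta_prod (falling j n) f) z - of_nat n * theta_prod (falling j n) f z)) =
        expo (b - axis j (of_nat (Suc n))) z * theta_prod (falling j (Suc n)) f z"
      by (simp add: falling_def)
  qed
  finally show ?case .
qed (simp add: falling_def)

lemma foldr_dx:
  assumes f: "sep_holomorphic W f" and "distinct xs"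
  shows "foldr (\<lambda>j P. (dx W j ^^ (a $ j)) \<circ> P) xs id f =
    (\<lambda>z. expo (\<chi> j. if j \<in> set xs then - of_nat (a $ j) else 0) z * theta_prod (falling_list a xs) f z)"
  using assms(2)
proof (induction xs)
  case Nil
  have "(\<chi> j. 0) = (0 :: complex^'n)" by (simp add: vec_eq_iff)
  then show ?case by (simp add: falling_list_def)
next
  case (Cons x xs)
  let ?b = "\<lambda>xs. (\<chi> j. if j \<in> set xs then - of_nat (a $ j) else 0) :: complex^'n"
  have "foldr (\<lambda>j P. (dx W j ^^ (a $ j)) \<circ> P) (x # xs) id f =
      (dx W x ^^ (a $ x)) (\<lambda>z. expo (?b xs) z * theta_prod (falling_list a xs) f z)"
    using Cons.prems by (simp add: Cons.IH)
  also have "\<dots> = (\<lambda>z. expo (?b xs - axis x (of_nat (a $ x))) z *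
      theta_prod (falling x (a $ x)) (theta_prod (falling_list a xs) f) z)"
    using Cons.prems by (intro dx_power sep_holomorphic_theta_prod f) auto
  also have "?b xs - axis x (of_nat (a $ x)) = ?b (x # xs)"
    using Cons.prems by (auto simp: vec_eq_iff axis_def)
  finally show ?case by (simp add: falling_list_def theta_prod_append)
qed

end

section \<open>Series of exponentials\<close>

lemma summable_on_sum:
  fixes f :: "'s \<Rightarrow> 'i \<Rightarrow> 'a::topological_comm_monoid_add"
  assumes "\<And>s. s \<in> P \<Longrightarrow> f s summable_on X"
  shows "(\<lambda>i. \<Sum>s\<in>P. f s i) summable_on X"
  using assms by (induction P rule: infinite_finite_induct) (auto intro!: summable_on_add)

text \<open>The series may be differentiated termwise because \<open>\<bar>\<lambda>\<bar>\<^sup>2 e\<^bsup>\<bar>\<lambda>\<bar> \<delta> / 4\<^esup>\<close> is bounded by a multiple of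
  \<open>\<Sum>\<^sub>s \<bar>e\<^bsup>\<lambda> s\<^esup>\<bar>\<close> over the four points \<open>s = \<plusminus> \<delta>, \<plusminus> i \<delta>\<close>.\<close>

lemma exp_series_derivative:
  fixes c l :: "'i \<Rightarrow> complex" and F :: "complex \<Rightarrow> complex"
  assumes \<delta>: "\<delta> > 0" and F: "\<And>t. norm t \<le> \<delta> \<Longrightarrow> ((\<lambda>i. c i * exp (l i * t)) has_sum F t) UNIV"
  obtains D where "((\<lambda>i. c i * l i) has_sum D) UNIV" "(F has_field_derivative D) (at 0)"
proof -
  define P where "P = {of_real \<delta>, - of_real \<delta>, \<i> * of_real \<delta>, - (\<i> * of_real \<delta>)}"
  define b where "b i = (\<Sum>s\<in>P. norm (c i * exp (l i * s)))" for i
  have norm_P: "norm s \<le> \<delta>" if "s \<in> P" for s using that \<delta> by (auto simp: P_def norm_mult)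
  have b_sum: "b summable_on UNIV"
    unfolding b_def
  proof (rule summable_on_sum)
    fix s assume "s \<in> P"
    then have "(\<lambda>i. c i * exp (l i * s)) summable_on UNIV"
      using F norm_P by (auto simp: summable_on_def)
    then show "(\<lambda>i. norm (c i * exp (l i * s))) summable_on UNIV"
      by (simp add: summable_on_iff_abs_summable_on_complex)
  qed
  have b_nonneg: "0 \<le> b i" for i unfolding b_def by (intro sum_nonneg) auto
  have dom: "norm (c i) * exp (norm (l i) * \<delta> / 2) \<le> b i" for i
  proof -
    have "\<exists>s\<in>P. norm (l i) * \<delta> / 2 \<le> Re (l i * s)"
    proof -
      \<comment> \<open>One of the four directions has real part at least half the modulus, whence
        \<delta> / 2 in the exponent.\<close>
      have "norm (l i) \<le> \<bar>Re (l i)\<bar> + \<bar>Im (l i)\<bar>" by (rule cmod_le)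
      then consider "norm (l i) / 2 \<le> Re (l i)" | "norm (l i) / 2 \<le> - Re (l i)"
        | "norm (l i) / 2 \<le> Im (l i)" | "norm (l i) / 2 \<le> - Im (l i)" by linarith
      then have "\<exists>s\<in>{1, -1, \<i>, -\<i>}. norm (l i) / 2 \<le> Re (l i * s)" by cases auto
      then obtain s where s: "s \<in> {1, -1, \<i>, -\<i>}" "norm (l i) / 2 \<le> Re (l i * s)" by blast
      have "norm (l i) / 2 * \<delta> \<le> Re (l i * s) * \<delta>" using s(2) \<delta> by (intro mult_right_mono) auto
      also have "\<dots> = Re (l i * (s * of_real \<delta>))" by (simp add: algebra_simps)
      finally have "norm (l i) * \<delta> / 2 \<le> Re (l i * (s * of_real \<delta>))" by simp
      moreover have "s * of_real \<delta> \<in> P" using s(1) by (auto simp: P_def)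
      ultimately show ?thesis by blast
    qed
    then obtain s where s: "s \<in> P" "norm (l i) * \<delta> / 2 \<le> Re (l i * s)" by blast
    have "norm (c i) * exp (norm (l i) * \<delta> / 2) \<le> norm (c i) * exp (Re (l i * s))"
      using s(2) by (intro mult_left_mono) auto
    also have "\<dots> = norm (c i * exp (l i * s))" by (simp add: norm_mult)
    also have "\<dots> \<le> b i" unfolding b_def using s(1) by (intro member_le_sum) (auto simp: P_def)
    finally show ?thesis .
  qed
  have cl: "norm (c i * l i) \<le> 2 / \<delta> * b i" for i
  proof -
    have "norm (l i) * \<delta> / 2 \<le> exp (norm (l i) * \<delta> / 2)"
      using exp_ge_add_one_self[of "norm (l i) * \<delta> / 2"] by linarith
    then have "norm (l i) \<le> 2 / \<delta> * exp (norm (l i) * \<delta> / 2)"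
      using \<delta> by (simp add: field_simps)
    then have "norm (c i * l i) \<le> norm (c i) * (2 / \<delta> * exp (norm (l i) * \<delta> / 2))"
      unfolding norm_mult by (rule mult_left_mono) simp
    also have "\<dots> = 2 / \<delta> * (norm (c i) * exp (norm (l i) * \<delta> / 2))" by simp
    also have "\<dots> \<le> 2 / \<delta> * b i" using dom[of i] \<delta> by (intro mult_left_mono) auto
    finally show ?thesis .
  qed
  have "(\<lambda>i. c i * l i) summable_on UNIV"
    unfolding summable_on_iff_abs_summable_on_complex
  proof (rule summable_on_comparison_test)
    show "(\<lambda>i. 2 / \<delta> * b i) summable_on UNIV" using b_sum by (rule summable_on_cmult_right)
  qed (use cl in auto)
  then obtain D where D: "((\<lambda>i. c i * l i) has_sum D) UNIV" by (auto simp: summable_on_def)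
  \<comment> \<open>With x = |\<lambda>| \<delta>, the quadratic term (x/4)^2 / 2 of exp (x/4) gives
    x^2 \<le> 32 exp (x/4). The second factor exp (x/4) comes from |t| \<le> \<delta> / 4, and their
    product exp (x/2) is what \<open>dom\<close> controls.\<close>
  define K where "K = 32 / \<delta>\<^sup>2 * infsum b UNIV"
  have remainder: "norm (F t - F 0 - t * D) \<le> K * (norm t)\<^sup>2" if t: "norm t \<le> \<delta> / 4" for t
  proof -
    have F': "((\<lambda>i. c i * (exp (l i * t) - 1 - l i * t)) has_sum (F t - F 0 - t * D)) UNIV"
    proof -
      have "((\<lambda>i. c i * exp (l i * t)) has_sum F t) UNIV" "((\<lambda>i. c i) has_sum F 0) UNIV"
        using F[of t] F[of 0] t \<delta> by auto
      from has_sum_add[OF has_sum_add[OF this(1) has_sum_cmult_right[OF this(2), of "- 1"]]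
          has_sum_cmult_right[OF D, of "- t"]]
      show ?thesis by (simp add: algebra_simps)
    qed
    have bound: "norm (c i * (exp (l i * t) - 1 - l i * t)) \<le> (norm t)\<^sup>2 * (32 / \<delta>\<^sup>2) * b i" for i
    proof -
      define x where "x = norm (l i) * \<delta>"
      have x: "0 \<le> x" using \<delta> by (simp add: x_def)
      have "norm (exp (l i * t) - 1 - l i * t) \<le> exp \<bar>Re (l i * t)\<bar> * (norm (l i * t))\<^sup>2"
        using Taylor_exp[of "l i * t" 1] by (simp add: diff_diff_eq power2_eq_square)
      also have "\<dots> \<le> exp (x / 4) * (norm (l i * t))\<^sup>2"
      proof (intro mult_right_mono)
        have "\<bar>Re (l i * t)\<bar> \<le> norm (l i) * norm t" using abs_Re_le_cmod[of "l i * t"] by (simp add: norm_mult)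
        also have "\<dots> \<le> norm (l i) * (\<delta> / 4)" using t by (intro mult_left_mono) auto
        finally show "exp \<bar>Re (l i * t)\<bar> \<le> exp (x / 4)" by (simp add: x_def)
      qed auto
      also have "(norm (l i * t))\<^sup>2 = (norm t)\<^sup>2 * x\<^sup>2 / \<delta>\<^sup>2"
        using \<delta> by (simp add: x_def norm_mult power_mult_distrib field_simps)
      also have "exp (x / 4) * ((norm t)\<^sup>2 * x\<^sup>2 / \<delta>\<^sup>2) = ((norm t)\<^sup>2 / \<delta>\<^sup>2) * (x\<^sup>2 * exp (x / 4))" by simp
      also have "\<dots> \<le> ((norm t)\<^sup>2 / \<delta>\<^sup>2) * (32 * exp (x / 2))"
      proof (intro mult_left_mono)
        have "1 + x / 4 + (x / 4)\<^sup>2 / 2 \<le> exp (x / 4)" using x by (intro exp_lower_Taylor_quadratic) auto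
        then have "x\<^sup>2 \<le> 32 * exp (x / 4)" using x by (simp add: power2_eq_square)
        then have "x\<^sup>2 * exp (x / 4) \<le> 32 * exp (x / 4) * exp (x / 4)" by (intro mult_right_mono) auto
        also have "\<dots> = 32 * exp (x / 2)" by (simp flip: exp_add)
        finally show "x\<^sup>2 * exp (x / 4) \<le> 32 * exp (x / 2)" .
      qed auto
      finally have "norm (exp (l i * t) - 1 - l i * t) \<le> ((norm t)\<^sup>2 / \<delta>\<^sup>2) * (32 * exp (x / 2))" .
      then have "norm (c i * (exp (l i * t) - 1 - l i * t)) \<le>
          norm (c i) * (((norm t)\<^sup>2 / \<delta>\<^sup>2) * (32 * exp (x / 2)))"
        unfolding norm_mult by (rule mult_left_mono) simp
      also have "\<dots> = (norm t)\<^sup>2 * (32 / \<delta>\<^sup>2) * (norm (c i) * exp (norm (l i) * \<delta> / 2))"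
        by (simp add: x_def)
      also have "\<dots> \<le> (norm t)\<^sup>2 * (32 / \<delta>\<^sup>2) * b i" by (intro mult_left_mono dom) auto
      finally show ?thesis .
    qed
    have "norm (F t - F 0 - t * D) \<le> infsum (\<lambda>i. (norm t)\<^sup>2 * (32 / \<delta>\<^sup>2) * b i) UNIV"
    proof (rule norm_infsum_le[OF F'])
      show "((\<lambda>i. (norm t)\<^sup>2 * (32 / \<delta>\<^sup>2) * b i) has_sum infsum (\<lambda>i. (norm t)\<^sup>2 * (32 / \<delta>\<^sup>2) * b i) UNIV) UNIV"
        using b_sum by (intro has_sum_infsum summable_on_cmult_right)
    qed (rule bound)
    also have "\<dots> = K * (norm t)\<^sup>2" 
      unfolding K_def infsum_cmult_right' by simp
    finally show ?thesis .
  qed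
  have "((\<lambda>t. (F (0 + t) - F 0) / t - D) \<longlongrightarrow> 0) (at 0)"
  proof (rule Lim_null_comparison)
    show "((\<lambda>t. K * norm (t :: complex)) \<longlongrightarrow> 0) (at 0)"
      by (auto intro!: tendsto_eq_intros)
    have "eventually (\<lambda>t::complex. t \<noteq> 0 \<and> norm t \<le> \<delta> / 4) (at 0)"
      unfolding eventually_at using \<delta> by (intro exI[of _ "\<delta> / 4"]) auto
    then show "eventually (\<lambda>t. norm ((F (0 + t) - F 0) / t - D) \<le> K * norm t) (at 0)"
    proof (rule eventually_mono)
      fix t :: complex assume t: "t \<noteq> 0 \<and> norm t \<le> \<delta> / 4"
      have "(F (0 + t) - F 0) / t - D = (F t - F 0 - t * D) / t" using t by (simp add: field_simps)
      then have "norm ((F (0 + t) - F 0) / t - D) \<le> K * (norm t)\<^sup>2 / norm t"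
        using remainder[of t] t by (simp add: norm_divide divide_right_mono)
      also have "\<dots> = K * norm t" using t by (simp add: power2_eq_square)
      finally show "norm ((F (0 + t) - F 0) / t - D) \<le> K * norm t" .
    qed
  qed
  then have "(F has_field_derivative D) (at 0)" unfolding DERIV_def by (simp add: LIM_zero_iff)
  with D that show thesis by blast
qed

text \<open>Unordered sums over all complex exponent vectors let series with different exponent sets
  be added and shifted without reindexing.\<close>

definition exp_series ::
    "(complex^'n::finite) set \<Rightarrow> (complex^'n \<Rightarrow> complex) \<Rightarrow> (complex^'n \<Rightarrow> complex) \<Rightarrow> bool" where
  "exp_series W C F \<longleftrightarrow> (\<forall>z\<in>W. ((\<lambda>a. C a * expo a z) has_sum F z) UNIV)"

lemma exp_series_cmult:
  "exp_series W C F \<Longrightarrow> exp_series W (\<lambda>a. c * C a) (\<lambda>z. c * F z)"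
  unfolding exp_series_def by (simp add: has_sum_cmult_right mult.assoc)

lemma exp_series_add:
  "exp_series W C F \<Longrightarrow> exp_series W C' F' \<Longrightarrow> exp_series W (\<lambda>a. C a + C' a) (\<lambda>z. F z + F' z)"
  unfolding exp_series_def by (simp add: has_sum_add distrib_right)

lemma exp_series_sum:
  assumes "\<And>x. x \<in> X \<Longrightarrow> exp_series W (C x) (F x)"
  shows "exp_series W (\<lambda>a. \<Sum>x\<in>X. C x a) (\<lambda>z. \<Sum>x\<in>X. F x z)"
  using assms
proof (induction X rule: infinite_finite_induct)
  case (insert x X)
  then show ?case by (auto intro!: exp_series_add)
qed (auto simp: exp_series_def)

lemma exp_series_expo:
  assumes "exp_series W C F"
  shows "exp_series W (\<lambda>a. C (a - b)) (\<lambda>z. expo b z * F z)"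
  unfolding exp_series_def
proof
  fix z assume "z \<in> W"
  then have "((\<lambda>a. C a * expo a z) has_sum F z) UNIV" using assms by (simp add: exp_series_def)
  then have "((\<lambda>a. expo b z * (C a * expo a z)) has_sum (expo b z * F z)) UNIV"
    by (rule has_sum_cmult_right)
  moreover have "bij (\<lambda>a :: complex^'a. a - b)"
    by (rule bij_betw_byWitness[where f' = "\<lambda>a. a + b"]) auto
  ultimately have "((\<lambda>a. expo b z * (C (a - b) * expo (a - b) z)) has_sum (expo b z * F z)) UNIV"
    by (subst has_sum_reindex_bij_betw[of "\<lambda>a. a - b" UNIV UNIV "\<lambda>a. expo b z * (C a * expo a z)"])
  moreover have "expo b z * (C (a - b) * expo (a - b) z) = C (a - b) * expo a z" for a
    using expo_add[of b "a - b" z] by simp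
  ultimately show "((\<lambda>a. C (a - b) * expo a z) has_sum (expo b z * F z)) UNIV" by simp
qed

text \<open>If the exponents of \<open>x\<^sub>i\<close> are nonpositive integers, the series is a power series in \<open>x\<^sub>i\<^sup>-\<^sup>1\<close>.\<close>

lemma exp_series_degree_zero:
  fixes W :: "(complex^'n::finite) set"
  assumes "open W" "z \<in> W" and series: "exp_series W C (\<lambda>_. 0)"
    and supp: "\<And>a. C a \<noteq> 0 \<Longrightarrow> \<exists>n::nat. a $ i = - of_nat n"
  shows "((\<lambda>a. C a * expo a z) has_sum 0) {a. a $ i = 0}"
proof -
  obtain \<delta> where \<delta>: "\<delta> > 0" "cball z \<delta> \<subseteq> W"
    using open_contains_cball_eq[OF assms(1)] assms(2) by blast
  have inW: "z + axis i t \<in> W" if "norm t \<le> \<delta>" for t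
    using \<delta>(2) that by (auto simp: dist_norm)
  define B where "B n = {a :: complex^'n. a $ i = - of_nat n}" for n :: nat
  define g where "g a = C a * expo a z" for a
  have "g summable_on UNIV" using series assms(2) unfolding exp_series_def g_def summable_on_def by blast
  then have g_sum: "g summable_on X" for X using summable_on_subset_banach by blast
  define D where "D n = infsum g (B n)" for n
  have D: "(g has_sum D n) (B n)" for n
    unfolding D_def by (rule has_sum_infsum[OF g_sum])
  \<comment> \<open>Shifting z_i by \<open>t\<close> multiplies the part of degree -n by w^n, so the
    grouped sums form a power series in w.\<close>
  have series_D: "((\<lambda>n. D n * w ^ n) has_sum 0) UNIV" if w: "w = exp (- t)" "norm t \<le> \<delta>" for w t
  proof -
    have "((\<lambda>a. C a * expo a (z + axis i t)) has_sum 0) UNIV"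
      using series inW[OF w(2)] by (simp add: exp_series_def)
    then have "((\<lambda>a. g a * exp (a $ i * t)) has_sum 0) UNIV"
      by (simp add: expo_shift g_def mult.assoc)
    then have "((\<lambda>a. g a * exp (a $ i * t)) has_sum 0) (\<Union>n. B n)"
      by (subst (asm) has_sum_cong_neutral[where T = "\<Union>n. B n" and g = "\<lambda>a. g a * exp (a $ i * t)"])
        (use supp in \<open>auto simp: g_def B_def\<close>)
    moreover have "bij_betw snd (Sigma UNIV B) (\<Union>n. B n)"
      unfolding bij_betw_def inj_on_def by (force simp: B_def)
    ultimately have "((\<lambda>x. g (snd x) * exp (snd x $ i * t)) has_sum 0) (Sigma UNIV B)"
      by (subst has_sum_reindex_bij_betw[where f = "\<lambda>a. g a * exp (a $ i * t)"])
    then show ?thesis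
    proof (rule has_sum_SigmaD)
      fix n
      have "((\<lambda>a. g a * w ^ n) has_sum (D n * w ^ n)) (B n)"
        by (rule has_sum_cmult_left[OF D])
      then show "((\<lambda>y. g (snd (n, y)) * exp (snd (n, y) $ i * t)) has_sum (D n * w ^ n)) (B n)"
      proof (rule has_sum_cong[THEN iffD1, rotated])
        fix a assume "a \<in> B n"
        then show "g a * w ^ n = g (snd (n, a)) * exp (snd (n, a) $ i * t)"
          by (simp add: B_def w(1) flip: exp_of_nat_mult)
      qed
    qed
  qed
  define R where "R = exp \<delta>"
  have R: "R > 1" using \<delta> by (simp add: R_def)
  have "summable (\<lambda>n. D n * (of_real R) ^ n)"
    using series_D[of "of_real R" "- of_real \<delta>"] \<delta>(1)
    by (auto simp: R_def exp_of_real intro!: sums_summable has_sum_imp_sums)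
  then have sums: "(\<lambda>n. D n * (w - 0) ^ n) sums suminf (\<lambda>n. D n * w ^ n)" if "w \<in> ball 0 R" for w
    using powser_inside[of D "of_real R" w] that R by (auto intro!: summable_sums)
  then have hol: "(\<lambda>w. suminf (\<lambda>n. D n * w ^ n)) holomorphic_on ball 0 R"
    by (rule power_series_holomorphic)
  \<comment> \<open>The value at w = 0, that is, x_i at infinity, is not covered by
    \<open>series_D\<close>; it is reached by continuation from a real segment ending at 1, inside a
    disc of radius greater than 1.\<close>
  define U where "U = complex_of_real ` {exp (- \<delta>)<..<1}"
  have "suminf (\<lambda>n. D n * 0 ^ n) = 0"
  proof (rule analytic_continuation[OF hol, of U 1 0])
    show "U \<subseteq> ball 0 R"
    proof
      fix w assume "w \<in> U"
      then obtain x where "w = of_real x" "exp (- \<delta>) < x" "x < 1" by (auto simp: U_def)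
      then show "w \<in> ball 0 R" using R less_trans[OF exp_gt_zero, of "- \<delta>" x] by simp
    qed
    show "1 islimpt U"
      unfolding islimpt_approachable
    proof (intro allI impI)
      fix e :: real assume "e > 0"
      define x where "x = max (1 - e / 2) ((1 + exp (- \<delta>)) / 2)"
      have "exp (- \<delta>) < x" "x < 1" "1 - x < e" "exp (- \<delta>) < 1"
        using \<open>e > 0\<close> \<delta>(1) by (auto simp: x_def max_def field_simps)
      then have x: "exp (- \<delta>) < x" "x < 1" "1 - x < e" by blast+
      have "of_real x \<in> U" "complex_of_real x \<noteq> 1" using x by (auto simp: U_def)
      moreover have "dist (complex_of_real x) (of_real 1) < e"
        unfolding dist_of_real using x by (simp add: dist_real_def)
      ultimately show "\<exists>x'\<in>U. x' \<noteq> 1 \<and> dist x' 1 < e" by (auto intro!: bexI[of _ "of_real x"])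
    qed
    show "suminf (\<lambda>n. D n * w ^ n) = 0" if wU: "w \<in> U" for w
    proof -
      obtain x where x: "w = of_real x" "exp (- \<delta>) < x" "x < 1" using wU by (auto simp: U_def)
      have "0 < x" using x(2) less_trans[OF exp_gt_zero] by blast
      moreover have "- \<delta> < ln x" using x(2) \<open>0 < x\<close> by (metis exp_less_cancel_iff exp_ln)
      moreover have "ln x < 0" using x(3) \<open>0 < x\<close> by simp
      ultimately have "((\<lambda>n. D n * w ^ n) has_sum 0) UNIV"
        by (intro series_D[of w "- of_real (ln x)"]) (auto simp: x(1) exp_of_real)
      then show ?thesis by (intro sums_unique[symmetric] has_sum_imp_sums)
    qed
  qed (use R in auto)
  then have "D 0 = 0" by simp
  then show ?thesis using D[of 0] by (simp add: B_def g_def[abs_def])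
qed

context open_domain
begin

lemma exp_series_theta:
  assumes F: "exp_series W C F"
  shows "exp_series W (\<lambda>a. C a * a $ j) (theta W j F)"
  unfolding exp_series_def
proof
  fix z assume z: "z \<in> W"
  obtain r where r: "r > 0" "cball z (3 * r) \<subseteq> W" using radius[OF z] .
  have "((\<lambda>a. (C a * expo a z) * exp (a $ j * t)) has_sum F (z + axis j t)) UNIV" if "norm t \<le> r" for t
  proof -
    have "z + axis j t \<in> W" using r that by (auto simp: dist_norm)
    then have "((\<lambda>a. C a * expo a (z + axis j t)) has_sum F (z + axis j t)) UNIV"
      using F by (simp add: exp_series_def)
    then show ?thesis by (simp add: expo_shift mult.assoc)
  qed
  then obtain D where D: "((\<lambda>a. C a * expo a z * a $ j) has_sum D) UNIV"
      "((\<lambda>t. F (z + axis j t)) has_field_derivative D) (at 0)"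
    by (rule exp_series_derivative[OF r(1)])
  from thetaI[OF D(2) z] D(1) show "((\<lambda>a. C a * a $ j * expo a z) has_sum theta W j F z) UNIV"
    by (simp add: mult_ac)
qed

lemma exp_series_theta_prod:
  assumes F: "exp_series W C F"
  shows "exp_series W (\<lambda>a. C a * (\<Prod>x\<leftarrow>xs. a $ fst x - snd x)) (theta_prod xs F)"
proof (induction xs)
  case (Cons x xs)
  from exp_series_add[OF exp_series_theta[OF Cons, of "fst x"] exp_series_cmult[OF Cons, of "- snd x"]]
  show ?case by (simp add: algebra_simps)
qed (simp add: F)

end

lemma dmon_op_eq_theta_prod:
  fixes W :: "(complex^'n::{finite,linorder}) set"
  assumes "open W" "sep_holomorphic W f"
  shows "dmon_op W a f = (\<lambda>z. expo (- of_nat_vec a) z *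
    open_domain.theta_prod W (falling_list a (sorted_list_of_set UNIV)) f z)"
proof -
  interpret open_domain W using assms(1) by unfold_locales
  have "(\<chi> j. if j \<in> set (sorted_list_of_set (UNIV :: 'n set)) then - of_nat (a $ j) else 0) =
      (- of_nat_vec a :: (complex, 'n) vec)"
    by (simp add: vec_eq_iff of_nat_vec_def)
  then show ?thesis unfolding dmon_op_def by (subst foldr_dx[OF assms(2)]) auto
qed

section \<open>The canonical series and the vanishing of coefficients\<close>

text \<open>Indexed by the exponent v + k instead of k, so that the series of different
  \<open>v\<close> become comparable.\<close>

definition phi_series_coeff :: "int^'n::finite^'d \<Rightarrow> complex^'n \<Rightarrow> complex^'n \<Rightarrow> complex" where
  "phi_series_coeff A v a =
     (let X = {k. - k \<in> N_set A v}; h = (\<lambda>k. v + of_int_vec k)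
      in if a \<in> h ` X then phi_coeff v (inv_into X h a) else 0)"

lemma inj_add_of_int_vec: "inj_on (\<lambda>k. (v :: complex^'n) + of_int_vec k) X"
  by (auto simp: inj_on_def of_int_vec_def vec_eq_iff)

lemma exp_series_phi:
  assumes "phi_converges_on W A v"
  shows "exp_series W (phi_series_coeff A v) (phi W A v)"
  unfolding exp_series_def
proof
  fix z assume z: "z \<in> W"
  let ?X = "{k. - k \<in> N_set A v}" and ?h = "\<lambda>k. v + of_int_vec k"
  let ?g = "\<lambda>a. phi_series_coeff A v a * expo a z"
  have "(phi_term v z has_sum phi W A v z) ?X"
    using assms z unfolding phi_converges_on_def phi_def by (simp add: has_sum_infsum)
  then have "((?g \<circ> ?h) has_sum phi W A v z) ?X"
  proof (rule has_sum_cong[THEN iffD1, rotated])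
    fix k assume "k \<in> ?X"
    then show "phi_term v z k = (?g \<circ> ?h) k"
      using inv_into_f_f[OF inj_add_of_int_vec, of k ?X v]
      by (simp add: phi_series_coeff_def phi_term_def expo_def of_int_vec_def)
  qed
  then have "(?g has_sum phi W A v z) (?h ` ?X)" by (simp add: has_sum_reindex[OF inj_add_of_int_vec])
  then show "(?g has_sum phi W A v z) UNIV"
    by (rule has_sum_cong_neutral[THEN iffD1, rotated -1]) (auto simp: phi_series_coeff_def)
qed

lemma phi_series_coeff_nonzeroE:
  assumes "phi_series_coeff A v a \<noteq> 0"
  obtains k where "k \<in> kerZ A" "nsupp (v + of_int_vec k) = nsupp v" "a = v + of_int_vec k"
proof -
  obtain k where k: "- k \<in> N_set A v" "a = v + of_int_vec k"
    using assms unfolding phi_series_coeff_def Let_def by (auto split: if_splits)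
  have "k \<in> kerZ A" using k(1) kerZ_uminus[of "- k" A] by (simp add: N_set_def)
  moreover have "v - of_int_vec (- k) = v + of_int_vec k" by (simp add: of_int_vec_def vec_eq_iff)
  then have "nsupp (v + of_int_vec k) = nsupp v" using k(1) unfolding N_set_def by (metis (lifting) mem_Collect_eq)
  ultimately show thesis using that k(2) by blast
qed

lemma phi_series_coeff_self: "phi_series_coeff A v v = 1"
proof -
  let ?X = "{k. - k \<in> N_set A v}" and ?h = "\<lambda>k. v + of_int_vec k"
  have "of_int_vec 0 = (0 :: complex^'a)" by (simp add: of_int_vec_def vec_eq_iff)
  then have *: "0 \<in> ?X" "?h 0 = v" by (simp_all add: N_set_def kerZ_def)
  then have "inv_into ?X ?h v = 0" using inv_into_f_f[OF inj_add_of_int_vec *(1)] by metis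
  moreover have "v \<in> ?h ` ?X" using * by force
  ultimately show ?thesis by (simp add: phi_series_coeff_def phi_coeff_def)
qed

lemma Sol_dmon_op_eq:
  fixes A :: "int^'n::{finite,linorder}^'d"
  assumes f: "f \<in> Sol W A \<gamma>" and pq: "A *v of_nat_vec p = A *v of_nat_vec q"
  shows "dmon_op W p f = dmon_op W q f"
proof (cases "p = q")
  case False
  have "dpoly_op W (dmon p - dmon q) \<in> H_A W A \<gamma>"
    unfolding H_A_def using pq by (intro weyl_left_ideal.gen) (auto simp: dmon_diff_mem_toric_ideal_iff)
  then have "dpoly_op W (dmon p - dmon q) f = 0" using f by (auto simp: Sol_def)
  then have "dpoly_op W (dmon p - dmon q) f z = 0" for z by simp
  then have "dmon_op W p f z - dmon_op W q f z = 0" for z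
    using False by (simp add: dpoly_op_def keys_dmon_diff lookup_minus)
      (simp add: dmon_def lookup_single_not_eq)
  then show ?thesis by (intro ext) simp
qed simp

lemma Sol_euler:
  fixes A :: "int^'n::{finite,linorder}^'d"
  assumes f: "f \<in> Sol W A \<gamma>"
  shows "(\<Sum>j\<in>UNIV. of_int (A $ x $ j) * theta W j f z) = \<gamma> $ x * f z"
proof -
  have "euler_op W A \<gamma> x \<in> H_A W A \<gamma>" unfolding H_A_def by (intro weyl_left_ideal.gen) auto
  then have "euler_op W A \<gamma> x f = 0" using f by (auto simp: Sol_def)
  then have "euler_op W A \<gamma> x f z = 0" by simp
  moreover have "exp (z $ j) * dx W j f z = theta W j f z" for j by (simp add: dx_eq_theta exp_minus)
  ultimately show ?thesis by (simp add: euler_op_def)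
qed

text \<open>\<open>S\<close> collects the exponents of one linear combination; a single
  \<open>u\<close> is treated at a time because the operator T depends on it.\<close>

lemma coefficient_vanishes:
  fixes A :: "int^'n::{finite,linorder}^'d::finite"
  assumes setting: "combinatorial_setting A i \<tau> \<eta>"
    and \<alpha>: "rat_independent \<tau> \<alpha>" "\<And>j. j \<notin> \<tau> \<Longrightarrow> \<alpha> $ j = 0"
    and \<gamma>: "\<gamma> = of_int_mat A *v (of_nat_vec \<eta> + \<alpha>)"
    and W: "open W" "W \<noteq> {}"
    and conv: "\<And>v. v \<in> minimal_fake_exponents (- axis i 1) A
      (of_int_mat A *v (of_nat_vec \<eta> + \<alpha> - axis i 1)) \<Longrightarrow> phi_converges_on W A v"
    and f: "f \<in> Sol W A \<gamma>"
    and S: "finite S" "\<And>v. v \<in> S \<Longrightarrow> v \<in> minimal_fake_exponents (- axis i 1) A \<gamma> \<and> v $ i = 0"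
    and dx: "\<And>z. z \<in> W \<Longrightarrow> dx W i f z = (\<Sum>v\<in>S. c v * phi W A (v - axis i 1) z)"
    and u: "u \<in> S"
  shows "c u = 0"
proof -
  interpret open_domain W using W(1) by unfold_locales
  interpret combinatorial_setting A i \<tau> \<eta> by (rule setting)
  have gs: "generic_setting A i \<tau> \<eta> \<alpha> v" if "v \<in> S" for v
    using S(2)[OF that] \<alpha> \<gamma>
    by (auto simp: generic_setting_def generic_setting_axioms_def setting minimal_fake_exponents_def)
  interpret u: generic_setting A i \<tau> \<eta> \<alpha> u by (rule gs[OF u])
  have hol: "sep_holomorphic W f"
    using f by (intro holomorphic_Cn_imp_sep_holomorphic) (auto simp: Sol_def)

  \<comment> \<open>Coefficients of x_1 \<partial>_1 f; the factor x_1 accounts for the shift of the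
    argument by e_1.\<close>
  define C where "C a = (\<Sum>v\<in>S. c v * phi_series_coeff A (v - axis i 1) (a - axis i 1))" for a
  have C: "exp_series W C (theta W i f)"
  proof -
    have "exp_series W C (\<lambda>z. \<Sum>v\<in>S. c v * (expo (axis i 1) z * phi W A (v - axis i 1) z))"
      unfolding C_def
    proof (intro exp_series_sum exp_series_cmult exp_series_expo exp_series_phi conv)
      fix v assume v: "v \<in> S"
      show "v - axis i 1 \<in> minimal_fake_exponents (- axis i 1) A
          (of_int_mat A *v (of_nat_vec \<eta> + \<alpha> - axis i 1))"
        using S(2)[OF v]
        by (intro generic_setting.shift_mem_minimal_fake_exponents[OF gs[OF v]])
          (simp add: minimal_fake_exponents_def)
    qed
    moreover have "(\<Sum>v\<in>S. c v * (expo (axis i 1) z * phi W A (v - axis i 1) z)) = theta W i f z"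
      if "z \<in> W" for z
    proof -
      have "(\<Sum>v\<in>S. c v * (expo (axis i 1) z * phi W A (v - axis i 1) z)) = exp (z $ i) * dx W i f z"
        using that by (simp add: dx sum_distrib_left expo_axis mult.left_commute)
      also have "\<dots> = theta W i f z" by (simp add: dx_eq_theta exp_minus)
      finally show ?thesis .
    qed
    ultimately show ?thesis by (simp add: exp_series_def)
  qed
  have C_support: "(\<exists>n::nat. a $ i = - of_nat n) \<and> (a $ i = 0 \<longrightarrow> a \<in> S)" if "C a \<noteq> 0" for a
  proof -
    obtain v where v: "v \<in> S" "phi_series_coeff A (v - axis i 1) (a - axis i 1) \<noteq> 0"
      using \<open>C a \<noteq> 0\<close> unfolding C_def by (metis (mono_tags, lifting) mult_eq_0_iff sum.neutral)
    obtain k where k: "k \<in> kerZ A" "nsupp (v - axis i 1 + of_int_vec k) = nsupp (v - axis i 1)"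
        "a - axis i 1 = v - axis i 1 + of_int_vec k"
      using phi_series_coeff_nonzeroE[OF v(2)] by metis
    note v_facts = generic_setting.nsupp_shift_eqD[OF gs[OF v(1)] k(1,2)]
    have a: "a = v + of_int_vec k" using k(3) by (simp add: diff_add_eq)
    then have ai: "a $ i = of_int (k $ i)" using S(2)[OF v(1)] by (simp add: of_int_vec_def)
    have "a $ i = - of_nat (nat (- (k $ i)))" using ai v_facts(1) by simp
    moreover have "a \<in> S" if "a $ i = 0"
    proof -
      have "k = 0" using that ai v_facts(2) by simp
      then show ?thesis using a v(1) by (simp add: of_int_vec_def zero_vec_def[symmetric])
    qed
    ultimately show ?thesis by blast
  qed
  have C_S: "C u = c u"
  proof -
    have "phi_series_coeff A (v - axis i 1) (u - axis i 1) = (if v = u then 1 else 0)" if v: "v \<in> S" for v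
    proof (cases "v = u")
      case False
      show ?thesis
      proof (rule ccontr)
        assume "\<not> ?thesis"
        then have "phi_series_coeff A (v - axis i 1) (u - axis i 1) \<noteq> 0" using False by auto
        then obtain k where k: "k \<in> kerZ A" "nsupp (v - axis i 1 + of_int_vec k) = nsupp (v - axis i 1)"
            "u - axis i 1 = v - axis i 1 + of_int_vec k"
          using phi_series_coeff_nonzeroE by metis
        have "u = v + of_int_vec k" using k(3) by (simp add: diff_add_eq)
        moreover from this have "k $ i = 0"
          using S(2)[OF v] u.v_i by (simp add: of_int_vec_def)
        then have "k = 0" using generic_setting.nsupp_shift_eqD(2)[OF gs[OF v] k(1,2)] by blast
        ultimately show False using False by (simp add: of_int_vec_def zero_vec_def[symmetric])
      qed
    qed (simp add: phi_series_coeff_self)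
    then have "C u = (\<Sum>v\<in>S. if v = u then c v else 0)"
      unfolding C_def by (intro sum.cong) auto
    then show ?thesis using u S(1) by simp
  qed

  obtain d :: "'d \<Rightarrow> rat" where d: "(\<Sum>x\<in>UNIV. d x * of_int (A $ x $ i)) = 1"
    and d': "\<And>j. j \<noteq> i \<Longrightarrow> (\<Sum>x\<in>UNIV. d x * of_int (A $ x $ j)) \<noteq> 0 \<Longrightarrow> u $ j \<in> \<nat> \<and>
      (\<exists>k\<in>kerZ A. 0 < k $ i \<and> \<lfloor>Re (u $ j)\<rfloor> + k $ j < 0 \<and>
        (\<forall>x. x \<noteq> i \<and> x \<noteq> j \<and> u $ x \<in> \<nat> \<longrightarrow> 0 \<le> \<lfloor>Re (u $ x)\<rfloor> + k $ x))"
    by (rule u.weights_exist) (rule that; assumption)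
  define wt :: "'n \<Rightarrow> complex" where "wt j = of_rat (\<Sum>x\<in>UNIV. d x * of_int (A $ x $ j))" for j
  define G where "G = {j. j \<noteq> i \<and> wt j \<noteq> 0}"
  have "\<exists>k. \<forall>j\<in>G. k j \<in> kerZ A \<and> 0 < k j $ i \<and> \<lfloor>Re (u $ j)\<rfloor> + k j $ j < 0 \<and>
        (\<forall>x. x \<noteq> i \<and> x \<noteq> j \<and> u $ x \<in> \<nat> \<longrightarrow> 0 \<le> \<lfloor>Re (u $ x)\<rfloor> + k j $ x)"
    using d' by (intro bchoice) (auto simp: G_def wt_def)
  then obtain k where k_all: "\<forall>j\<in>G. k j \<in> kerZ A \<and> 0 < k j $ i \<and> \<lfloor>Re (u $ j)\<rfloor> + k j $ j < 0 \<and>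
        (\<forall>x. x \<noteq> i \<and> x \<noteq> j \<and> u $ x \<in> \<nat> \<longrightarrow> 0 \<le> \<lfloor>Re (u $ x)\<rfloor> + k j $ x)" ..
  have k: "\<And>j. j \<in> G \<Longrightarrow> k j \<in> kerZ A" "\<And>j. j \<in> G \<Longrightarrow> 0 < k j $ i"
      "\<And>j. j \<in> G \<Longrightarrow> \<lfloor>Re (u $ j)\<rfloor> + k j $ j < 0"
      "\<And>j x. j \<in> G \<Longrightarrow> x \<noteq> i \<Longrightarrow> x \<noteq> j \<Longrightarrow> u $ x \<in> \<nat> \<Longrightarrow> 0 \<le> \<lfloor>Re (u $ x)\<rfloor> + k j $ x"
    using k_all by simp_all
  have uG: "u $ j \<in> \<nat>" if "j \<in> G" for j using d' that by (auto simp: G_def wt_def)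
  \<comment> \<open>Negative and positive parts of the kernel vector, so that \<partial>^p -
    \<partial>^q lies in the toric ideal.\<close>
  define p where "p j = (\<chi> x. nat (- (k j $ x)))" for j
  define q where "q j = (\<chi> x. nat (k j $ x))" for j
  have pq: "of_nat_vec (q j) = of_nat_vec (p j) + k j" for j
    by (simp add: p_def q_def of_nat_vec_def vec_eq_iff)
  define L where "L a = falling_list a (sorted_list_of_set (UNIV :: 'n set))" for a
  have L_set: "set (L a) = {(j, of_nat m) |j m. m < a $ j}" for a by (simp add: L_def set_falling_list)
  have L_distinct: "distinct (L a)" for a by (simp add: L_def distinct_falling_list)

  txt \<open>By the toric equations \<open>[\<theta>]\<^sub>p f\<close> is a series in which \<open>x\<^sub>i\<close> has negative exponents only.\<close>
  have neg_series: "\<exists>C'. exp_series W C' (theta_prod (L (p j)) f) \<and>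
      (\<forall>a. C' a \<noteq> 0 \<longrightarrow> (\<exists>n::nat. a $ i = - of_nat (Suc n)))" if j: "j \<in> G" for j
  proof -
    have "A *v of_nat_vec (p j) = A *v of_nat_vec (q j)"
      using k(1)[OF j] by (simp add: pq matrix_vector_right_distrib kerZ_def)
    from Sol_dmon_op_eq[OF f this]
    have eq: "expo (- of_nat_vec (p j)) z * theta_prod (L (p j)) f z =
        expo (- of_nat_vec (q j)) z * theta_prod (L (q j)) f z" for z
      unfolding dmon_op_eq_theta_prod[OF W(1) hol] L_def[symmetric] by (rule fun_cong)
    define b :: "(complex, 'n) vec" where "b = of_nat_vec (p j) - of_nat_vec (q j)"
    have prod_eq: "theta_prod (L (p j)) f z = expo b z * theta_prod (L (q j)) f z" for z
    proof -
      have "theta_prod (L (p j)) f z =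
          expo (of_nat_vec (p j)) z * (expo (- of_nat_vec (p j)) z * theta_prod (L (p j)) f z)"
        using expo_add[of "of_nat_vec (p j)" "- of_nat_vec (p j)" z] by (simp flip: mult.assoc)
      also have "\<dots> = expo b z * theta_prod (L (q j)) f z"
        unfolding eq b_def diff_conv_add_uminus expo_add by (simp add: mult.assoc)
      finally show ?thesis .
    qed
    \<comment> \<open>Since q_i > 0, the factor \<theta>_i occurs and can be made to act on
      \<open>f\<close> first; only then is an expansion available.\<close>
    have "(i, 0) \<in> set (L (q j))" using k(2)[OF j] by (auto simp: L_set q_def intro!: exI[of _ 0])
    then have "mset (L (q j)) = mset (remove1 (i, 0) (L (q j)) @ [(i, 0)])" by simp
    then have "theta_prod (L (q j)) f = theta_prod (remove1 (i, 0) (L (q j)) @ [(i, 0)]) f"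
      by (rule theta_prod_mset[OF hol])
    then have "theta_prod (L (q j)) f = theta_prod (remove1 (i, 0) (L (q j))) (theta W i f)"
      by (simp add: theta_prod_append)
    then have "exp_series W
        (\<lambda>a. C (a - b) * (\<Prod>x\<leftarrow>remove1 (i, 0) (L (q j)). (a - b) $ fst x - snd x))
        (\<lambda>z. expo b z * theta_prod (L (q j)) f z)"
      using exp_series_expo[OF exp_series_theta_prod[OF C]] by simp
    \<comment> \<open>The monomial x^(p - q) lowers the degree in x_i by the positive integer
      \<open>k j $ i\<close>.\<close>
    moreover have "\<exists>n::nat. a $ i = - of_nat (Suc n)" if Cab: "C (a - b) \<noteq> 0" for a
    proof -
      obtain n :: nat where "(a - b) $ i = - of_nat n" using C_support[OF Cab] by blast
      moreover have "b $ i = - of_nat (nat (k j $ i))"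
        using k(2)[OF j] by (simp add: b_def p_def q_def of_nat_vec_def)
      ultimately have "a $ i = - of_nat (n + nat (k j $ i))" by (simp add: algebra_simps)
      then show ?thesis using k(2)[OF j] by (intro exI[of _ "n + nat (k j $ i) - 1"]) simp
    qed
    ultimately show ?thesis unfolding prod_eq[abs_def] by auto
  qed
  have pj: "(j, u $ j) \<in> set (L (p j))" if j: "j \<in> G" for j
  proof -
    obtain n where n: "u $ j = of_nat n" using uG[OF j] by (elim Nats_cases)
    then have "n < p j $ j" using k(3)[OF j] by (simp add: p_def)
    then show ?thesis using n by (auto simp: L_set)
  qed
  define T where "T j = remove1 (j, u $ j) (L (p j))" for j
  \<comment> \<open>A vanishing factor at \<open>y\<close> needs u_y < p_y. For y different from
    \<open>j\<close> and \<open>i\<close> the choice of \<open>k j\<close> gives p_y \<le> u_y,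
    while p_i = 0.\<close>
  have T_nonzero: "u $ fst x - snd x \<noteq> 0" if j: "j \<in> G" and x: "x \<in> set (T j)" for j x
  proof
    assume eq0: "u $ fst x - snd x = 0"
    have "x \<in> set (L (p j))" "x \<noteq> (j, u $ j)"
      using x L_distinct by (auto simp: T_def)
    then obtain y m where ym: "x = (y, of_nat m)" "m < p j $ y" by (auto simp: L_set)
    then have uy: "u $ y = of_nat m" using eq0 by simp
    have "y \<noteq> j" using uy ym(1) \<open>x \<noteq> (j, u $ j)\<close> by auto
    moreover have "y \<noteq> i" using ym(2) k(2)[OF j] by (auto simp: p_def)
    ultimately have "0 \<le> \<lfloor>Re (u $ y)\<rfloor> + k j $ y" using uy by (intro k(4)[OF j]) simp_all
    then show False using uy ym(2) by (simp add: p_def)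
  qed

  txt \<open>Factors annihilating the other exponents of \<open>S\<close>, which all have \<open>x\<^sub>i\<close>-degree \<open>0\<close>.\<close>
  have "\<exists>y. v $ y \<noteq> u $ y" if "v \<noteq> u" for v using that by (simp add: vec_eq_iff)
  then obtain e where e: "\<And>v. v \<noteq> u \<Longrightarrow> v $ e v \<noteq> u $ e v" by metis
  obtain vs where vs: "set vs = S - {u}" using finite_list[of "S - {u}"] S(1) by auto
  obtain js where js: "set js = G" "distinct js" using finite_distinct_list[of G] by auto
  define TT where "TT = concat (map T js) @ map (\<lambda>v. (e v, v $ e v)) vs"
  have TT_u: "(\<Prod>x\<leftarrow>TT. u $ fst x - snd x) \<noteq> 0"
  proof -
    have "u $ fst x - snd x \<noteq> 0" if "x \<in> set TT" for x
    proof -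
      from that consider j where "j \<in> G" "x \<in> set (T j)" | v where "v \<noteq> u" "x = (e v, v $ e v)"
        using vs js(1) by (auto simp: TT_def)
      then show ?thesis
      proof cases
        case 2
        then show ?thesis using e[of v] by simp
      qed (use T_nonzero in blast)
    qed
    then show ?thesis by (auto simp: prod_list_zero_iff)
  qed
  have TT_v: "(\<Prod>x\<leftarrow>TT. v $ fst x - snd x) = 0" if "v \<in> S" "v \<noteq> u" for v
    unfolding prod_list_zero_iff TT_def using that vs by (auto simp: image_iff)

  have neg_TT: "\<exists>C'. exp_series W C' (theta_prod TT (\<lambda>z. theta W j f z - u $ j * f z)) \<and>
      (\<forall>a. C' a \<noteq> 0 \<longrightarrow> (\<exists>n::nat. a $ i = - of_nat (Suc n)))" if j: "j \<in> G" for j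
  proof -
    have "j \<in> set js" using js(1) j by simp
    from split_list[OF this] obtain ys zs where "js = ys @ j # zs" by blast
    then have "mset TT = mset (concat (map T ys) @ concat (map T zs) @ map (\<lambda>v. (e v, v $ e v)) vs) + mset (T j)"
      by (simp add: TT_def)
    then obtain R where R: "mset TT = mset R + mset (T j)" by blast
    \<comment> \<open>The missing factor \<theta>_j - u_j completes T_j to the whole falling
      factorial; the remaining factors \<open>R\<close> do not enlarge the set of exponents.\<close>
    have "mset (TT @ [(j, u $ j)]) = mset (R @ L (p j))"
      using pj[OF j] by (simp add: R T_def)
    then have "theta_prod (TT @ [(j, u $ j)]) f = theta_prod (R @ L (p j)) f"
      by (rule theta_prod_mset[OF hol])
    then have "theta_prod TT (\<lambda>z. theta W j f z - u $ j * f z) = theta_prod R (theta_prod (L (p j)) f)"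
      by (simp add: theta_prod_append)
    moreover obtain C' where C': "exp_series W C' (theta_prod (L (p j)) f)"
      "\<forall>a. C' a \<noteq> 0 \<longrightarrow> (\<exists>n::nat. a $ i = - of_nat (Suc n))" using neg_series[OF j] by blast
    ultimately show ?thesis
      using exp_series_theta_prod[OF C'(1), of R]
      by (intro exI[of _ "\<lambda>a. C' a * (\<Prod>x\<leftarrow>R. a $ fst x - snd x)"]) auto
  qed
  then obtain D where D: "\<And>j. j \<in> G \<Longrightarrow> exp_series W (D j) (theta_prod TT (\<lambda>z. theta W j f z - u $ j * f z))"
      "\<And>j a. j \<in> G \<Longrightarrow> D j a \<noteq> 0 \<Longrightarrow> \<exists>n::nat. a $ i = - of_nat (Suc n)"
    by metis

  have euler: "theta W i f = (\<lambda>z. \<Sum>j\<in>G. - wt j * (theta W j f z - u $ j * f z))"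
  proof
    fix z
    have wt: "wt j = (\<Sum>x\<in>UNIV. of_rat (d x) * of_int (A $ x $ j))" for j
      by (simp add: wt_def of_rat_sum of_rat_mult)
    have "(\<Sum>j\<in>UNIV. wt j * theta W j f z) =
        (\<Sum>x\<in>UNIV. of_rat (d x) * (\<Sum>j\<in>UNIV. of_int (A $ x $ j) * theta W j f z))"
      unfolding wt sum_distrib_left sum_distrib_right by (subst sum.swap) (simp add: mult.assoc)
    also have "\<dots> = (\<Sum>x\<in>UNIV. of_rat (d x) * \<gamma> $ x) * f z"
      by (simp add: Sol_euler[OF f] sum_distrib_right mult.assoc)
    also have "(\<Sum>x\<in>UNIV. of_rat (d x) * \<gamma> $ x) = (\<Sum>j\<in>UNIV. wt j * u $ j)"
    proof -
      have "\<gamma> $ x = (\<Sum>j\<in>UNIV. of_int (A $ x $ j) * u $ j)" for x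
        unfolding \<gamma> u.A_v[symmetric] by (simp add: matrix_vector_mult_def map_matrix_def)
      then show ?thesis
        unfolding wt sum_distrib_left sum_distrib_right by (subst sum.swap) (simp add: sum_distrib_left mult.assoc)
    qed
    finally have "(\<Sum>j\<in>UNIV. wt j * (theta W j f z - u $ j * f z)) = 0"
      by (simp add: right_diff_distrib sum_subtractf sum_distrib_right mult.assoc)
    moreover have "(\<Sum>j\<in>UNIV. wt j * (theta W j f z - u $ j * f z)) =
        (\<Sum>j\<in>insert i G. wt j * (theta W j f z - u $ j * f z))"
      by (rule sum.mono_neutral_right) (auto simp: G_def)
    moreover have "wt i = 1" using d by (simp add: wt_def)
    ultimately have "theta W i f z + (\<Sum>j\<in>G. wt j * (theta W j f z - u $ j * f z)) = 0"
      using u.v_i by (simp add: G_def)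
    then show "theta W i f z = (\<Sum>j\<in>G. - wt j * (theta W j f z - u $ j * f z))"
      by (simp add: sum_negf add_eq_0_iff2)
  qed
  have "theta_prod TT (theta W i f) =
      (\<lambda>z. \<Sum>j\<in>G. - wt j * theta_prod TT (\<lambda>z. theta W j f z - u $ j * f z) z)"
    unfolding euler[THEN arg_cong[of _ _ "theta_prod TT"]]
    by (intro theta_prod_sum sep_holomorphic_diff_cmult sep_holomorphic_theta hol)
  \<comment> \<open>Coefficients of the identity obtained by moving all terms of the Euler relation,
    after applying \<open>TT\<close>, to one side.\<close>
  moreover define E where
    "E a = C a * (\<Prod>x\<leftarrow>TT. a $ fst x - snd x) + (\<Sum>j\<in>G. wt j * D j a)" for a
  have "exp_series W E (\<lambda>z. theta_prod TT (theta W i f) z +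
      (\<Sum>j\<in>G. wt j * theta_prod TT (\<lambda>z. theta W j f z - u $ j * f z) z))"
    unfolding E_def
    by (intro exp_series_add exp_series_theta_prod[OF C] exp_series_sum exp_series_cmult D(1))
  ultimately have E: "exp_series W E (\<lambda>_. 0)"
    by (simp add: sum_negf)
  have E0: "E a = C a * (\<Prod>x\<leftarrow>TT. a $ fst x - snd x)" if "a $ i = 0" for a
  proof -
    have "D j a = 0" if j: "j \<in> G" for j
    proof (rule ccontr)
      assume "D j a \<noteq> 0"
      then obtain n :: nat where "a $ i = - of_nat (Suc n)" using D(2)[OF j] by blast
      then have "- of_nat (Suc n) = (0 :: complex)" using \<open>a $ i = 0\<close> by metis
      then show False by (simp only: neg_equal_0_iff_equal of_nat_eq_0_iff)
    qed
    then show ?thesis by (simp add: E_def)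
  qed
  have E_support: "\<exists>n::nat. a $ i = - of_nat n" if "E a \<noteq> 0" for a
  proof (cases "C a = 0")
    case True
    with that have "(\<Sum>j\<in>G. wt j * D j a) \<noteq> 0" by (simp add: E_def)
    then obtain j where "j \<in> G" "D j a \<noteq> 0" by (metis (mono_tags, lifting) mult_zero_right sum.neutral)
    then show ?thesis using D(2) by blast
  next
    case False
    then show ?thesis using C_support by blast
  qed
  obtain z where z: "z \<in> W" using W(2) by blast
  have "((\<lambda>a. E a * expo a z) has_sum 0) {a. a $ i = 0}"
    by (rule exp_series_degree_zero[OF W(1) z E E_support])
  then have "((\<lambda>a. E a * expo a z) has_sum 0) {u}"
  proof (rule has_sum_cong_neutral[THEN iffD1, rotated -1])
    fix a assume a: "a \<in> {a. a $ i = 0} - {u}"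
    then have "C a = 0 \<or> a \<in> S" using C_support by blast
    then have "E a = 0" using a E0[of a] TT_v[of a] by auto
    then show "E a * expo a z = 0" by simp
  qed (use u.v_i in auto)
  then have "E u * expo u z = 0" using has_sum_unique[OF _ has_sum_finite[of "{u}"]] by force
  then show ?thesis using TT_u E0[OF u.v_i] C_S by simp
qed

section \<open>Translation of the hypotheses\<close>

lemma idx_bij: "bij_betw (idx :: nat \<Rightarrow> 'k::{finite,linorder}) {1..CARD('k)} UNIV"
proof -
  let ?l = "sorted_list_of_set (UNIV :: 'k set)"
  have "bij_betw (nth ?l) {..<length ?l} (set ?l)" by (rule bij_betw_nth) auto
  then have nth: "bij_betw (nth ?l) {..<CARD('k)} UNIV" by simp
  have "bij_betw (\<lambda>j. j - 1) {1..CARD('k)} {..<CARD('k)}"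
    by (rule bij_betw_byWitness[where f' = Suc]) auto
  from bij_betw_trans[OF this nth] show ?thesis by (simp add: idx_def[abs_def] comp_def)
qed

lemma of_int_mat_mult_of_int_vec:
  "of_int_mat B *v (of_int_vec y :: 'a::ring_1^'m::finite) = of_int_vec (B *v y)"
  by (simp add: matrix_vector_mult_def map_matrix_def of_int_vec_def vec_eq_iff)

lemma of_int_mat_component:
  "(of_int_mat B *v (of_int_vec y :: 'a::ring_1^'m::finite)) $ j = of_int ((B *v y) $ j)"
  by (simp add: of_int_mat_mult_of_int_vec) (simp add: of_int_vec_def)

text \<open>Since the columns generate the lattice, each unit vector has an integer preimage;
  subtracting these projects e_j to an integral kernel vector h_j, and z is the sum of the z_j h_j
  whenever Az = 0.\<close>

lemma complex_kernel_eq_range: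
  fixes A :: "int^'n::finite^'d::finite" and B :: "int^'m::finite^'n" and z :: "complex^'n"
  assumes surj: "range (\<lambda>u :: int^'n. A *v u) = UNIV"
    and B: "range (\<lambda>y :: int^'m. B *v y) = kerZ A"
    and z: "of_int_mat A *v z = 0"
  obtains y :: "complex^'m" where "of_int_mat B *v y = z"
proof -
  have "\<forall>x. \<exists>r. A *v r = axis x 1" using surj by (metis surj_def)
  then obtain r where r: "\<And>x. A *v r x = axis x 1" by metis
  define h where "h j = axis j 1 - (\<Sum>x\<in>UNIV. A $ x $ j *s r x)" for j
  have "h j \<in> kerZ A" for j
  proof -
    have "A *v (\<Sum>x\<in>UNIV. A $ x $ j *s r x) = (\<Sum>x\<in>UNIV. A $ x $ j *s (A *v r x))"
    proof (rule vec_eq_iff[THEN iffD2], rule allI)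
      fix t
      show "(A *v (\<Sum>x\<in>UNIV. A $ x $ j *s r x)) $ t = (\<Sum>x\<in>UNIV. A $ x $ j *s (A *v r x)) $ t"
        by (simp add: matrix_vector_mult_def sum_distrib_left mult.left_commute)
          (rule sum.swap)
    qed
    also have "\<dots> = A *v axis j 1"
      unfolding r
      by (simp add: vec_eq_iff matrix_vector_mult_def axis_def if_distrib[of "\<lambda>t. _ * t"] cong: if_cong)
    finally show ?thesis by (simp add: h_def kerZ_def matrix_vector_mult_diff_distrib)
  qed
  then have "\<forall>j. \<exists>y. B *v y = h j" using B by (metis imageE)
  then obtain y where y: "\<And>j. B *v y j = h j" by metis
  define w :: "complex^'m" where "w = (\<chi> s. \<Sum>j\<in>UNIV. z $ j * of_int (y j $ s))"
  have Az: "(\<Sum>j\<in>UNIV. of_int (A $ x $ j) * z $ j) = 0" for x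
    using arg_cong[OF z, of "\<lambda>v. v $ x"] by (simp add: matrix_vector_mult_def map_matrix_def)
  have "(of_int_mat B *v w) $ t = z $ t" for t
  proof -
    have "(of_int_mat B *v w) $ t = (\<Sum>s\<in>UNIV. \<Sum>j\<in>UNIV. z $ j * of_int (B $ t $ s * y j $ s))"
      by (simp add: w_def matrix_vector_mult_def map_matrix_def sum_distrib_left mult_ac)
    also have "\<dots> = (\<Sum>j\<in>UNIV. \<Sum>s\<in>UNIV. z $ j * of_int (B $ t $ s * y j $ s))"
      by (rule sum.swap)
    also have "\<dots> = (\<Sum>j\<in>UNIV. z $ j * of_int ((B *v y j) $ t))"
      by (simp add: matrix_vector_mult_def flip: sum_distrib_left)
    also have "\<dots> = (\<Sum>j\<in>UNIV. (if j = t then z $ j else 0) -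
        (\<Sum>x\<in>UNIV. of_int (r x $ t) * (of_int (A $ x $ j) * z $ j)))"
      by (rule sum.cong)
        (auto simp: y h_def axis_def right_diff_distrib sum_distrib_left mult_ac)
    also have "\<dots> = z $ t - (\<Sum>x\<in>UNIV. of_int (r x $ t) * (\<Sum>j\<in>UNIV. of_int (A $ x $ j) * z $ j))"
      by (simp add: sum_subtractf sum_distrib_left) (rule sum.swap)
    also have "\<dots> = z $ t" by (simp add: Az)
    finally show ?thesis .
  qed
  then show thesis using that[of w] by (simp add: vec_eq_iff)
qed

text \<open>The excluded hyperplanes have rational coefficients and right-hand sides, hence are
  countably many.\<close>

lemma for_generic_rat_independent:
  assumes "\<And>\<alpha>. rat_independent T \<alpha> \<Longrightarrow> (\<And>j. j \<notin> T \<Longrightarrow> \<alpha> $ j = 0) \<Longrightarrow> P \<alpha>"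
  shows "for_generic T P"
proof -
  define H :: "((complex^'a) \<times> complex) set" where
    "H = (\<lambda>(q :: rat^'a, b :: rat). ((\<chi> j. of_rat (q $ j)), of_rat b)) ` {(q, b). \<exists>j\<in>T. q $ j \<noteq> 0}"
  have "countable H" unfolding H_def by (intro countable_image) (rule countableI_type)
  moreover have "\<forall>(c, b)\<in>H. \<exists>i\<in>T. c $ i \<noteq> 0" by (auto simp: H_def)
  moreover have "P \<alpha>" if \<alpha>: "\<forall>i. i \<notin> T \<longrightarrow> \<alpha> $ i = 0" "\<forall>(c, b)\<in>H. (\<Sum>i\<in>T. c $ i * \<alpha> $ i) \<noteq> b" for \<alpha>
  proof (rule assms)
    show "rat_independent T \<alpha>"
      unfolding rat_independent_def
    proof (intro allI impI ballI, rule ccontr)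
      fix q :: "'a \<Rightarrow> rat" and b j
      assume eq: "(\<Sum>j\<in>T. of_rat (q j) * \<alpha> $ j) = of_rat b" and "j \<in> T" "q j \<noteq> 0"
      then have "((\<chi> j. of_rat (q j)), of_rat b) \<in> H"
        unfolding H_def by (intro image_eqI[of _ _ "((\<chi> j. q j), b)"]) auto
      then show False using \<alpha>(2) eq by auto
    qed
  qed (use \<alpha> in auto)
  ultimately show ?thesis unfolding for_generic_def by (intro exI[of _ H]) blast
qed

text \<open>A bounded polyhedron has trivial recession cone, and \<open>opt\<close> handles kernel
  vectors of the other sign at \<open>i\<close>. Coinciding hyperplanes make entries
  \<open>r\<close> and \<open>i\<close> proportional; a nonnegative ratio again gives the first
  alternative.\<close>

lemma recession_dichotomy:
  fixes A :: "int^'n::finite^'d" and B :: "int^'m::finite^'n"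
  assumes B: "range (\<lambda>y :: int^'m. B *v y) = kerZ A"
    and opt: "optimal A i \<sigma> (\<lambda>_. 0)"
    and J: "- \<sigma> = J"
    and cond: "bounded {y :: real^'m. (\<forall>j\<in>J. (of_int_mat B *v y) $ j \<le> real (\<eta> $ j)) \<and>
          (of_int_mat B *v y) $ i \<ge> 0} \<or>
       (\<exists>r\<in>J. {y :: real^'m. (of_int_mat B *v y) $ r = 0} = {y :: real^'m. (of_int_mat B *v y) $ i = 0})"
  shows "(\<forall>k\<in>kerZ A. (\<forall>j. j \<notin> \<sigma> \<longrightarrow> 0 \<le> k $ j) \<longrightarrow> k = 0) \<or>
      (\<exists>r. r \<notin> \<sigma> \<and> (\<forall>k\<in>kerZ A. k $ r * k $ i \<le> 0 \<and> (k $ r = 0 \<longleftrightarrow> k $ i = 0)))"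
  using cond
proof
  assume bdd: "bounded {y :: real^'m. (\<forall>j\<in>J. (of_int_mat B *v y) $ j \<le> real (\<eta> $ j)) \<and>
          (of_int_mat B *v y) $ i \<ge> 0}" (is "bounded ?Q")
  have neg: "k = 0" if k: "k \<in> kerZ A" "0 \<le> k $ i" "\<And>j. j \<notin> \<sigma> \<Longrightarrow> k $ j \<le> 0" for k
  proof -
    obtain y where y: "k = B *v y" using k(1) B by blast
    obtain b where b: "\<And>x. x \<in> ?Q \<Longrightarrow> norm x \<le> b" using bdd unfolding bounded_iff by blast
    have scale: "(of_int_mat B *v (real n *s of_int_vec y)) $ j = real n * of_int (k $ j)" for n j
      using of_int_mat_component[of B y j, where 'a = real] by (simp add: vec.scale y)
    have mem: "real n *s of_int_vec y \<in> ?Q" for n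
    proof -
      have "real n * of_int (k $ j) \<le> real (\<eta> $ j)" if "j \<in> J" for j
      proof -
        have "real n * of_int (k $ j) \<le> 0" using that k(3)[of j] J by (intro mult_nonneg_nonpos) auto
        then show ?thesis by (rule order_trans) simp
      qed
      then show ?thesis using k(2) by (simp add: scale del: of_int_mat_component)
    qed
    have "norm (of_int_vec y :: real^'m) = 0"
    proof (rule ccontr)
      assume "norm (of_int_vec y :: real^'m) \<noteq> 0"
      then have pos: "norm (of_int_vec y :: real^'m) > 0" by simp
      obtain n where "b / norm (of_int_vec y :: real^'m) < real n" using reals_Archimedean2 by blast
      then have "b < real n * norm (of_int_vec y :: real^'m)" using pos by (simp add: divide_less_eq)
      moreover have "norm (real n *s of_int_vec y :: real^'m) \<le> b" using b[OF mem] .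
      ultimately show False by (simp add: scalar_mult_eq_scaleR)
    qed
    then have "y = 0" by (simp add: of_int_vec_def vec_eq_iff)
    then show ?thesis by (simp add: y)
  qed
  have "k = 0" if k: "k \<in> kerZ A" "\<And>j. j \<notin> \<sigma> \<Longrightarrow> 0 \<le> k $ j" for k
  proof (cases "0 \<le> k $ i")
    case True
    then show ?thesis using k by (intro optimalD[OF opt]) auto
  next
    case False
    then have "- k = 0" using k by (intro neg) (auto simp: kerZ_uminus)
    then show ?thesis by simp
  qed
  then show ?thesis by blast
next
  assume "\<exists>r\<in>J. {y :: real^'m. (of_int_mat B *v y) $ r = 0} = {y :: real^'m. (of_int_mat B *v y) $ i = 0}"
  then obtain r where r: "r \<in> J" and
    eq: "{y :: real^'m. (of_int_mat B *v y) $ r = 0} = {y :: real^'m. (of_int_mat B *v y) $ i = 0}" by blast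
  have r\<sigma>: "r \<notin> \<sigma>" using r J by auto
  have iff: "k $ r = 0 \<longleftrightarrow> k $ i = 0" if k: "k \<in> kerZ A" for k
  proof -
    obtain y where y: "k = B *v y" using k B by blast
    have "(of_int_vec y :: real^'m) \<in> {y. (of_int_mat B *v y) $ r = 0} \<longleftrightarrow>
        (of_int_vec y :: real^'m) \<in> {y. (of_int_mat B *v y) $ i = 0}" by (simp only: eq)
    then show ?thesis unfolding mem_Collect_eq of_int_mat_component y by simp
  qed
  have proportional: "k $ r * k' $ i = k' $ r * k $ i" if "k \<in> kerZ A" "k' \<in> kerZ A" for k k'
  proof -
    have "k $ r *s k' - k' $ r *s k \<in> kerZ A" by (intro kerZ_diff kerZ_scale that)
    from iff[OF this] show ?thesis by simp
  qed
  show ?thesis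
  proof (cases "\<forall>k\<in>kerZ A. 0 \<le> k $ r * k $ i")
    case True
    have "k = 0" if k: "k \<in> kerZ A" "\<And>j. j \<notin> \<sigma> \<Longrightarrow> 0 \<le> k $ j" for k
    proof (rule optimalD[OF opt k(1)])
      show "0 \<le> k $ i"
        using True k(1) k(2)[OF r\<sigma>] iff[OF k(1)] by (metis le_less mult_pos_neg not_le)
    qed (use k(2) in auto)
    then show ?thesis by blast
  next
    case False
    then obtain k0 where k0: "k0 \<in> kerZ A" "k0 $ r * k0 $ i < 0" by (metis not_le)
    have "k $ r * k $ i \<le> 0" if "k \<in> kerZ A" for k
    proof (rule ccontr)
      assume "\<not> ?thesis"
      then have "(k $ r * k $ i) * (k0 $ r * k0 $ i) < 0" using k0(2) by (simp only: mult_pos_neg not_le)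
      also have "(k $ r * k $ i) * (k0 $ r * k0 $ i) = (k $ r * k0 $ i) * (k0 $ r * k $ i)" by simp
      also have "\<dots> = (k0 $ r * k $ i)\<^sup>2"
        unfolding proportional[OF that k0(1)] by (simp add: power2_eq_square)
      finally show False by simp
    qed
    then show ?thesis using r\<sigma> iff by blast
  qed
qed

lemma module_complex_functions: "module (\<lambda>(c::complex) (f :: 'x \<Rightarrow> complex) x. c * f x)"
  by unfold_locales (auto simp: algebra_simps)

lemma zero_mem_Sol: "0 \<in> Sol W A \<gamma>"
proof -
  have dx0: "dx W j 0 = 0" for j by (auto simp: dx_def zero_fun_def)
  have weyl0: "P 0 = 0" if "P \<in> weyl_algebra W" for P
    using that
  proof induction
    case (add P Q)
    then show ?case by (simp only: plus_fun_apply add_0)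
  next
    case (mult P Q)
    then show ?case by (simp only: comp_apply)
  next
    case (deriv j)
    show ?case by (rule dx0)
  qed (auto intro!: ext)
  have dmon0: "foldr (\<lambda>j P. (dx W j ^^ (a $ j)) \<circ> P) xs id 0 = 0" for a xs
  proof (induction xs)
    case (Cons x xs)
    have "(dx W x ^^ n) 0 = 0" for n
    proof (induction n)
      case (Suc n)
      then show ?case by (simp only: funpow.simps comp_apply dx0)
    qed simp
    then show ?case using Cons by (simp only: foldr.simps comp_apply)
  qed simp
  have "P 0 = 0" if "P \<in> H_A W A \<gamma>" for P
    using that unfolding H_A_def
  proof induction
    case zero
    show ?case by (rule zero_fun_apply)
  next
    case (gen P)
    have dpoly0: "dpoly_op W p 0 = 0" for p
      by (rule ext) (unfold dpoly_op_def dmon_op_def dmon0, simp)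
    have euler0: "euler_op W A \<gamma> x 0 = 0" for x
      by (rule ext) (unfold euler_op_def dx0, simp)
    from gen show ?case by (elim UnE imageE) (simp_all only: dpoly0 euler0)
  next
    case (add P Q)
    then show ?case by (simp only: plus_fun_apply add_0)
  next
    case (mult Q P)
    then show ?case by (simp only: comp_apply weyl0)
  qed
  moreover have "holomorphic_Cn W 0"
    unfolding holomorphic_Cn_def zero_fun_def by (auto intro!: exI[of _ "\<lambda>_. 0"])
  ultimately show ?thesis by (auto simp: Sol_def)
qed

theorem theorem6p2:
  fixes A :: "int^'n::{finite,linorder}^'d::{finite,linorder}"
    and B :: "int^'m^'n::{finite,linorder}"
    and \<eta> :: "nat^'n::{finite,linorder}"
    and \<tau> :: "'n set"
    and M :: "'n dpoly set"
  assumes dims: "CARD('n) = CARD('d) + CARD('m)"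
    and first_row: "\<forall>j. A $ idx 1 $ j = 1"
    and distinct_columns: "inj (\<lambda>j. column j A)"
    and columns_generate: "range (\<lambda>u :: int^'n::{finite,linorder}. A *v u) = UNIV"
    and B_basis: "inj (\<lambda>y :: int^'m. B *v y)" "range (\<lambda>y :: int^'m. B *v y) = kerZ A"
    and generic_ideal: "generic_binomial_ideal (toric_ideal A)"
    and not_CM: "\<not> cohen_macaulay_mod (toric_ideal A)"
    and M_eq: "M = initial_ideal (- axis (idx 1) 1) (toric_ideal A)"
    and \<tau>_eq: "\<tau> = idx ` {CARD('m) + 3..CARD('n)}"
    and embedded: "embedded_standard_pair M \<eta> (insert (idx 1) \<tau>)"
    and cond_i:
      "bounded {y :: real^'m.
          (\<forall>j\<in>{2..CARD('m) + 2}. (of_int_mat B *v y) $ idx j \<le> real (\<eta> $ idx j)) \<and>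
          (of_int_mat B *v y) $ idx 1 \<ge> 0} \<or>
       (\<exists>r\<in>{2..CARD('m) + 2}.
          {y :: real^'m. (of_int_mat B *v y) $ idx r = 0} =
          {y :: real^'m. (of_int_mat B *v y) $ idx 1 = 0})"
    and cond_ii:
      "\<forall>\<mu> (y :: complex^'m) (k :: int).
          standard_pair M \<mu> (insert (idx 1) \<tau>) \<and>
          (\<forall>i\<in>{2..CARD('m) + 2}.
              of_nat (\<mu> $ idx i) = of_nat (\<eta> $ idx i) - (of_int_mat B *v y) $ idx i) \<and>
          (of_int_mat B *v y) $ idx 1 = of_int k
          \<longrightarrow> k \<le> 0"
  shows "for_generic \<tau> (\<lambda>\<alpha>.
    let w = - axis (idx 1) 1;
        \<gamma> = of_int_mat A *v (of_nat_vec \<eta> + \<alpha>);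
        \<beta> = of_int_mat A *v (of_nat_vec \<eta> + \<alpha> - axis (idx 1) 1);
        F = minimal_fake_exponents w A \<gamma>;
        K = {u \<in> F. u $ idx 1 = 0}
    in \<forall>W :: (complex^'n::{finite,linorder}) set.
         open W \<and> connected W \<and> W \<noteq> {} \<and>
         (\<forall>v \<in> F \<union> minimal_fake_exponents w A \<beta>. phi_converges_on W A v)
         \<longrightarrow> complex_span {phi W A (u - axis (idx 1) 1) | u. u \<in> K}
               \<inter> dx W (idx 1) ` Sol W A \<gamma> = {0})"
proof (rule for_generic_rat_independent)
  let ?i = "idx 1 :: 'n"
  have inj_idx: "inj_on (idx :: nat \<Rightarrow> 'n) {1..CARD('n)}" and surj_idx: "idx ` {1..CARD('n)} = (UNIV :: 'n set)"
    using idx_bij[where 'k = 'n] by (auto simp: bij_betw_def)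
  have m: "CARD('m) \<ge> 1" by (simp add: Suc_le_eq)
  have d2: "CARD('d) \<ge> 2"
  \<comment> \<open>For d = 1 every column equals (1), while there are at least two distinct
    columns.\<close>
  proof (rule ccontr)
    assume "\<not> ?thesis"
    then have "CARD('d) = 1" using zero_less_card_finite[where 'a = 'd] by linarith
    then obtain x where "(UNIV :: 'd set) = {x}" by (auto simp: card_1_singleton_iff)
    then have "y = idx 1" for y :: 'd by (metis UNIV_I singletonD)
    then have "column j A = column j' A" for j j'
      using first_row by (simp add: column_def vec_eq_iff) metis
    then have "j = j'" for j j' :: 'n using distinct_columns by (auto dest: injD)
    then have "CARD('n) \<le> 1" by (metis card_le_Suc0_iff_eq finite One_nat_def)
    then show False using dims m \<open>CARD('d) = 1\<close> by simp
  qed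
  have i_\<tau>: "?i \<notin> \<tau>"
    using inj_idx dims d2 unfolding \<tau>_eq by (auto dest!: inj_onD)
  have card_\<tau>: "card \<tau> + 2 = CARD('d)"
  proof -
    have "card \<tau> = card {CARD('m) + 3..CARD('n)}"
      unfolding \<tau>_eq by (rule card_image, rule inj_on_subset[OF inj_idx]) auto
    then show ?thesis using dims d2 by simp
  qed
  have compl: "- insert ?i \<tau> = idx ` {2..CARD('m) + 2}"
  proof -
    have "insert ?i \<tau> = idx ` ({1} \<union> {CARD('m) + 3..CARD('n)})" by (simp add: \<tau>_eq)
    then have "- insert ?i \<tau> = idx ` {1..CARD('n)} - idx ` ({1} \<union> {CARD('m) + 3..CARD('n)})"
      by (simp only: surj_idx Compl_eq_Diff_UNIV)
    also have "\<dots> = idx ` ({1..CARD('n)} - ({1} \<union> {CARD('m) + 3..CARD('n)}))"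
      using dims d2 by (intro inj_on_image_set_diff[OF inj_idx, symmetric]) auto
    also have "{1..CARD('n)} - ({1} \<union> {CARD('m) + 3..CARD('n)}) = {2..CARD('m) + 2}"
      using dims d2 by auto
    finally show ?thesis .
  qed
  have std: "standard_pair (initial_ideal (- axis ?i 1) (toric_ideal A)) \<eta> (insert ?i \<tau>)"
    using embedded M_eq by (simp add: embedded_standard_pair_def)
  have setting: "combinatorial_setting A ?i \<tau> \<eta>"
  proof (unfold_locales, rule generic_ideal, rule distinct_columns, rule i_\<tau>, rule card_\<tau>, rule std)
    have "optimal A ?i (insert ?i \<tau>) (\<lambda>j. int (\<eta> $ j))"
      using std by (simp add: standard_pair_iff_optimal[OF generic_ideal])
    then have "optimal A ?i (insert ?i \<tau>) (\<lambda>_. 0)" by (rule optimal_zero) simp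
    then show "(\<forall>k\<in>kerZ A. (\<forall>j. j \<notin> insert ?i \<tau> \<longrightarrow> 0 \<le> k $ j) \<longrightarrow> k = 0) \<or>
      (\<exists>r. r \<notin> insert ?i \<tau> \<and> (\<forall>k\<in>kerZ A. k $ r * k $ ?i \<le> 0 \<and> (k $ r = 0 \<longleftrightarrow> k $ ?i = 0)))"
      using cond_i by (intro recession_dichotomy[OF B_basis(2) _ compl]) auto
  next
    fix \<mu> and z :: "(complex, 'n) vec" and k
    assume \<mu>: "standard_pair (initial_ideal (- axis ?i 1) (toric_ideal A)) \<mu> (insert ?i \<tau>)"
      and Az: "of_int_mat A *v z = 0"
      and \<mu>z: "\<And>j. j \<notin> insert ?i \<tau> \<Longrightarrow> of_nat (\<mu> $ j) = of_nat (\<eta> $ j) - z $ j"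
      and zk: "z $ ?i = of_int k"
    obtain y :: "complex^'m" where y: "of_int_mat B *v y = z"
      using complex_kernel_eq_range[OF columns_generate B_basis(2) Az] .
    have "of_nat (\<mu> $ idx j) = of_nat (\<eta> $ idx j) - (of_int_mat B *v y) $ idx j"
      if "j \<in> {2..CARD('m) + 2}" for j
    proof -
      have "idx j \<in> - insert ?i \<tau>" unfolding compl using that by (rule imageI)
      then show ?thesis unfolding y by (intro \<mu>z) simp
    qed
    then show "k \<le> 0"
      using cond_ii[rule_format, of \<mu> y k] \<mu> zk by (simp add: M_eq y)
  qed
  fix \<alpha> :: "(complex, 'n) vec"
  assume \<alpha>: "rat_independent \<tau> \<alpha>" "\<And>j. j \<notin> \<tau> \<Longrightarrow> \<alpha> $ j = 0"
  define \<gamma> where "\<gamma> = of_int_mat A *v (of_nat_vec \<eta> + \<alpha>)"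
  define \<beta> where "\<beta> = of_int_mat A *v (of_nat_vec \<eta> + \<alpha> - axis ?i 1)"
  define F where "F = minimal_fake_exponents (- axis ?i 1) A \<gamma>"
  have main: "complex_span {phi W A (u - axis ?i 1) | u. u \<in> {u \<in> F. u $ ?i = 0}} \<inter> dx W ?i ` Sol W A \<gamma> = {0}"
    if W: "open W" "W \<noteq> {}" and conv: "\<forall>v \<in> F \<union> minimal_fake_exponents (- axis ?i 1) A \<beta>. phi_converges_on W A v"
    for W
  proof (intro equalityI subsetI)
    fix \<Phi> assume "\<Phi> \<in> complex_span {phi W A (u - axis ?i 1) | u. u \<in> {u \<in> F. u $ ?i = 0}} \<inter> dx W ?i ` Sol W A \<gamma>"
    then obtain t r f where t: "finite t" "t \<subseteq> {phi W A (u - axis ?i 1) | u. u \<in> {u \<in> F. u $ ?i = 0}}"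
        and \<Phi>: "\<Phi> = (\<Sum>a\<in>t. (\<lambda>x. r a * a x))" and f: "f \<in> Sol W A \<gamma>" "\<Phi> = dx W ?i f"
      unfolding complex_span_def module.span_explicit[OF module_complex_functions] by auto
    \<comment> \<open>The span consists of combinations of functions, so one exponent is chosen per
      function; distinct functions then have distinct exponents.\<close>
    have "\<forall>a\<in>t. \<exists>u. u \<in> F \<and> u $ ?i = 0 \<and> phi W A (u - axis ?i 1) = a" using t(2) by blast
    then obtain U where U: "\<And>a. a \<in> t \<Longrightarrow> U a \<in> F" "\<And>a. a \<in> t \<Longrightarrow> U a $ ?i = 0"
        "\<And>a. a \<in> t \<Longrightarrow> phi W A (U a - axis ?i 1) = a" by metis
    have inj: "inj_on U t" using U(3) by (metis inj_onI)
    define c where "c v = r (phi W A (v - axis ?i 1))" for v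
    have sum: "\<Phi> z = (\<Sum>v\<in>U ` t. c v * phi W A (v - axis ?i 1) z)" for z
    proof -
      have "(\<Sum>a\<in>t. (\<lambda>x. r a * a x)) z = (\<Sum>a\<in>t. r a * a z)"
        using t(1) by induction auto
      then show ?thesis by (simp add: \<Phi> sum.reindex[OF inj] c_def U(3) del: One_nat_def)
    qed
    have "c v = 0" if "v \<in> U ` t" for v
    proof (rule coefficient_vanishes[OF setting \<alpha> \<gamma>_def W _ f(1) _ _ _ that])
      show "finite (U ` t)" using t(1) by (rule finite_imageI)
      show "phi_converges_on W A v" if "v \<in> minimal_fake_exponents (- axis ?i 1) A
          (of_int_mat A *v (of_nat_vec \<eta> + \<alpha> - axis ?i 1))" for v
        using conv that by (simp add: \<beta>_def)
      show "v \<in> minimal_fake_exponents (- axis ?i 1) A \<gamma> \<and> v $ ?i = 0" if "v \<in> U ` t" for v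
        using that U(1,2) by (auto simp: F_def)
      show "dx W ?i f z = (\<Sum>v\<in>U ` t. c v * phi W A (v - axis ?i 1) z)" for z
        using sum[of z] f(2) by simp
    qed
    then show "\<Phi> \<in> {0}" using sum by (auto simp: fun_eq_iff)
  next
    fix \<Phi> :: "(complex, 'n) vec \<Rightarrow> complex" assume "\<Phi> \<in> {0}"
    moreover have "dx W ?i 0 = 0" by (auto simp: dx_def zero_fun_def)
    then have "0 \<in> dx W ?i ` Sol W A \<gamma>" using zero_mem_Sol by (metis imageI)
    moreover have "0 \<in> complex_span {phi W A (u - axis ?i 1) | u. u \<in> {u \<in> F. u $ ?i = 0}}"
      unfolding complex_span_def by (rule module.span_zero[OF module_complex_functions])
    ultimately show "\<Phi> \<in> complex_span {phi W A (u - axis ?i 1) | u. u \<in> {u \<in> F. u $ ?i = 0}} \<inter>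
        dx W ?i ` Sol W A \<gamma>" by simp
  qed
  show "let w = - axis (idx 1) 1;
        \<gamma> = of_int_mat A *v (of_nat_vec \<eta> + \<alpha>);
        \<beta> = of_int_mat A *v (of_nat_vec \<eta> + \<alpha> - axis (idx 1) 1);
        F = minimal_fake_exponents w A \<gamma>;
        K = {u \<in> F. u $ idx 1 = 0}
    in \<forall>W. open W \<and> connected W \<and> W \<noteq> {} \<and>
         (\<forall>v \<in> F \<union> minimal_fake_exponents w A \<beta>. phi_converges_on W A v)
         \<longrightarrow> complex_span {phi W A (u - axis (idx 1) 1) | u. u \<in> K}
               \<inter> dx W (idx 1) ` Sol W A \<gamma> = {0}"
    unfolding Let_def \<gamma>_def[symmetric] \<beta>_def[symmetric] F_def[symmetric] using main by blast
qed

end
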